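(* Let $\beta\in(1,\infty)\setminus\{2,3,\dots\}$ and $\gamma=(\beta-1)\wedge2$. Let $\xi$ be a $\gamma$-stable spectrally negative Lévy process started from $1$ under $\mathbf P_1$. For $\delta\in(0,1)$ let $\tau_\delta=\inf\{s\ge0:\xi_s\le\delta\}$, and suppose that $$\forall\delta\in(0,1),\qquad 1=\mathbf E_1\Big[(\xi_{\tau_\delta})^{-\beta}\cdot\mathbf 1\Big\{|\Delta\xi_s|<\tfrac{\xi_{s-}}{2}\ :\ \forall s\le\tau_\delta\Big\}\Big].$$ Then necessarily $\beta=3/2$ or $\beta=5/2$.
   Context: $\Delta\xi_s=\xi_s-\xi_{s-}$. On the event in the indicator one has $\xi_{\tau_\delta}>\delta/2>0$; the integrand is $0$ off this event. The spectrally negative $\gamma$-stable process is normalized (for $\xi$ started from $x$ under $\mathbf P_x$, $\lambda\ge0$) by $\mathbf E_x[e^{\lambda(\xi_t-x)}]=e^{t\lambda^\gamma}$ if $\gamma\in(1,2]$ and $\mathbf E_x[e^{\lambda(\xi_t-x)}]=e^{-t\lambda^\gamma}$ if $\gamma\in(0,1)$. Thus for $\gamma\in(0,1)$ it is the opposite of a pure-jump stable subordinator with Lévy measure proportional to $|r|^{-\gamma-1}\mathbf 1_{r<0}dr$; for $\gamma\in(1,2)$ it is the centered process with no Brownian part and Lévy measure proportional to $|r|^{-\gamma-1}\mathbf 1_{r<0}dr$; for $\gamma=2$ it is $\sqrt2$ times a standard linear Brownian motion. *)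

theory Defs
  imports "HOL-Probability.Probability"
begin

definition cadlag :: "(real \<Rightarrow> real) \<Rightarrow> bool" where
  "cadlag f \<longleftrightarrow>
     (\<forall>t\<ge>0. (f \<longlongrightarrow> f t) (at_right t)) \<and> (\<forall>t>0. \<exists>l. (f \<longlongrightarrow> l) (at_left t))"

(* Paths live on [0,\<infinity>), hence the usual convention f(0-) = f(0), i.e. no jump at time 0. *)
definition left_limit :: "(real \<Rightarrow> real) \<Rightarrow> real \<Rightarrow> real" where
  "left_limit f t = (if t \<le> 0 then f 0 else Lim (at_left t) f)"

definition jump :: "(real \<Rightarrow> real) \<Rightarrow> real \<Rightarrow> real" where
  "jump f t = f t - left_limit f t"

(* Extended-real valued, so that the infimum of the empty set is \<infinity>. *)
definition passage_time :: "(real \<Rightarrow> real) \<Rightarrow> real \<Rightarrow> ereal" where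
  "passage_time f \<delta> = (INF s\<in>{s. 0 \<le> s \<and> f s \<le> \<delta>}. ereal s)"

locale levy_process = prob_space M for M :: "'a measure" +
  fixes X :: "real \<Rightarrow> 'a \<Rightarrow> real" and x :: real
  assumes measurable_process: "\<And>t. 0 \<le> t \<Longrightarrow> X t \<in> borel_measurable M"
    and start: "AE \<omega> in M. X 0 \<omega> = x"
    and cadlag_paths: "AE \<omega> in M. cadlag (\<lambda>t. X t \<omega>)"
    and independent_increments:
      "\<And>(n::nat) t. 0 \<le> t 0 \<Longrightarrow> (\<And>i. i < n \<Longrightarrow> t i \<le> t (Suc i)) \<Longrightarrow>
         indep_vars (\<lambda>_. borel) (\<lambda>i \<omega>. X (t (Suc i)) \<omega> - X (t i) \<omega>) {..<n}"
    and stationary_increments: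
      "\<And>s t. 0 \<le> s \<Longrightarrow> 0 \<le> t \<Longrightarrow>
         distr M borel (\<lambda>\<omega>. X (s + t) \<omega> - X s \<omega>) = distr M borel (\<lambda>\<omega>. X t \<omega> - X 0 \<omega>)"

(* Stability is self-similarity with index \<gamma>; since the increments are stationary and independent,
   it suffices to state it for the one-dimensional marginals.  No positive jumps includes the
   continuous case \<gamma> = 2.  The last assumption fixes the normalization; with \<gamma> < 1 the process is
   the negative of a subordinator, whence the sign.  A non-integrable exponential would have
   integral 0, so finiteness of the exponential moments is part of that assumption. *)
locale spectrally_negative_stable_process = levy_process M X x
  for M :: "'a measure" and X :: "real \<Rightarrow> 'a \<Rightarrow> real" and x :: real +
  fixes \<gamma> :: real
  assumes index: "\<gamma> \<in> {0<..2} - {1}"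
    and no_positive_jumps: "AE \<omega> in M. \<forall>t>0. jump (\<lambda>t. X t \<omega>) t \<le> 0"
    and stable:
      "\<And>c t. 0 < c \<Longrightarrow> 0 \<le> t \<Longrightarrow>
         distr M borel (\<lambda>\<omega>. X (c * t) \<omega> - X 0 \<omega>) =
         distr M borel (\<lambda>\<omega>. c powr (1 / \<gamma>) * (X t \<omega> - X 0 \<omega>))"
    and laplace:
      "\<And>t l. 0 \<le> t \<Longrightarrow> 0 \<le> l \<Longrightarrow>
         expectation (\<lambda>\<omega>. exp (l * (X t \<omega> - x))) =
         (if 1 < \<gamma> then exp (t * l powr \<gamma>) else exp (- t * l powr \<gamma>))"

end

theory Submission
  imports Defs "HOL-Real_Asymp.Real_Asymp"
begin

text \<open>
  Let \<open>h(x) = x powr -\<beta>\<close>. By scaling, the generator of \<open>\<xi>\<close> killed at its first jump of relative size at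
  least one half maps \<open>h\<close> to \<open>F x powr (-\<beta> - \<gamma>)\<close> for a constant \<open>F\<close>. For \<open>\<beta> < 3\<close> one has
  \<open>\<gamma> = \<beta> - 1\<close>, and \<open>F\<close> is up to a positive factor the finite part of the integral of
  \<open>(r (1 - r)) powr -\<beta>\<close> over \<open>(0, 1/2)\<close>. Integrating the derivatives of \<open>(2 r - 1) (r (1 - r)) powr -s\<close>
  reduces the exponent to one in \<open>(0, 1)\<close>, where the integral converges and is positive; this exhibits \<open>F\<close>
  as a positive multiple of \<open>4 \<beta> - 6\<close>, times \<open>4 \<beta> - 10\<close> if \<open>\<beta> > 2\<close>. For \<open>\<beta> > 3\<close> the process is Brownian
  and \<open>F = \<beta> (\<beta> + 1)\<close>. If \<open>F \<noteq> 0\<close>, then \<open>h\<close> evaluated along the killed process, stopped at the passage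
  below \<open>1/2\<close>, is a strict sub- or supermartingale, so that the expectation differs from \<open>1\<close>.

  No stochastic calculus is used: the process is sampled on dyadic grids, and the killing indicator
  is replaced by a continuous cutoff of the ratio of consecutive values, chosen above or below the
  indicator of \<open>(1/2, \<infinity>)\<close> according to the sign of \<open>F\<close>. One-sided pathwise limits then suffice.
\<close>

subsection \<open>The constant \<open>F\<close>\<close>

text \<open>The law is known only through its Laplace transform, so the generator at 1 is found as
  the derivative at time 0 of expectations. The bridge is that second differences of
  \<open>l powr \<gamma>\<close> in \<open>l\<close> are, up to sign and a constant, the moments of
  (1 - exp (-r))^2 r^(-\<beta>) dr carried to u = exp (-r). The indicator of ratios above 1/2 is an
  obstacle twice: its discontinuity escapes polynomial approximation, and grid ratios tending to
  exactly 1/2 may fall on either side. A ramp placed near 1/2 on one side changes F by an error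
  proportional to its distance, so the sign survives, and the choice of side decides every
  borderline jump. If F > 0 the ramp starts above 1/2: the sampled mean exceeds 1 by a fixed amount,
  while pathwise the sampled value is asymptotically at most the true one. If F < 0 both
  inequalities are reversed. The fixed amount is collected in a short initial period in which the
  path is close to 1. It is thus independent of the time horizon, which must grow with the grid
  since the passage time is finite only almost surely.\<close>

lemma antiderivative_deriv:
  fixes r s :: real
  assumes "0 < r" "r < 1"
  shows "((\<lambda>r. (2*r-1) * (r powr (-s) * (1-r) powr (-s))) has_real_derivative
     (2 - 4 * s) * (r powr (-s) * (1-r) powr (-s)) + s * (r powr (-s-1) * (1-r) powr (-s-1))) (at r)"
proof -
  have e: "r powr (-s) = r * r powr (-s-1)" "(1-r) powr (-s) = (1-r) * (1-r) powr (-s-1)"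
    using assms by (auto simp: powr_mult_base)
  have A: "((\<lambda>r. r powr (-s)) has_real_derivative (-s) * r powr (-s-1)) (at r)"
    using has_real_derivative_powr[OF assms(1), of "-s"] by simp
  have "((\<lambda>r. 1 - r) has_real_derivative (-1)) (at r)"
    by (auto intro!: derivative_eq_intros)
  from DERIV_fun_powr[OF this, of "-s"]
  have B: "((\<lambda>r. (1-r) powr (-s)) has_real_derivative s * (1-r) powr (-s-1)) (at r)"
    using assms by simp
  have C: "((\<lambda>r. 2*r-1) has_real_derivative 2) (at r)"
    by (auto intro!: derivative_eq_intros)
  note D = DERIV_mult[OF C DERIV_mult[OF A B]]
  show ?thesis
  proof (rule DERIV_cong[OF D])
    \<comment> \<open>With w = r (1 - r), the identity (2 r - 1)^2 = 1 - 4 w splits the product-rule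
      term s (2 r - 1)^2 w^(-s-1) into the exponents -s-1 and -s. This is the reduction of the
      exponent, with factor 2 - 4 s.\<close>
    define a c where ac: "a = r powr (-s-1)" "c = (1-r) powr (-s-1)"
    show "2 * (r powr (-s) * (1-r) powr (-s)) +
      ((-s) * r powr (-s-1) * (1-r) powr (-s) + s * (1-r) powr (-s-1) * r powr (-s)) * (2*r-1) =
      (2 - 4 * s) * (r powr (-s) * (1-r) powr (-s)) + s * (r powr (-s-1) * (1-r) powr (-s-1))"
      unfolding e unfolding ac[symmetric] by (simp add: algebra_simps)
  qed
qed

text \<open>Finite part for \<open>b < 2\<close>: near 0 the product behaves like
  \<open>- r powr (1-b)\<close>, which the added power cancels, leaving order
  \<open>r powr (2-b)\<close>. Hence there is no boundary term at 0.\<close>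

lemma antiderivative_at_0_low: fixes b::real assumes "1<b" "b<2" shows
 "((\<lambda>r. ((2*r-1) * (r powr (1-b) * (1-r) powr (1-b)) + r powr (1-b)) / (b-1)) \<longlongrightarrow> 0) (at_right 0)"
  using assms by real_asymp

text \<open>Two reductions leave two singular orders, \<open>r powr (1-b)\<close> and
  \<open>r powr (2-b)\<close>. The last two summands cancel them; they are a primitive of minus the
  compensator \<open>(1 + b*r) * r powr (-b)\<close>. The remainder has order
  \<open>r powr (3-b)\<close>.\<close>

lemma antiderivative_at_0_high: fixes b::real assumes "2<b" "b<3" shows
 "((\<lambda>r. (2*r-1) * (r powr (1-b) * (1-r) powr (1-b))/(b-1) + (4*b-6)/((b-1)*(b-2)) * ((2*r-1) * (r powr (2-b) * (1-r) powr (2-b))) + r powr (1-b)/(b-1) + b * r powr (2-b)/(b-2)) \<longlongrightarrow> 0) (at_right 0)"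
proof -
  \<comment> \<open>Taylor remainder quotients; \<open>cl\<close> below states that the coefficients
    of \<open>r powr (2-b)\<close> add up to 0.\<close>
  define E1 where "E1 = (\<lambda>r::real. ((1-r) powr (1-b) - 1 - (b-1)*r) / r^2)"
  define E2 where "E2 = (\<lambda>r::real. ((1-r) powr (2-b) - 1) / r)"
  have E1: "(E1 \<longlongrightarrow> b*(b-1)/2) (at_right 0)"
    unfolding E1_def using assms by (real_asymp simp: field_simps)
  have E2: "(E2 \<longlongrightarrow> b-2) (at_right 0)"
    unfolding E2_def using assms by (real_asymp simp: field_simps)
  define c where "c = (4*b-6)/((b-1)*(b-2))"
  have cl: "(3-b)/(b-1) - c + b/(b-2) = 0"
  proof -
    define q where "q = b - 2"
    have b: "b = q + 2" "q > 0" using assms by (auto simp: q_def)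
    show ?thesis unfolding c_def b(1) using b(2) by (simp add: divide_simps) (simp add: algebra_simps)
  qed
  let ?B = "\<lambda>r. r powr (3-b) * ((2*r-1) * E1 r/(b-1) + 2 + c * ((2*r-1) * E2 r + 2))"
  have "(?B \<longlongrightarrow> 0 * ((2*0-1) * (b*(b-1)/2)/(b-1) + 2 + c * ((2*0-1) * (b-2) + 2))) (at_right 0)"
    by (intro tendsto_intros E1 E2) (use assms in \<open>real_asymp | simp\<close>)+
  moreover have "eventually (\<lambda>r. ?B r = (2*r-1) * (r powr (1-b) * (1-r) powr (1-b))/(b-1) + c * ((2*r-1) * (r powr (2-b) * (1-r) powr (2-b))) + r powr (1-b)/(b-1) + b * r powr (2-b)/(b-2)) (at_right 0)"
    using eventually_at_right_less[of 0]
  proof eventually_elim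
    case (elim r)
    have p: "r powr (3-b) = r^2 * r powr (1-b)" "r powr (2-b) = r * r powr (1-b)"
      using elim by (simp_all flip: powr_add powr_numeral add: powr_mult_base)
    have x: "(1-r) powr (1-b) = 1 + (b-1)*r + r^2 * E1 r" "(1-r) powr (2-b) = 1 + r * E2 r"
      using elim by (simp_all add: E1_def E2_def)
    have bb: "b / (b-2) = c - (3-b)/(b-1)" using cl by simp
    have "(2*r-1) * (r powr (1-b) * (1-r) powr (1-b))/(b-1) + c * ((2*r-1) * (r powr (2-b) * (1-r) powr (2-b))) + r powr (1-b)/(b-1) + b * r powr (2-b)/(b-2)
      = r powr (1-b) * ((2*r-1) * (1 + (b-1)*r + r^2 * E1 r)/(b-1) + c * ((2*r-1) * (r * (1 + r * E2 r))) + 1/(b-1) + (b/(b-2)) * r)"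
      unfolding x p by (simp add: algebra_simps add_divide_distrib diff_divide_distrib)
    also have "\<dots> = r powr (1-b) * (r^2 * ((2*r-1) * E1 r/(b-1) + 2 + c * ((2*r-1) * E2 r + 2)))"
    proof -
      define i where "i = 1 / (b-1)"
      have i: "(b-1) * i = 1" using assms by (simp add: i_def)
      have "(2*r-1) * (1 + (b-1)*r + r^2 * E1 r) * i + c * ((2*r-1) * (r * (1 + r * E2 r))) + i + (c - (3-b) * i) * r
        = r^2 * ((2*r-1) * E1 r * i + 2 + c * ((2*r-1) * E2 r + 2))"
        using i by algebra
      then show ?thesis unfolding bb i_def by simp
    qed
    finally show ?case unfolding p by simp
  qed
  ultimately show ?thesis unfolding c_def by (subst (asm) filterlim_cong[OF refl refl]) auto
qed

text \<open>Put u = exp y: the power contributes \<open>b*(b+1)/2\<close> to the coefficient of y^2,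
  and b (exp y - 1 - y) contributes \<open>b/2\<close>.\<close>

lemma second_order_quotient_at_1: fixes b::real assumes "0<b" shows
 "((\<lambda>u. ((1+ln u) powr (-b) - 1 + b*(u-1)) / (1-u)^2) \<longlongrightarrow> b*(b+2)/2) (at 1)"
proof -
  have "((\<lambda>u. ((1+ln u) powr (-b) - 1 + b*(u-1)) / (1-u)^2) \<longlongrightarrow> b/2 - (-b-1)*b/2) (at 1)"
    using assms by real_asymp
  moreover have "b/2 - (-b-1)*b/2 = b*(b+2)/2" by (simp add: field_simps)
  ultimately show ?thesis by simp
qed

text \<open>Since \<open>(1-r) powr (-b)\<close> is 1 + b r + O(r^2), this is what has to be
  subtracted for integrability against \<open>r powr (-b)\<close> at 0. The linear term reflects the
  centering of the process, present when \<gamma> = b - 1 exceeds 1.\<close>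

definition lcomp :: "real \<Rightarrow> real \<Rightarrow> real" where
  "lcomp b r = 1 + (if 2 < b then b * r else 0)"

text \<open>Integrand of F at the starting point 1: a downward jump of size r has density
  r^(-\<gamma>-1) = r^(-b) up to a constant, and a jump of size at least 1/2 kills, so that only the
  compensator remains.\<close>

definition jump_kernel :: "real \<Rightarrow> real \<Rightarrow> real" where
  "jump_kernel b r = ((if r < 1/2 then (1-r) powr (-b) else 0) - lcomp b r) * r powr (-b)"

text \<open>The boundary value \<open>v\<close> of the primitive at 1/2 is also the mass of the
  compensator beyond 1/2, so the two cancel and only the reduced integral survives. The signs of
  \<open>p\<close> and \<open>q\<close> give absolute integrability, hence Lebesgue
  integrals.\<close>

lemma integral_split_at_half:
  fixes p q w k :: "real \<Rightarrow> real"
  assumes L: "((\<lambda>r. p r - c * w r) has_integral v) {0..1/2}"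
    and R: "(q has_integral v) {1/2..}" and W: "(w has_integral J) {0..1/2}"
    and p0: "\<And>r. 0 < r \<Longrightarrow> r < 1/2 \<Longrightarrow> 0 \<le> p r" and q0: "\<And>r. 1/2 \<le> r \<Longrightarrow> 0 \<le> q r"
    and k: "\<And>r. 0 < r \<Longrightarrow> k r = (if r < 1/2 then p r else - q r)" and [measurable]: "k \<in> borel_measurable borel"
  shows "set_integrable lborel {0<..} k" "(LBINT r:{0<..}. k r) = c * J"
proof -
  have P: "(p has_integral (v + c * J)) {0..1/2}"
    using has_integral_add[OF L has_integral_mult_right[OF W, of c]] by simp
  have P': "(k has_integral (v + c * J)) {0<..<1/2}"
  proof -
    have "(p has_integral (v + c * J)) {0<..<1/2}"
      using P has_integral_Icc_iff_Ioo by blast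
    then show ?thesis by (rule has_integral_eq[rotated]) (use k in auto)
  qed
  have R': "(k has_integral (- v)) {1/2..}"
    using has_integral_neg[OF R] by (rule has_integral_eq[rotated]) (use k in auto)
  have U: "{0<..} = {0<..<1/2} \<union> {1/2::real..}" by auto
  have tot: "(k has_integral (v + c * J + - v)) ({0<..<1/2} \<union> {1/2..})"
  proof (rule has_integral_Un[OF P' R'])
    have "{0<..<1/2} \<inter> {1/2::real..} = {}" by auto
    then show "negligible ({0<..<1/2} \<inter> {1/2::real..})" by simp
  qed
  have a1: "k absolutely_integrable_on {0<..<1/2}"
    by (rule nonnegative_absolutely_integrable_1) (use P' k p0 in auto)
  have "(\<lambda>r. - k r) absolutely_integrable_on {1/2..}"
    by (rule nonnegative_absolutely_integrable_1) (use has_integral_neg[OF R'] k q0 in auto)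
  then have a2: "k absolutely_integrable_on {1/2..}"
    by (auto simp: absolutely_integrable_on_def dest: integrable_neg)
  have a: "set_integrable lebesgue {0<..} k" unfolding U
    by (rule set_integrable_Un[OF a1 a2]) auto
  show i: "set_integrable lborel {0<..} k"
  proof -
    have "(\<lambda>r. indicator {0<..} r *\<^sub>R k r) \<in> borel_measurable lborel" by measurable
    from integrable_completion[OF this] show ?thesis using a unfolding set_integrable_def by blast
  qed
  show "(LBINT r:{0<..}. k r) = c * J"
    using set_borel_integral_eq_integral(2)[OF i] integral_unique[OF tot[folded U]] by simp
qed

lemma beta_half_integral:
  fixes t :: real assumes "0 \<le> t" "t < 1"
  obtains J where "((\<lambda>r. r powr (-t) * (1-r) powr (-t)) has_integral J) {0..1/2}" "J > 0"
proof -
  let ?w = "\<lambda>r::real. r powr (-t) * (1-r) powr (-t)"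
  have "(\<lambda>r::real. r powr (-t)) integrable_on {0..1/2}"
    by (rule integrable_on_powr_from_0) (use assms in auto)
  then have g: "(\<lambda>r::real. 2 * r powr (-t)) integrable_on {0..1/2}"
    unfolding integrable_on_def using has_integral_mult_right[where c="2::real"] by blast
  have i: "?w integrable_on {0..1/2}"
  proof (rule measurable_bounded_by_integrable_imp_integrable[OF _ g])
    have "?w \<in> borel_measurable lborel" by measurable
    then show "?w \<in> borel_measurable (lebesgue_on {0..1/2})"
      using measurable_completion measurable_restrict_space1 by blast
    fix r :: real assume r: "r \<in> {0..1/2}"
    have "(1-r) powr (-t) \<le> (1/2) powr (-t)"
      using r assms by (intro powr_mono2') auto
    also have "\<dots> = 2 powr t" by (simp add: powr_divide powr_minus field_simps)
    also have "\<dots> \<le> 2 powr 1" using assms by (intro powr_mono) auto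
    finally have "(1-r) powr (-t) \<le> 2" by simp
    then have "?w r \<le> r powr (-t) * 2" by (intro mult_left_mono) auto
    then show "norm (?w r) \<le> 2 * r powr (-t)" by simp
  qed auto
  have "((\<lambda>r. 1::real) has_integral (1/2)) {0<..<1/2::real}"
    unfolding has_integral_Icc_iff_Ioo[symmetric] using has_integral_const_real[of "1::real" 0 "1/2"] by simp
  moreover have "(?w has_integral integral {0..1/2} ?w) {0<..<1/2}"
    using i integrable_integral has_integral_Icc_iff_Ioo by blast
  ultimately have "1/2 \<le> integral {0..1/2} ?w"
  proof (rule has_integral_le)
    fix r :: real assume r: "r \<in> {0<..<1/2}"
    have "1 \<le> r powr (-t)" "1 \<le> (1-r) powr (-t)"
      using r assms powr_mono'[of "-t" 0 r] powr_mono'[of "-t" 0 "1-r"] by auto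
    then show "1 \<le> ?w r" using r mult_mono[of 1 "r powr (-t)" 1 "(1-r) powr (-t)"] by simp
  qed
  then show ?thesis using i by (intro that[of "integral {0..1/2} ?w"]) auto
qed

text \<open>\<open>f'\<close> may be unbounded near 0; continuity of the primitive, extended by 0,
  is enough at that endpoint.\<close>

lemma ftc_from_0:
  fixes f f' :: "real \<Rightarrow> real"
  assumes lim: "(f \<longlongrightarrow> 0) (at_right 0)"
    and d: "\<And>r. 0 < r \<Longrightarrow> r < 1 \<Longrightarrow> (f has_real_derivative f' r) (at r)"
  shows "(f' has_integral f (1/2)) {0..1/2}"
proof -
  define g where "g = (\<lambda>r. if r \<le> 0 then 0 else f r)"
  have dg: "(g has_real_derivative f' r) (at r)" if "0 < r" "r < 1" for r
  proof (rule DERIV_cong_ev[THEN iffD1, OF refl _ refl d[OF that]])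
    show "eventually (\<lambda>x. f x = g x) (nhds r)"
      using eventually_nhds_in_open[of "{0<..}" r] that by (auto simp: g_def elim!: eventually_mono)
  qed
  have "continuous_on {0..1/2} g"
    unfolding continuous_on_eq_continuous_within
  proof
    fix r :: real assume r: "r \<in> {0..1/2}"
    show "continuous (at r within {0..1/2}) g"
    proof (cases "r = 0")
      case True
      have "(g \<longlongrightarrow> 0) (at_right 0)"
        by (rule Lim_transform_eventually[OF lim]) (auto simp: g_def eventually_at_filter)
      moreover have "g 0 = 0" by (simp add: g_def)
      moreover have "at (0::real) within {0..1/2} = at_right 0"
        by (rule at_within_Icc_at_right) simp
      ultimately show ?thesis unfolding True continuous_within by simp
    next
      case False
      then have "isCont g r" using r dg[of r] DERIV_isCont by auto
      then show ?thesis by (rule continuous_at_imp_continuous_at_within)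
    qed
  qed
  then have "(f' has_integral (g (1/2) - g 0)) {0..1/2}"
    by (intro fundamental_theorem_of_calculus_interior)
       (simp_all add: dg flip: has_real_derivative_iff_has_vector_derivative)
  then show ?thesis by (simp add: g_def)
qed

lemma jump_kernel_measurable [measurable]: "jump_kernel b \<in> borel_measurable borel"
  unfolding jump_kernel_def lcomp_def by measurable

lemma one_minus_powr_ge:
  fixes b r :: real assumes "0 < b" "0 < r" "r < 1"
  shows "1 + b * r \<le> (1-r) powr (-b)"
proof -
  have "1 + b * r \<le> exp (b * r)" using exp_ge_add_one_self by simp
  also have "\<dots> \<le> exp (-b * ln (1-r))"
    using assms ln_le_minus_one[of "1-r"] mult_left_mono[of r "- ln (1-r)" b] by simp
  also have "\<dots> = (1-r) powr (-b)" using assms by (simp add: powr_def)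
  finally show ?thesis .
qed

text \<open>One reduction, with \<open>s = b-1\<close>, brings the exponent into (0, 1); its factor
  2 - 4 s produces \<open>4*b-6\<close> and hence the zero 3/2.\<close>

lemma jump_kernel_integral_1:
  fixes b :: real assumes "1 < b" "b < 2"
  obtains J where "J > 0" "set_integrable lborel {0<..} (jump_kernel b)"
    "(LBINT r:{0<..}. jump_kernel b r) = (4*b-6)/(b-1) * J"
proof -
  obtain J where J: "((\<lambda>r. r powr (-(b-1)) * (1-r) powr (-(b-1))) has_integral J) {0..1/2}" "J > 0"
    using beta_half_integral[of "b-1"] assms by auto
  let ?f = "\<lambda>r::real. ((2*r-1) * (r powr (1-b) * (1-r) powr (1-b)) + r powr (1-b)) / (b-1)"
  let ?p = "\<lambda>r::real. ((1-r) powr (-b) - 1) * r powr (-b)"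
  have L: "((\<lambda>r. ?p r - (4*b-6)/(b-1) * (r powr (-(b-1)) * (1-r) powr (-(b-1)))) has_integral ?f (1/2)) {0..1/2}"
  proof (rule ftc_from_0[OF antiderivative_at_0_low[OF assms]])
    fix r :: real assume r: "0 < r" "r < 1"
    have e: "- (b-1) - 1 = -b" "- (b-1) = 1 - b" by auto
    have D: "((\<lambda>r. r powr (1-b)) has_real_derivative (1-b) * r powr (-b)) (at r)"
      using has_real_derivative_powr[OF r(1), of "1-b"] by (simp add: algebra_simps)
    show "(?f has_real_derivative ?p r - (4*b-6)/(b-1) * (r powr (-(b-1)) * (1-r) powr (-(b-1)))) (at r)"
      apply (rule DERIV_cong[OF DERIV_cdivide[OF DERIV_add[OF antiderivative_deriv[OF r, of "b-1"] D, unfolded e], of "b-1"]])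
      using assms by (simp add: e field_simps)
  qed
  \<comment> \<open>At 1/2 the factor \<open>2*r-1\<close> vanishes, so \<open>?f (1/2)\<close>
    consists of the compensator part alone.\<close>
  have R: "((\<lambda>r. r powr (-b)) has_integral ?f (1/2)) {1/2..}"
    using has_integral_powr_to_inf[of "-b" "1/2"] assms
    by (simp add: minus_divide_right[of _ "1-b"])
  show ?thesis
  proof (rule that[OF J(2)])
    have k: "jump_kernel b r = (if r < 1/2 then ?p r else - (r powr (-b)))" if "0 < r" for r
      using assms by (simp add: jump_kernel_def lcomp_def algebra_simps)
    have p: "0 \<le> ?p r" if "0 < r" "r < 1/2" for r
    proof -
      have "1 \<le> (1-r) powr (-b)"
        using one_minus_powr_ge[of b r] mult_pos_pos[of b r] assms that by linarith
      then show ?thesis by simp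
    qed
    have q: "0 \<le> r powr (-b)" if "1/2 \<le> r" for r by simp
    note G = integral_split_at_half[OF L R J(1) p q k jump_kernel_measurable]
    show "set_integrable lborel {0<..} (jump_kernel b)" by (rule G(1))
    show "(LBINT r:{0<..}. jump_kernel b r) = (4*b-6)/(b-1) * J" by (rule G(2))
  qed
qed

text \<open>After one reduction the exponent \<open>b-1\<close> still exceeds 1. The second one,
  with \<open>s = b-2\<close>, produces the factor \<open>4*b-10\<close> and hence the zero
  5/2.\<close>

lemma jump_kernel_integral_2:
  fixes b :: real assumes "2 < b" "b < 3"
  obtains J where "J > 0" "set_integrable lborel {0<..} (jump_kernel b)"
    "(LBINT r:{0<..}. jump_kernel b r) = (4*b-6)*(4*b-10)/((b-1)*(b-2)) * J"
proof -
  obtain J where J: "((\<lambda>r. r powr (-(b-2)) * (1-r) powr (-(b-2))) has_integral J) {0..1/2}" "J > 0"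
    using beta_half_integral[of "b-2"] assms by auto
  let ?c = "(4*b-6)/((b-1)*(b-2))"
  let ?f = "\<lambda>r::real. (2*r-1) * (r powr (1-b) * (1-r) powr (1-b))/(b-1) + ?c * ((2*r-1) * (r powr (2-b) * (1-r) powr (2-b))) + r powr (1-b)/(b-1) + b * r powr (2-b)/(b-2)"
  let ?p = "\<lambda>r::real. ((1-r) powr (-b) - (1 + b * r)) * r powr (-b)"
  have L: "((\<lambda>r. ?p r - (4*b-6)*(4*b-10)/((b-1)*(b-2)) * (r powr (-(b-2)) * (1-r) powr (-(b-2)))) has_integral ?f (1/2)) {0..1/2}"
  proof (rule ftc_from_0[OF antiderivative_at_0_high[OF assms]])
    fix r :: real assume r: "0 < r" "r < 1"
    have e: "- (b-1) - 1 = -b" "- (b-1) = 1 - b" "- (b-2) - 1 = 1-b" "- (b-2) = 2 - b"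
      "1 - b - 1 = - b" "2 - b - 1 = 1 - b" by auto
    have D1: "((\<lambda>r. r powr (1-b)) has_real_derivative (1-b) * r powr (-b)) (at r)"
      using has_real_derivative_powr[OF r(1), of "1-b"] by (simp add: algebra_simps)
    have D2: "((\<lambda>r. r powr (2-b)) has_real_derivative (2-b) * (r * r powr (-b))) (at r)"
      using has_real_derivative_powr[OF r(1), of "2-b"] r by (simp add: powr_mult_base)
    define U V W Y where d: "U = r powr (-b) * (1-r) powr (-b)" "V = r powr (1-b) * (1-r) powr (1-b)"
      "W = r powr (2-b) * (1-r) powr (2-b)" "Y = r powr (-b)"
    note D = DERIV_add[OF DERIV_add[OF DERIV_add[OF DERIV_cdivide[OF antiderivative_deriv[OF r, of "b-1"], of "b-1"]
       DERIV_cmult[OF antiderivative_deriv[OF r, of "b-2"], of ?c]] DERIV_cdivide[OF D1, of "b-1"]] DERIV_cdivide[OF DERIV_cmult[OF D2, of b], of "b-2"]]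
    define q where "q = b - 2"
    have b: "b = q + 2" "q > 0" using assms by (auto simp: q_def)
    have "((2 - 4 * (b-1)) * V + (b-1) * U)/(b-1) + ?c * ((2 - 4 * (b-2)) * W + (b-2) * V) + (1-b) * Y/(b-1) + b * ((2-b) * (r * Y))/(b-2)
      = U - (1 + b*r) * Y - (4*b-6)*(4*b-10)/((b-1)*(b-2)) * W"
      unfolding b(1) using b(2) by (simp add: divide_simps) (simp add: algebra_simps)
    also have "U - (1 + b*r) * Y = ((1-r) powr (-b) - (1 + b*r)) * Y"
      by (simp add: d algebra_simps)
    finally have m: "((2 - 4 * (b-1)) * V + (b-1) * U)/(b-1) + ?c * ((2 - 4 * (b-2)) * W + (b-2) * V) + (1-b) * Y/(b-1) + b * ((2-b) * (r * Y))/(b-2)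
      = ((1-r) powr (-b) - (1 + b*r)) * Y - (4*b-6)*(4*b-10)/((b-1)*(b-2)) * W" .
    show "(?f has_real_derivative ?p r - (4*b-6)*(4*b-10)/((b-1)*(b-2)) * (r powr (-(b-2)) * (1-r) powr (-(b-2)))) (at r)"
      unfolding e by (rule DERIV_cong[OF D[unfolded e] m[unfolded d]])
  qed
  have R: "((\<lambda>r. (1 + b*r) * r powr (-b)) has_integral ?f (1/2)) {1/2..}"
  proof -
    have "((\<lambda>r. r powr (-b) + b * r powr (1-b)) has_integral ?f (1/2)) {1/2..}"
      using has_integral_add[OF has_integral_powr_to_inf[of "-b" "1/2"] has_integral_mult_right[OF has_integral_powr_to_inf[of "1-b" "1/2"], of b]] assms
      by (simp add: field_simps)
    then show ?thesis
      by (rule has_integral_eq[rotated]) (auto simp: algebra_simps powr_mult_base)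
  qed
  show ?thesis
  proof (rule that[OF J(2)])
    have k: "jump_kernel b r = (if r < 1/2 then ?p r else - ((1 + b*r) * r powr (-b)))" if "0 < r" for r
      using assms by (simp add: jump_kernel_def lcomp_def algebra_simps)
    have p: "0 \<le> ?p r" if "0 < r" "r < 1/2" for r
      using one_minus_powr_ge[of b r] assms that by (intro mult_nonneg_nonneg) auto
    have q: "0 \<le> (1 + b*r) * r powr (-b)" if "1/2 \<le> r" for r
      using that assms by simp
    note G = integral_split_at_half[OF L R J(1) p q k jump_kernel_measurable]
    show "set_integrable lborel {0<..} (jump_kernel b)" by (rule G(1))
    show "(LBINT r:{0<..}. jump_kernel b r) = (4*b-6)*(4*b-10)/((b-1)*(b-2)) * J" by (rule G(2))
  qed
qed

subsection \<open>Small-time asymptotics of infinitely divisible laws\<close>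

lemma exp_diff_quotient: "((\<lambda>e. (exp (a * e) - 1) / e) \<longlongrightarrow> (a::real)) (at_right 0)"
proof -
  have "((\<lambda>e::real. exp (a * e)) has_real_derivative a) (at 0)"
    by (auto intro!: derivative_eq_intros)
  then have "((\<lambda>e. (exp (a * e) - 1) / e) \<longlongrightarrow> a) (at 0)"
    by (simp add: has_field_derivative_iff)
  then show ?thesis by (rule filterlim_mono) (auto simp: at_le)
qed

text \<open>
  The measures \<open>(1 - exp y)\<^sup>2 \<mu>\<^sub>e(dy) / e\<close>, seen through \<open>u = exp y\<close>, have convergent moments; on \<open>[0, 2]\<close> the
  test function is approximated by polynomials, and the mass of \<open>u > 2\<close> is exponentially small by
  a Chernoff bound with parameter \<open>e powr (-1/\<gamma>)\<close>.
\<close>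

lemma exp_moment_convergence:
  fixes \<mu> :: "real \<Rightarrow> real measure" and s \<gamma> Q :: real and N :: "real measure" and q :: "real \<Rightarrow> real"
  assumes pr: "\<And>e. 0 < e \<Longrightarrow> prob_space (\<mu> e)" and sets: "\<And>e. sets (\<mu> e) = sets borel"
    and lap: "\<And>e l. 0 < e \<Longrightarrow> 0 \<le> l \<Longrightarrow> (\<integral>y. exp (l * y) \<partial>\<mu> e) = exp (s * l powr \<gamma> * e)"
    and \<gamma>: "0 < \<gamma>"
    and N: "finite_measure N" and setsN: "sets N = sets borel" and AEN: "AE u in N. 0 \<le> u \<and> u \<le> 1"
    and mom: "\<And>k::nat. (\<integral>u. u ^ k \<partial>N) = s * (real (k+2) powr \<gamma> - 2 * real (k+1) powr \<gamma> + real k powr \<gamma>)"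
    and q: "continuous_on {0..} q" "\<And>u. 0 \<le> u \<Longrightarrow> \<bar>q u\<bar> \<le> Q" and qm [measurable]: "q \<in> borel_measurable borel"
  shows "((\<lambda>e. (\<integral>y. (1 - exp y)^2 * q (exp y) \<partial>\<mu> e) / e) \<longlongrightarrow> (\<integral>u. q u \<partial>N)) (at_right 0)"
proof -
  note [measurable_cong] = sets setsN
  interpret N: finite_measure N by fact
  have int: "integrable (\<mu> e) (\<lambda>y. exp (l * y))" if "0 < e" "0 \<le> l" for e l
    using lap[OF that] not_integrable_integral_eq by fastforce
  have expk: "exp (real k * y) = exp y ^ k" for k y by (simp add: exp_of_nat_mult)
  \<comment> \<open>The weight is a second difference in the exponent, so its moments are
    combinations of the given Laplace transform.\<close>
  have wexp: "(1 - exp y)^2 * exp y ^ k = exp (real (k+2) * y) - 2 * exp (real (k+1) * y) + exp (real k * y)" for k and y :: real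
    unfolding expk by (simp add: power2_eq_square algebra_simps)
  have Wint: "integrable (\<mu> e) (\<lambda>y. (1 - exp y)^2 * exp y ^ k)" if "0 < e" for e k
    unfolding wexp using that by (intro Bochner_Integration.integrable_add Bochner_Integration.integrable_diff integrable_mult_right int) auto
  define W where "W k e = (\<integral>y. (1 - exp y)^2 * exp y ^ k \<partial>\<mu> e)" for k e
  define m where "m k = (\<integral>u. u ^ k \<partial>N)" for k
  have Wlim: "((\<lambda>e. W k e / e) \<longlongrightarrow> m k) (at_right 0)" for k
  proof -
    \<comment> \<open>The subtracted units cancel since 1 - 2 + 1 = 0, which makes every term a
      difference quotient at 0.\<close>
    define E where "E a e = (exp (s * real a powr \<gamma> * e) - 1) / e" for a e
    have "((\<lambda>e. E (k+2) e - 2 * E (k+1) e + E k e) \<longlongrightarrow> s * real (k+2) powr \<gamma> - 2 * (s * real (k+1) powr \<gamma>) + s * real k powr \<gamma>) (at_right 0)"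
      unfolding E_def by (intro tendsto_intros exp_diff_quotient)
    also have "s * real (k+2) powr \<gamma> - 2 * (s * real (k+1) powr \<gamma>) + s * real k powr \<gamma> = m k"
      unfolding m_def mom by (simp add: algebra_simps)
    finally show ?thesis
    proof (rule Lim_transform_eventually)
      show "eventually (\<lambda>e. E (k+2) e - 2 * E (k+1) e + E k e = W k e / e) (at_right 0)"
        using eventually_at_right_less[of 0]
      proof eventually_elim
        case (elim e)
        have "W k e = exp (s * real (k+2) powr \<gamma> * e) - 2 * exp (s * real (k+1) powr \<gamma> * e) + exp (s * real k powr \<gamma> * e)"
          unfolding W_def wexp using elim
          by (subst Bochner_Integration.integral_add Bochner_Integration.integral_diff | intro Bochner_Integration.integrable_diff integrable_mult_right int | simp add: lap del: of_nat_add of_nat_Suc)+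
        then show ?case by (simp add: E_def diff_divide_distrib add_divide_distrib)
      qed
    qed
  qed
  have tail: "(\<integral>y. exp y ^ k * indicator {ln 2<..} y \<partial>\<mu> e) \<le> 2 powr (real k - e powr (-1/\<gamma>)) * exp s"
      "integrable (\<mu> e) (\<lambda>y. exp y ^ k * indicator {ln 2<..} y)"
    if e: "0 < e" "real k \<le> e powr (-1/\<gamma>)" for k e
  proof -
    \<comment> \<open>Chernoff parameter: \<open>L powr \<gamma> * e = 1\<close> keeps the
      exponential moment at \<open>exp s\<close>, while \<open>2 powr (k - L)\<close> vanishes
      faster than every power of \<open>e\<close>.\<close>
    define L where "L = e powr (-1/\<gamma>)"
    have L: "L powr \<gamma> * e = 1" "0 \<le> L"
    proof -
      have "L powr \<gamma> = e powr ((-1/\<gamma>) * \<gamma>)" unfolding L_def by (rule powr_powr)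
      also have "(-1/\<gamma>) * \<gamma> = -1" using \<gamma> by simp
      finally show "L powr \<gamma> * e = 1" using e by (simp add: powr_minus)
    qed (simp add: L_def)
    have i: "integrable (\<mu> e) (\<lambda>y. exp y ^ k)"
      using int[of e "real k"] e by (simp add: expk)
    show i2: "integrable (\<mu> e) (\<lambda>y. exp y ^ k * indicator {ln 2<..} y)"
      by (rule Bochner_Integration.integrable_bound[OF i]) (auto simp: indicator_def)
    have "(\<integral>y. exp y ^ k * indicator {ln 2<..} y \<partial>\<mu> e) \<le> (\<integral>y. 2 powr (real k - L) * exp (L * y) \<partial>\<mu> e)"
    proof (rule integral_mono[OF i2])
      show "integrable (\<mu> e) (\<lambda>y. 2 powr (real k - L) * exp (L * y))"
        using int[OF e(1) L(2)] by simp
      fix y :: real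
      show "exp y ^ k * indicator {ln 2<..} y \<le> 2 powr (real k - L) * exp (L * y)"
      proof (cases "y > ln 2")
        case True
        have "(real k - L) * y \<le> (real k - L) * ln 2"
          using True e by (intro mult_left_mono_neg) (auto simp: L_def)
        then have "exp (real k * y) \<le> exp ((real k - L) * ln 2 + L * y)"
          by (simp add: algebra_simps)
        then show ?thesis using True by (simp add: expk powr_def exp_add)
      qed simp
    qed
    also have "\<dots> = 2 powr (real k - L) * exp s"
      using lap[OF e(1) L(2)] L(1) by (simp add: mult.assoc)
    finally show "(\<integral>y. exp y ^ k * indicator {ln 2<..} y \<partial>\<mu> e) \<le> 2 powr (real k - e powr (-1/\<gamma>)) * exp s"
      by (simp add: L_def)
  qed
  have Q0: "0 \<le> Q" using q(2)[of 0] by simp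
  have m0: "0 \<le> m 0" unfolding m_def by simp
  show ?thesis
  proof (rule tendstoI)
    fix \<epsilon> :: real assume \<epsilon>: "0 < \<epsilon>"
    \<comment> \<open>The errors will add up to \<open>\<eta> * (2 * m 0 + 3)\<close>: approximation
      on the weighted law, Chernoff tail, convergence for the polynomial, and approximation under
      \<open>N\<close>.\<close>
    define \<eta> where "\<eta> = \<epsilon> / (2 * m 0 + 4)"
    have \<eta>: "0 < \<eta>" "\<eta> * (2 * m 0 + 3) < \<epsilon>"
    proof -
      show "0 < \<eta>" using \<epsilon> m0 by (simp add: \<eta>_def)
      moreover have "\<eta> * (2 * m 0 + 4) = \<epsilon>" using m0 by (simp add: \<eta>_def)
      ultimately show "\<eta> * (2 * m 0 + 3) < \<epsilon>" by (simp add: algebra_simps)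
    qed
    obtain g where g: "real_polynomial_function g" "\<And>x. x \<in> {0..2} \<Longrightarrow> \<bar>q x - g x\<bar> < \<eta>"
    proof -
      have "continuous_on {0..2} q" by (rule continuous_on_subset[OF q(1)]) auto
      from Stone_Weierstrass_real_polynomial_function[OF compact_Icc this \<eta>(1)]
      show ?thesis using that by blast
    qed
    obtain a n where gs: "g = (\<lambda>x. \<Sum>i\<le>n. a i * x ^ i)"
      using g(1) unfolding real_polynomial_function_iff_sum by blast
    \<comment> \<open>For u > 2 both \<open>q\<close> and the polynomial are at most a constant
      times \<open>u ^ n\<close>; the weight (1 - u)^2 adds 2 to the exponent.\<close>
    define C where "C = Q + (\<Sum>i\<le>n. \<bar>a i\<bar>)"
    have C0: "0 \<le> C" using Q0 by (auto simp: C_def intro!: add_nonneg_nonneg sum_nonneg)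
    have bnd: "\<bar>(1-u)^2 * q u - (1-u)^2 * g u\<bar> \<le> \<eta> * (1-u)^2 + C * (u ^ (n+2) * indicator {ln 2<..} (ln u))" if u: "0 < u" for u
    proof (cases "u \<le> 2")
      case True
      have "\<bar>(1-u)^2 * q u - (1-u)^2 * g u\<bar> = (1-u)^2 * \<bar>q u - g u\<bar>"
        by (simp add: abs_mult flip: right_diff_distrib)
      also have "\<dots> \<le> (1-u)^2 * \<eta>" using g(2)[of u] True u by (intro mult_left_mono) auto
      finally show ?thesis using True u by (simp add: mult.commute)
    next
      case False
      have "\<bar>g u\<bar> \<le> (\<Sum>i\<le>n. \<bar>a i * u ^ i\<bar>)" unfolding gs by (rule sum_abs)
      also have "\<dots> \<le> (\<Sum>i\<le>n. \<bar>a i\<bar> * u ^ n)"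
        using False by (intro sum_mono) (auto simp: abs_mult intro!: mult_left_mono power_increasing)
      finally have 1: "\<bar>g u\<bar> \<le> (\<Sum>i\<le>n. \<bar>a i\<bar>) * u ^ n" by (simp add: sum_distrib_right)
      have "1 \<le> u ^ n" using False by simp
      then have 2: "\<bar>q u\<bar> \<le> Q * u ^ n" using q(2)[of u] u Q0 mult_left_mono[of 1 "u^n" Q] by simp
      have "(1-u)^2 \<le> u^2" using False by (intro power2_le_iff_abs_le[THEN iffD2]) auto
      then have "(1-u)^2 * \<bar>q u - g u\<bar> \<le> u^2 * (C * u ^ n)"
        using 1 2 by (intro mult_mono) (auto simp: C_def algebra_simps)
      also have "\<dots> = C * u ^ (n+2)" by (simp add: power_add power2_eq_square)
      finally have "(1-u)^2 * \<bar>q u - g u\<bar> \<le> C * u ^ (n+2)" .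
      moreover have "\<bar>(1-u)^2 * q u - (1-u)^2 * g u\<bar> = (1-u)^2 * \<bar>q u - g u\<bar>"
        by (simp add: abs_mult flip: right_diff_distrib)
      moreover have "indicator {ln 2<..} (ln u) = (1::real)" using False u by (simp add: indicator_def)
      moreover have "0 \<le> \<eta> * (1-u)^2" using \<eta> by simp
      ultimately show ?thesis by simp
    qed
    have gm [measurable]: "g \<in> borel_measurable borel" unfolding gs by measurable
    define Ig where "Ig e = (\<integral>y. (1 - exp y)^2 * g (exp y) \<partial>\<mu> e)" for e
    define Iq where "Iq e = (\<integral>y. (1 - exp y)^2 * q (exp y) \<partial>\<mu> e)" for e
    have gint: "integrable (\<mu> e) (\<lambda>y. (1 - exp y)^2 * g (exp y))" and Igs: "Ig e = (\<Sum>i\<le>n. a i * W i e)" if "0 < e" for e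
    proof -
      have *: "(\<lambda>y. (1 - exp y)^2 * g (exp y)) = (\<lambda>y. \<Sum>i\<le>n. a i * ((1 - exp y)^2 * exp y ^ i))"
        unfolding gs by (simp add: sum_distrib_left algebra_simps)
      show "integrable (\<mu> e) (\<lambda>y. (1 - exp y)^2 * g (exp y))"
        unfolding * by (intro Bochner_Integration.integrable_sum integrable_mult_right Wint that)
      show "Ig e = (\<Sum>i\<le>n. a i * W i e)"
        unfolding Ig_def * W_def
        by (subst Bochner_Integration.integral_sum) (auto intro!: Wint that)
    qed
    have qint: "integrable (\<mu> e) (\<lambda>y. (1 - exp y)^2 * q (exp y))" if "0 < e" for e
    proof (rule Bochner_Integration.integrable_bound[OF integrable_mult_right[OF Wint[OF that, of 0], of Q]])
      have "\<bar>q (exp y)\<bar> * (1 - exp y)^2 \<le> Q * (1 - exp y)^2" for y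
        using q(2)[of "exp y"] by (intro mult_right_mono) auto
      then show "AE y in \<mu> e. norm ((1 - exp y)^2 * q (exp y)) \<le> norm (Q * ((1 - exp y)^2 * exp y ^ 0))"
        using Q0 by (intro AE_I2) (simp add: abs_mult mult.commute)
    qed measurable
    have cmp: "\<bar>Iq e - Ig e\<bar> \<le> \<eta> * W 0 e + C * (2 powr (real (n+2) - e powr (-1/\<gamma>)) * exp s)"
      if e: "0 < e" "real (n+2) \<le> e powr (-1/\<gamma>)" for e
    proof -
      let ?T = "\<lambda>y. exp y ^ (n+2) * indicator {ln 2<..} y :: real"
      have "Iq e - Ig e = (\<integral>y. ((1 - exp y)^2 * q (exp y) - (1 - exp y)^2 * g (exp y)) \<partial>\<mu> e)"
        unfolding Iq_def Ig_def using qint gint e by simp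
      also have "\<bar>\<dots>\<bar> \<le> (\<integral>y. \<bar>(1 - exp y)^2 * q (exp y) - (1 - exp y)^2 * g (exp y)\<bar> \<partial>\<mu> e)"
        by (rule integral_abs_bound)
      also have "\<dots> \<le> (\<integral>y. \<eta> * ((1 - exp y)^2 * exp y ^ 0) + C * ?T y \<partial>\<mu> e)"
      proof (rule integral_mono)
        show "integrable (\<mu> e) (\<lambda>y. \<bar>(1 - exp y)^2 * q (exp y) - (1 - exp y)^2 * g (exp y)\<bar>)"
          using qint gint e by auto
        show "integrable (\<mu> e) (\<lambda>y. \<eta> * ((1 - exp y)^2 * exp y ^ 0) + C * ?T y)"
          using Wint[OF e(1), of 0] tail(2)[OF e] by auto
        show "\<bar>(1 - exp y)^2 * q (exp y) - (1 - exp y)^2 * g (exp y)\<bar> \<le> \<eta> * ((1 - exp y)^2 * exp y ^ 0) + C * ?T y" for y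
          using bnd[of "exp y"] by simp
      qed
      also have "\<dots> = \<eta> * W 0 e + C * (\<integral>y. ?T y \<partial>\<mu> e)"
        unfolding W_def using Wint[OF e(1), of 0] tail(2)[OF e] by (subst Bochner_Integration.integral_add) auto
      also have "\<dots> \<le> \<eta> * W 0 e + C * (2 powr (real (n+2) - e powr (-1/\<gamma>)) * exp s)"
        using tail(1)[OF e] C0 by (intro add_left_mono mult_left_mono) auto
      finally show ?thesis .
    qed
    have pint: "integrable N (\<lambda>u. u ^ k)" for k :: nat
    proof (rule N.integrable_const_bound[of _ 1])
      show "AE u in N. norm (u ^ k) \<le> 1"
        using AEN by eventually_elim (simp add: power_le_one)
    qed measurable
    have qN: "integrable N q"
    proof (rule N.integrable_const_bound[of _ Q])
      show "AE u in N. norm (q u) \<le> Q"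
        using AEN by eventually_elim (simp add: q(2))
    qed measurable
    have gN: "integrable N g" "(\<integral>u. g u \<partial>N) = (\<Sum>i\<le>n. a i * m i)"
      unfolding gs m_def using pint by (auto simp: Bochner_Integration.integral_sum)
    have N': "\<bar>(\<integral>u. q u \<partial>N) - (\<integral>u. g u \<partial>N)\<bar> \<le> \<eta> * m 0"
    proof -
      have "\<bar>(\<integral>u. q u \<partial>N) - (\<integral>u. g u \<partial>N)\<bar> = \<bar>\<integral>u. q u - g u \<partial>N\<bar>"
        using qN gN by simp
      also have "\<dots> \<le> (\<integral>u. \<bar>q u - g u\<bar> \<partial>N)" by (rule integral_abs_bound)
      also have "\<dots> \<le> (\<integral>u. \<eta> * u ^ 0 \<partial>N)"
      proof (rule integral_mono_AE)
        show "AE u in N. \<bar>q u - g u\<bar> \<le> \<eta> * u ^ 0"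
          using AEN by eventually_elim (use g(2) in \<open>auto intro!: less_imp_le\<close>)
      qed (use qN gN in auto)
      finally show ?thesis by (simp add: m_def mult.commute)
    qed
    have Iglim: "((\<lambda>e. Ig e / e) \<longlongrightarrow> (\<integral>u. g u \<partial>N)) (at_right 0)"
    proof (rule Lim_transform_eventually)
      show "((\<lambda>e. \<Sum>i\<le>n. a i * (W i e / e)) \<longlongrightarrow> (\<integral>u. g u \<partial>N)) (at_right 0)"
        unfolding gN by (intro tendsto_intros Wlim)
      show "eventually (\<lambda>e. (\<Sum>i\<le>n. a i * (W i e / e)) = Ig e / e) (at_right 0)"
        using eventually_at_right_less[of 0] by eventually_elim (simp add: Igs sum_divide_distrib)
    qed
    have E1: "eventually (\<lambda>e. \<bar>Ig e / e - (\<integral>u. g u \<partial>N)\<bar> < \<eta>) (at_right 0)"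
      using tendstoD[OF Iglim \<eta>(1)] by (simp add: dist_real_def)
    have E2: "eventually (\<lambda>e. W 0 e / e < m 0 + 1) (at_right 0)"
      by (rule order_tendstoD[OF Wlim]) simp
    have "((\<lambda>e. C * (2 powr (real (n+2) - e powr (-1/\<gamma>)) * exp s) / e) \<longlongrightarrow> 0) (at_right 0)"
      using \<gamma> by real_asymp
    then have E3: "eventually (\<lambda>e. C * (2 powr (real (n+2) - e powr (-1/\<gamma>)) * exp s) / e < \<eta>) (at_right 0)"
      by (rule order_tendstoD) fact
    have "filterlim (\<lambda>e::real. e powr (-1/\<gamma>)) at_top (at_right 0)"
      using \<gamma> by real_asymp
    then have E4: "eventually (\<lambda>e. real (n+2) \<le> e powr (-1/\<gamma>)) (at_right 0)"
      by (simp add: filterlim_at_top)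
    show "eventually (\<lambda>e. dist (Iq e / e) (\<integral>u. q u \<partial>N) < \<epsilon>) (at_right 0)"
      using E1 E2 E3 E4 eventually_at_right_less[of 0]
    proof eventually_elim
      case (elim e)
      have "\<bar>Iq e / e - Ig e / e\<bar> = \<bar>Iq e - Ig e\<bar> / e"
        using elim by (simp flip: diff_divide_distrib)
      also have "\<dots> \<le> (\<eta> * W 0 e + C * (2 powr (real (n+2) - e powr (-1/\<gamma>)) * exp s)) / e"
        using elim cmp[of e] by (intro divide_right_mono) auto
      also have "\<dots> = \<eta> * (W 0 e / e) + C * (2 powr (real (n+2) - e powr (-1/\<gamma>)) * exp s) / e"
        by (simp add: add_divide_distrib)
      also have "\<dots> \<le> \<eta> * (m 0 + 1) + \<eta>"
        using elim \<eta>(1) by (intro add_mono mult_left_mono) auto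
      finally have "\<bar>Iq e / e - Ig e / e\<bar> \<le> \<eta> * (m 0 + 1) + \<eta>" .
      then have "\<bar>Iq e / e - (\<integral>u. q u \<partial>N)\<bar> \<le> \<eta> * (2 * m 0 + 3)"
        using N' elim(1) by (simp add: algebra_simps)
      then show ?case using \<eta> by (simp add: dist_real_def)
    qed
  qed
qed

section \<open>Continuous cutoffs and the generator limit at 1\<close>

definition ramp :: "real \<Rightarrow> real \<Rightarrow> real \<Rightarrow> real" where
  "ramp a c v = max 0 (min 1 ((v - a) / (c - a)))"

lemma ramp_bounds: "0 \<le> ramp a c v" "ramp a c v \<le> 1"
  by (auto simp: ramp_def)

lemma ramp_eq_0: "a < c \<Longrightarrow> v \<le> a \<Longrightarrow> ramp a c v = 0"
  using divide_nonpos_pos[of "v - a" "c - a"] by (simp add: ramp_def)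

lemma ramp_eq_1: "a < c \<Longrightarrow> c \<le> v \<Longrightarrow> ramp a c v = 1"
  by (auto simp: ramp_def field_simps)

text \<open>The bound on \<open>a\<close> keeps the negative power away from its pole. The bound on
  \<open>c\<close> leaves the pure power untouched near 1, for the expansion there and for the
  ratios of a path that stays close to 1.\<close>

locale cutoff =
  fixes a c \<beta> :: real
  assumes a: "1/4 \<le> a" and ac: "a < c" and c: "c \<le> 3/4" and \<beta>: "1 < \<beta>"
begin

text \<open>With h(x) = x powr -\<beta>, the quotient h(v x) / h(x) is
  \<open>v powr (-\<beta>)\<close>: this is the factor gained in a step of ratio \<open>v\<close>,
  damped to 0 for large relative losses.\<close>

definition kap :: "real \<Rightarrow> real" where
  "kap v = ramp a c v * v powr (-\<beta>)"

lemma kap_nonneg: "0 \<le> kap v"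
  by (simp add: kap_def ramp_bounds)

lemma kap_eq_0: "v \<le> a \<Longrightarrow> kap v = 0"
  using ac by (simp add: kap_def ramp_eq_0)

lemma kap_eq: "c \<le> v \<Longrightarrow> kap v = v powr (-\<beta>)"
  using ac by (simp add: kap_def ramp_eq_1)

lemma kap_max: "kap v = ramp a c v * (max v (1/4)) powr (-\<beta>)"
  using a ac by (cases "v \<le> a") (auto simp: kap_def ramp_eq_0 max_def)

lemma kap_le_powr: "kap v \<le> v powr (-\<beta>)"
  using ramp_bounds[of a c v] by (simp add: kap_def mult_left_le_one_le)

lemma kap_le: "kap v \<le> 4 powr \<beta>"
proof -
  have "(max v (1/4)) powr (-\<beta>) \<le> (1/4) powr (-\<beta>)"
    using \<beta> by (intro powr_mono2') auto
  also have "\<dots> = 4 powr \<beta>" by (simp add: powr_divide powr_minus field_simps)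
  finally have "(max v (1/4)) powr (-\<beta>) \<le> 4 powr \<beta>" .
  then have "ramp a c v * (max v (1/4)) powr (-\<beta>) \<le> 1 * 4 powr \<beta>"
    using ramp_bounds[of a c v] by (intro mult_mono) auto
  then show ?thesis by (simp add: kap_max)
qed

lemma continuous_kap: "continuous_on S kap"
proof -
  have "continuous_on S (\<lambda>v. ramp a c v * (max v (1/4)) powr (-\<beta>))"
    using ac unfolding ramp_def by (intro continuous_intros) auto
  then show ?thesis by (simp add: kap_max[abs_def])
qed

lemma kap_measurable [measurable]: "kap \<in> borel_measurable borel"
  by (rule borel_measurable_continuous_onI[OF continuous_kap])

text \<open>
  The constants \<open>exp (-1)\<close> and \<open>\<beta> (\<beta> + 2) / 2\<close> make the function continuous: below \<open>exp (-1)\<close> the cutoff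
  vanishes, and the second is the limit at \<open>1\<close>.
\<close>

definition second_quot :: "real \<Rightarrow> real" where
  "second_quot u = (if u = 1 then \<beta> * (\<beta>+2) / 2 else (kap (1 + ln (max u (exp (-1)))) - 1 + \<beta> * (u-1)) / (1-u)^2)"

lemma kap_one: "kap 1 = 1"
  using c by (simp add: kap_eq)

text \<open>The linear part uses exp y - 1 rather than y because its mean is read off the Laplace
  transform at 1; the remainder carries the weight whose limit is known.\<close>

lemma kap_second_quot: "kap (1 + y) - 1 = (1 - exp y)^2 * second_quot (exp y) - \<beta> * (exp y - 1)"
proof (cases "y = 0")
  case True then show ?thesis by (simp add: kap_one)
next
  case False
  \<comment> \<open>For \<open>y < -1\<close> the left argument saturates at 0 while
    \<open>1 + y\<close> is negative; \<open>kap\<close> vanishes at both.\<close>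
  have "kap (1 + ln (max (exp y) (exp (-1)))) = kap (1 + y)"
  proof (cases "y \<ge> -1")
    case True
    then have "max (exp y) (exp (-1)) = exp y" by simp
    then show ?thesis by simp
  next
    case False
    then have "max (exp y) (exp (-1)) = exp (-1)" by simp
    then show ?thesis using False a by (simp add: kap_eq_0)
  qed
  then show ?thesis using False by (simp add: second_quot_def)
qed

lemma continuous_second_quot: "continuous_on S second_quot"
proof (rule continuous_at_imp_continuous_on, rule ballI)
  fix u :: real
  show "isCont second_quot u"
  proof (cases "u = 1")
    case True
    have "((\<lambda>u. ((1+ln u) powr (-\<beta>) - 1 + \<beta>*(u-1)) / (1-u)^2) \<longlongrightarrow> second_quot 1) (at 1)"
      using second_order_quotient_at_1[of \<beta>] \<beta> by (simp add: second_quot_def)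
    then have "(second_quot \<longlongrightarrow> second_quot 1) (at 1)"
    proof (rule Lim_transform_eventually)
      have "eventually (\<lambda>u::real. u \<in> {exp (c-1)<..}) (nhds 1)"
        using c by (intro eventually_nhds_in_open) auto
      then show "eventually (\<lambda>u. ((1+ln u) powr (-\<beta>) - 1 + \<beta>*(u-1)) / (1-u)^2 = second_quot u) (at 1)"
        unfolding eventually_at_filter
      proof eventually_elim
        case (elim u)
        have "0 < u" using elim by (auto intro: less_trans[OF exp_gt_zero])
        have "exp (-1) \<le> exp (c-1)" using a ac by simp
        moreover have "exp (c-1) < u" using elim by simp
        ultimately have m: "max u (exp (-1)) = u" by linarith
        have "c - 1 < ln u" using elim \<open>0 < u\<close> by (metis greaterThan_iff ln_exp ln_less_cancel_iff exp_gt_zero)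
        then show ?case unfolding second_quot_def m by (simp add: kap_eq)
      qed
    qed
    then show ?thesis using True by (simp add: isCont_def)
  next
    case False
    have "isCont (\<lambda>u. (kap (1 + ln (max u (exp (-1)))) - 1 + \<beta> * (u-1)) / (1-u)^2) u"
    proof -
      have "isCont (\<lambda>u. ln (max u (exp (-1)))) u"
      proof (rule isCont_ln')
        show "isCont (\<lambda>u. max u (exp (-1))) u" by (intro continuous_intros)
        show "max u (exp (-1)) \<noteq> 0" by (rule less_imp_neq[symmetric]) (simp add: less_max_iff_disj)
      qed
      then have "isCont (\<lambda>u. 1 + ln (max u (exp (-1)))) u" by (intro continuous_add continuous_const)
      moreover have "isCont kap v" for v
        using continuous_kap[of UNIV] by (simp add: continuous_on_eq_continuous_at)
      ultimately have "isCont (\<lambda>u. kap (1 + ln (max u (exp (-1))))) u"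
        by (rule isCont_o2)
      then show ?thesis using False by (intro continuous_intros) auto
    qed
    moreover have "eventually (\<lambda>u. second_quot u = (kap (1 + ln (max u (exp (-1)))) - 1 + \<beta> * (u-1)) / (1-u)^2) (nhds u)"
    proof -
      have "eventually (\<lambda>u. u \<in> - {1}) (nhds u)" using False by (intro eventually_nhds_in_open) auto
      then show ?thesis by eventually_elim (simp add: second_quot_def)
    qed
    ultimately show ?thesis by (subst isCont_cong)
  qed
qed

lemma second_quot_measurable [measurable]: "second_quot \<in> borel_measurable borel"
  by (rule borel_measurable_continuous_onI[OF continuous_second_quot])

lemma second_quot_bounded: obtains Q where "\<And>u. 0 \<le> u \<Longrightarrow> \<bar>second_quot u\<bar> \<le> Q"
proof -
  have "bounded (second_quot ` {0..2})"
    by (intro compact_imp_bounded compact_continuous_image continuous_second_quot compact_Icc)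
  then obtain B where B: "\<And>u. u \<in> {0..2} \<Longrightarrow> \<bar>second_quot u\<bar> \<le> B"
    unfolding bounded_iff by (metis image_eqI real_norm_def)
  have "\<bar>second_quot u\<bar> \<le> max B (1 + \<beta>)" if u: "0 \<le> u" for u
  proof (cases "u \<le> 2")
    case True then show ?thesis using B[of u] u by (simp add: le_max_iff_disj)
  next
    case False
    have "1 \<le> max u (exp (-1))" using False by simp
    then have v: "1 \<le> 1 + ln (max u (exp (-1)))" by (simp only: ln_ge_zero le_add_same_cancel1)
    have k1: "kap (1 + ln (max u (exp (-1)))) \<le> 1"
      using v \<beta> by (intro order_trans[OF kap_le_powr]) (simp add: powr_minus field_simps ge_one_powr_ge_zero)
    have k0: "0 \<le> kap (1 + ln (max u (exp (-1))))" by (rule kap_nonneg)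
    have u1: "1 \<le> u - 1" using False by simp
    then have sq: "1 \<le> (u-1)^2" "u - 1 \<le> (u-1)^2"
      using mult_mono[of 1 "u-1" 1 "u-1"] mult_left_mono[of 1 "u-1" "u-1"] by (auto simp: power2_eq_square)
    then have "\<beta> * (u - 1) \<le> \<beta> * (u-1)^2" using \<beta> by (intro mult_left_mono) auto
    then have "\<bar>kap (1 + ln (max u (exp (-1)))) - 1 + \<beta> * (u-1)\<bar> \<le> (1 + \<beta>) * (u-1)^2"
      unfolding distrib_right using k0 k1 u1 \<beta> sq(1) mult_pos_pos[of \<beta> "u-1"] by linarith
    then have "\<bar>second_quot u\<bar> \<le> 1 + \<beta>"
      using False sq(1) by (simp add: second_quot_def abs_divide divide_le_eq power2_commute[of 1])
    then show ?thesis by simp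
  qed
  then show ?thesis using that by blast
qed

text \<open>The quadratic part converges by \<open>exp_moment_convergence\<close>; the linear one
  contributes -\<beta> times the derivative of \<open>exp (s * e)\<close> at 0.\<close>

lemma generator_limit:
  fixes \<mu> :: "real \<Rightarrow> real measure" and s \<gamma> :: real and N :: "real measure"
  assumes pr: "\<And>e. 0 < e \<Longrightarrow> prob_space (\<mu> e)" and sets: "\<And>e. sets (\<mu> e) = sets borel"
    and lap: "\<And>e l. 0 < e \<Longrightarrow> 0 \<le> l \<Longrightarrow> (\<integral>y. exp (l * y) \<partial>\<mu> e) = exp (s * l powr \<gamma> * e)"
    and \<gamma>: "0 < \<gamma>"
    and N: "finite_measure N" and setsN: "sets N = sets borel" and AEN: "AE u in N. 0 \<le> u \<and> u \<le> 1"
    and mom: "\<And>k::nat. (\<integral>u. u ^ k \<partial>N) = s * (real (k+2) powr \<gamma> - 2 * real (k+1) powr \<gamma> + real k powr \<gamma>)"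
  shows "((\<lambda>e. (\<integral>y. kap (1 + y) - 1 \<partial>\<mu> e) / e) \<longlongrightarrow> (\<integral>u. second_quot u \<partial>N) - \<beta> * s) (at_right 0)"
proof -
  note [measurable_cong] = sets
  obtain Q where Q: "\<And>u. 0 \<le> u \<Longrightarrow> \<bar>second_quot u\<bar> \<le> Q" using second_quot_bounded by blast
  have A: "((\<lambda>e. (\<integral>y. (1 - exp y)^2 * second_quot (exp y) \<partial>\<mu> e) / e) \<longlongrightarrow> (\<integral>u. second_quot u \<partial>N)) (at_right 0)"
    by (rule exp_moment_convergence[OF pr sets lap \<gamma> N setsN AEN mom continuous_second_quot Q second_quot_measurable])
  have "((\<lambda>e. (\<integral>y. (1 - exp y)^2 * second_quot (exp y) \<partial>\<mu> e) / e - \<beta> * ((exp (s * e) - 1) / e)) \<longlongrightarrow> (\<integral>u. second_quot u \<partial>N) - \<beta> * s) (at_right 0)"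
    by (intro tendsto_intros A exp_diff_quotient)
  then show ?thesis
  proof (rule Lim_transform_eventually)
    show "eventually (\<lambda>e. (\<integral>y. (1 - exp y)^2 * second_quot (exp y) \<partial>\<mu> e) / e - \<beta> * ((exp (s * e) - 1) / e) = (\<integral>y. kap (1 + y) - 1 \<partial>\<mu> e) / e) (at_right 0)"
      using eventually_at_right_less[of 0]
    proof eventually_elim
      case (elim e)
      interpret prob_space "\<mu> e" using pr elim by simp
      have e1: "(\<integral>y. exp y \<partial>\<mu> e) = exp (s * e)" using lap[of e 1] elim by simp
      then have i1: "integrable (\<mu> e) exp" using not_integrable_integral_eq by fastforce
      have ik: "integrable (\<mu> e) (\<lambda>y. kap (1 + y) - 1)"
      proof (rule Bochner_Integration.integrable_diff)
        show "integrable (\<mu> e) (\<lambda>y. kap (1 + y))"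
          using kap_le kap_nonneg by (intro integrable_const_bound[where B="4 powr \<beta>"]) auto
      qed simp
      have "(\<integral>y. (1 - exp y)^2 * second_quot (exp y) \<partial>\<mu> e) = (\<integral>y. (kap (1 + y) - 1) + \<beta> * (exp y - 1) \<partial>\<mu> e)"
        by (simp add: kap_second_quot)
      also have "\<dots> = (\<integral>y. kap (1 + y) - 1 \<partial>\<mu> e) + \<beta> * (exp (s * e) - 1)"
        using ik i1 e1 by (subst Bochner_Integration.integral_add) (auto simp: prob_space)
      finally have eq: "(\<integral>y. (1 - exp y)^2 * second_quot (exp y) \<partial>\<mu> e) = (\<integral>y. kap (1 + y) - 1 \<partial>\<mu> e) + \<beta> * (exp (s * e) - 1)" .
      show ?case unfolding eq by (simp add: add_divide_distrib)
    qed
  qed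
qed

text \<open>In the Gaussian case the rescaled measures concentrate at \<open>u = 1\<close> with mass \<open>2\<close>.\<close>

lemma generator_limit_gaussian:
  fixes \<mu> :: "real \<Rightarrow> real measure"
  assumes pr: "\<And>e. 0 < e \<Longrightarrow> prob_space (\<mu> e)" and sets: "\<And>e. sets (\<mu> e) = sets borel"
    and lap: "\<And>e l. 0 < e \<Longrightarrow> 0 \<le> l \<Longrightarrow> (\<integral>y. exp (l * y) \<partial>\<mu> e) = exp (1 * l powr 2 * e)"
  shows "((\<lambda>e. (\<integral>y. kap (1 + y) - 1 \<partial>\<mu> e) / e) \<longlongrightarrow> \<beta> * (\<beta> + 1)) (at_right 0)"
proof -
  let ?N = "density (return borel (1::real)) (\<lambda>_. 2)"
  have i: "(\<integral>u. f u \<partial>?N) = 2 * f 1" if [measurable]: "f \<in> borel_measurable borel" for f :: "real \<Rightarrow> real"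
    using integral_density[of f "return borel 1" "\<lambda>_. 2"] by (simp add: integral_return)
  have "((\<lambda>e. (\<integral>y. kap (1 + y) - 1 \<partial>\<mu> e) / e) \<longlongrightarrow> (\<integral>u. second_quot u \<partial>?N) - \<beta> * 1) (at_right 0)"
  proof (rule generator_limit[OF pr sets lap])
    show "finite_measure ?N"
      by (rule finite_measureI) (simp add: emeasure_density)
    show "AE u in ?N. 0 \<le> u \<and> u \<le> 1"
      by (subst AE_density) (auto simp: AE_return)
    show "(\<integral>u. u ^ k \<partial>?N) = 1 * (real (k+2) powr 2 - 2 * real (k+1) powr 2 + real k powr 2)" for k
      by (subst i) (auto simp: power2_eq_square algebra_simps)
  qed auto
  also have "(\<integral>u. second_quot u \<partial>?N) - \<beta> * 1 = \<beta> * (\<beta> + 1)"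
    by (subst i) (auto simp: second_quot_def algebra_simps)
  finally show ?thesis .
qed

end

section \<open>Levy-Khintchine integrals for downward jumps of density r^(-b), centered when b >
  2\<close>

definition levy_exp :: "real \<Rightarrow> real \<Rightarrow> real \<Rightarrow> real" where
  "levy_exp b l r = (exp (- (l * r)) - 1 + (if 2 < b then l * r else 0)) * r powr (-b)"

lemma levy_exp_measurable [measurable]: "levy_exp b l \<in> borel_measurable borel"
  unfolding levy_exp_def by measurable

lemma powr_set_integrable:
  fixes p p' :: real assumes "-1 < p" "p' < -1"
  shows "set_integrable lborel {0<..} (\<lambda>r. if r \<le> 1 then r powr p else r powr p')"
proof -
  have A: "(\<lambda>r. r powr p) absolutely_integrable_on {0..1}"
    using assms by (intro nonnegative_absolutely_integrable_1 integrable_on_powr_from_0) auto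
  have B: "(\<lambda>r. r powr p') absolutely_integrable_on {1..}"
    using has_integral_powr_to_inf[of p' 1] assms by (intro nonnegative_absolutely_integrable_1) auto
  have A': "set_integrable lborel {0<..1} (\<lambda>r. r powr p)"
  proof -
    have "set_integrable lborel {0..1} (\<lambda>r. r powr p)"
      using A unfolding set_integrable_def by (subst integrable_completion[symmetric]) auto
    then show ?thesis by (rule set_integrable_subset) auto
  qed
  have B': "set_integrable lborel {1<..} (\<lambda>r. r powr p')"
  proof -
    have "set_integrable lborel {1..} (\<lambda>r. r powr p')"
      using B unfolding set_integrable_def by (subst integrable_completion[symmetric]) auto
    then show ?thesis by (rule set_integrable_subset) auto
  qed
  have "set_integrable lborel ({0<..1} \<union> {1<..}) (\<lambda>r. if r \<le> 1 then r powr p else r powr p')"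
  proof (rule set_integrable_Un)
    show "set_integrable lborel {0<..1} (\<lambda>r. if r \<le> 1 then r powr p else r powr p')"
      using A' by (rule set_integrable_cong[THEN iffD1, rotated -1]) auto
    show "set_integrable lborel {1<..} (\<lambda>r. if r \<le> 1 then r powr p else r powr p')"
      using B' by (rule set_integrable_cong[THEN iffD1, rotated -1]) auto
  qed auto
  moreover have "{0<..1} \<union> {1<..} = {0::real<..}" by auto
  ultimately show ?thesis by simp
qed

lemma levy_exp_integrable_1:
  assumes "1 < b" "b < 3" "b \<noteq> 2"
  shows "set_integrable lborel {0<..} (levy_exp b 1)"
proof -
  \<comment> \<open>\<open>?t\<close> is 1 in the centered case: before the factor
    \<open>r powr (-b)\<close>, the integrand is then of order r^2 instead of r at 0 and at most of
    order r instead of 1 at infinity.\<close>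
  let ?t = "if 2 < b then 1 else 0 :: real"
  show ?thesis
  proof (rule set_integrable_bound[OF powr_set_integrable[of "1 + ?t - b" "?t - b"]])
    show "-1 < 1 + ?t - b" "?t - b < -1" using assms by auto
    show "set_borel_measurable lborel {0<..} (levy_exp b 1)"
      unfolding set_borel_measurable_def by measurable
    have "\<bar>levy_exp b 1 r\<bar> \<le> (if r \<le> 1 then r powr (1 + ?t - b) else r powr (?t - b))" if r: "0 < r" for r
    proof -
      have p: "r powr (1 + ?t - b) = r powr (1 + ?t) * r powr (-b)" "r powr (?t - b) = r powr ?t * r powr (-b)"
        by (simp_all flip: powr_add)
      have e1: "exp (- r) \<ge> 1 - r" using exp_ge_add_one_self[of "-r"] by simp
      have e0: "exp (- r) \<le> 1" "0 < exp (-r)" using r by auto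
      have e2: "exp (- r) \<le> 1 - r + r^2" if "r \<le> 1"
      proof -
        have "1 + r \<le> exp r" by (rule exp_ge_add_one_self)
        then have "exp (- r) \<le> 1 / (1 + r)" using r by (simp add: exp_minus field_simps)
        also have "\<dots> \<le> 1 - r + r^2" using r by (simp add: field_simps power2_eq_square)
        finally show ?thesis .
      qed
      have r2: "r powr 2 = r^2" using r by simp
      have "\<bar>exp (- r) - 1 + (if 2 < b then r else 0)\<bar> \<le> (if r \<le> 1 then r powr (1 + ?t) else r powr ?t)"
        using e0 e1 e2 r r2 by auto
      then show ?thesis
        unfolding levy_exp_def p by (simp add: abs_mult mult_right_mono split: if_splits)
    qed
    then show "AE r in lborel. r \<in> {0<..} \<longrightarrow> norm (levy_exp b 1 r) \<le> norm (if r \<le> 1 then r powr (1 + ?t - b) else r powr (?t - b))"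
      by (intro AE_I2) auto
  qed
qed

definition levy_sign :: "real \<Rightarrow> real" where "levy_sign b = (if 2 < b then 1 else -1)"

text \<open>Substituting \<open>l * r\<close> for \<open>r\<close> extracts
  \<open>l powr (b-1)\<close>; the sign at \<open>l = 1\<close> comes from exp (-r) > 1 - r or exp
  (-r) < 1. So r^(-b) / c0 is the Levy density in the normalization of the process.\<close>

lemma levy_exp_integral:
  assumes b: "1 < b" "b < 3" "b \<noteq> 2"
  obtains c0 where "0 < c0" "\<And>l. 0 \<le> l \<Longrightarrow> set_integrable lborel {0<..} (levy_exp b l)"
    "\<And>l. 0 \<le> l \<Longrightarrow> (LBINT r:{0<..}. levy_exp b l r) = levy_sign b * l powr (b - 1) * c0"
proof -
  define I where "I = (LBINT r:{0<..}. levy_exp b 1 r)"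
  note i1 = levy_exp_integrable_1[OF b]
  have scal: "has_bochner_integral lborel (\<lambda>r. indicator {0<..} r *\<^sub>R levy_exp b l r) (l powr (b-1) * I)" if l: "0 < l" for l
  proof -
    have "has_bochner_integral lborel (\<lambda>r. indicator {0<..} r *\<^sub>R levy_exp b 1 r) I"
      unfolding I_def set_lebesgue_integral_def using i1 unfolding set_integrable_def by (rule has_bochner_integral_integrable)
    then have "has_bochner_integral lborel (\<lambda>r. indicator {0<..} (0 + l * r) *\<^sub>R levy_exp b 1 (0 + l * r)) (I /\<^sub>R \<bar>l\<bar>)"
      using l by (subst lborel_has_bochner_integral_real_affine_iff[of l _ _ 0, symmetric]) auto
    from has_bochner_integral_scaleR_right[OF this, of "l powr b"]
    have "has_bochner_integral lborel (\<lambda>r. l powr b * (indicator {0<..} (l * r) * levy_exp b 1 (l * r))) (l powr b * (I / l))"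
      using l by (simp add: divide_inverse mult.commute)
    moreover have "l powr b * (indicator {0<..} (l * r) * levy_exp b 1 (l * r)) = indicator {0<..} r *\<^sub>R levy_exp b l r" for r
    proof (cases "0 < r")
      case True
      then have "l powr b * (l * r) powr (-b) = r powr (-b)"
        using l by (simp add: powr_mult powr_minus)
      then show ?thesis using True l by (simp add: levy_exp_def mult.left_commute)
    qed (use l in \<open>auto simp: zero_less_mult_iff\<close>)
    moreover have "l powr b * (I / l) = l powr (b-1) * I" using l by (simp add: powr_diff)
    ultimately show ?thesis by simp
  qed
  have pos: "0 < levy_sign b * levy_exp b 1 r" if r: "0 < r" for r
  proof -
    have "1 + (-r) < exp (-r)" using r exp_minus_greater[of r] by simp
    moreover have "(exp (-r) - 1) * r powr (-b) < 0" using r by (intro mult_neg_pos) auto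
    ultimately show ?thesis using r by (auto simp: levy_sign_def levy_exp_def)
  qed
  have "0 < levy_sign b * I"
  proof -
    have int: "integrable lborel (\<lambda>r. levy_sign b * (indicator {0<..} r *\<^sub>R levy_exp b 1 r))"
      using i1 unfolding set_integrable_def by simp
    have nn: "AE r in lborel. 0 \<le> levy_sign b * (indicator {0<..} r *\<^sub>R levy_exp b 1 r)"
      using pos by (intro AE_I2) (auto simp: indicator_def less_imp_le)
    have eq: "levy_sign b * I = (\<integral>r. levy_sign b * (indicator {0<..} r *\<^sub>R levy_exp b 1 r) \<partial>lborel)"
      unfolding I_def set_lebesgue_integral_def by simp
    have "levy_sign b * I \<noteq> 0"
    proof
      assume "levy_sign b * I = 0"
      then have "AE r in lborel. levy_sign b * (indicator {0<..} r *\<^sub>R levy_exp b 1 r) = 0"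
        using integral_nonneg_eq_0_iff_AE[OF int nn] eq by simp
      then have "AE r in lborel. r \<notin> {0<..<1::real}"
        by eventually_elim (use pos in \<open>force simp: indicator_def\<close>)
      then have "emeasure lborel {0<..<1::real} = 0"
        by (subst (asm) AE_iff_measurable[of "{0<..<1::real}"]) auto
      then show False by simp
    qed
    moreover have "0 \<le> levy_sign b * I" unfolding eq by (rule integral_nonneg_AE[OF nn])
    ultimately show ?thesis by linarith
  qed
  moreover have "has_bochner_integral lborel (\<lambda>r. indicator {0<..} r *\<^sub>R levy_exp b l r) (levy_sign b * l powr (b - 1) * (levy_sign b * I))" if "0 \<le> l" for l
  proof (cases "l = 0")
    case True
    then have "(\<lambda>r. indicator {0<..} r *\<^sub>R levy_exp b l r) = (\<lambda>r. 0)" by (auto simp: levy_exp_def)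
    then show ?thesis using True by (simp add: has_bochner_integral_zero)
  next
    case False
    then show ?thesis using scal[of l] that by (auto simp: levy_sign_def)
  qed
  ultimately show ?thesis
    by (intro that[of "levy_sign b * I"])
       (auto simp: set_integrable_def set_lebesgue_integral_def has_bochner_integral_iff)
qed

section \<open>The jump generator with continuous cutoff\<close>

context cutoff begin

definition levy_gen :: "real \<Rightarrow> real" where
  "levy_gen r = (kap (1 - r) - lcomp \<beta> r) * r powr (-\<beta>)"

lemma levy_gen_measurable [measurable]: "levy_gen \<in> borel_measurable borel"
  unfolding levy_gen_def lcomp_def by measurable

lemma levy_gen_second_quot: "levy_gen r = ((1 - exp (-r))^2 * r powr (-\<beta>)) * second_quot (exp (-r)) - \<beta> * levy_exp \<beta> 1 r"
proof -
  have k: "kap (1 - r) = 1 + (1 - exp (-r))^2 * second_quot (exp (-r)) - \<beta> * (exp (-r) - 1)"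
    using kap_second_quot[of "-r"] by simp
  then show ?thesis unfolding levy_gen_def k lcomp_def levy_exp_def by (simp add: algebra_simps)
qed

text \<open>Constant and linear terms in \<open>l\<close> drop out of a second difference, so the
  identity holds with and without centering.\<close>

lemma weight_levy_exp:
  "(1 - exp (-r))^2 * r powr (-b) * exp (-r) ^ k = levy_exp b (real (k+2)) r - 2 * levy_exp b (real (k+1)) r + levy_exp b (real k) r"
proof -
  have e: "exp (- (real k * r)) = exp (-r) ^ k" for k by (simp flip: exp_of_nat_mult)
  show ?thesis unfolding levy_exp_def e by (simp add: power2_eq_square algebra_simps)
qed

text \<open>\<open>N\<close> is the image of (w r / c0) dr under exp (-r). Its moments are the
  second differences dictated by the Laplace transform, so it is the limit of the weighted laws; the
  factor \<open>C\<close> is \<open>1 / c0\<close>.\<close>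

lemma generator_limit_levy:
  fixes \<mu> :: "real \<Rightarrow> real measure"
  assumes \<beta>': "\<beta> < 3" "\<beta> \<noteq> 2"
    and pr: "\<And>e. 0 < e \<Longrightarrow> prob_space (\<mu> e)" and sets: "\<And>e. sets (\<mu> e) = sets borel"
    and lap: "\<And>e l. 0 < e \<Longrightarrow> 0 \<le> l \<Longrightarrow> (\<integral>y. exp (l * y) \<partial>\<mu> e) = exp (levy_sign \<beta> * l powr (\<beta> - 1) * e)"
  shows "set_integrable lborel {0<..} levy_gen"
    "\<exists>C>0. ((\<lambda>e. (\<integral>y. kap (1 + y) - 1 \<partial>\<mu> e) / e) \<longlongrightarrow> C * (LBINT r:{0<..}. levy_gen r)) (at_right 0)"
proof -
  obtain c0 where c0: "0 < c0" and li: "\<And>l. 0 \<le> l \<Longrightarrow> set_integrable lborel {0<..} (levy_exp \<beta> l)"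
    and lv: "\<And>l. 0 \<le> l \<Longrightarrow> (LBINT r:{0<..}. levy_exp \<beta> l r) = levy_sign \<beta> * l powr (\<beta> - 1) * c0"
    using levy_exp_integral[OF \<beta> \<beta>'] by blast
  define w where "w r = (1 - exp (-r))^2 * r powr (-\<beta>)" for r
  have wm [measurable]: "w \<in> borel_measurable borel" unfolding w_def by measurable
  have w0: "0 \<le> w r" for r by (simp add: w_def)
  have wk: "w r * exp (-r) ^ k = levy_exp \<beta> (real (k+2)) r - 2 * levy_exp \<beta> (real (k+1)) r + levy_exp \<beta> (real k) r" for r k
    unfolding w_def by (rule weight_levy_exp)
  have wki: "set_integrable lborel {0<..} (\<lambda>r. w r * exp (-r) ^ k)" for k
    unfolding wk by (intro set_integral_add(1) set_integral_diff(1) set_integrable_mult_right li) auto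
  have wkv: "(LBINT r:{0<..}. w r * exp (-r) ^ k) = c0 * (levy_sign \<beta> * (real (k+2) powr (\<beta>-1) - 2 * real (k+1) powr (\<beta>-1) + real k powr (\<beta>-1)))" for k
  proof -
    have "(LBINT r:{0<..}. w r * exp (-r) ^ k) = (LBINT r:{0<..}. levy_exp \<beta> (real (k+2)) r) - (LBINT r:{0<..}. 2 * levy_exp \<beta> (real (k+1)) r) + (LBINT r:{0<..}. levy_exp \<beta> (real k) r)"
      unfolding wk
      by (subst set_integral_add(2), intro set_integral_diff(1) set_integrable_mult_right li, simp_all add: li del: of_nat_add of_nat_Suc)
    then show ?thesis by (simp add: lv algebra_simps del: of_nat_add of_nat_Suc)
  qed
  obtain Q where Q: "\<And>u. 0 \<le> u \<Longrightarrow> \<bar>second_quot u\<bar> \<le> Q" using second_quot_bounded by blast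
  have wq: "set_integrable lborel {0<..} (\<lambda>r. w r * second_quot (exp (-r)))"
  proof (rule set_integrable_bound[where f="\<lambda>r. w r * Q"])
    show "set_integrable lborel {0<..} (\<lambda>r. w r * Q)" using wki[of 0] by simp
    show "set_borel_measurable lborel {0<..} (\<lambda>r. w r * second_quot (exp (-r)))"
      unfolding set_borel_measurable_def by measurable
    have "norm (w r * second_quot (exp (-r))) \<le> norm (w r * Q)" for r
      using Q[of "exp (-r)"] w0[of r] by (auto simp: abs_mult intro!: mult_left_mono)
    then show "AE r in lborel. r \<in> {0<..} \<longrightarrow> norm (w r * second_quot (exp (-r))) \<le> norm (w r * Q)" by simp
  qed
  show gi: "set_integrable lborel {0<..} levy_gen"
    unfolding levy_gen_second_quot[abs_def] w_def[symmetric]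
    by (intro set_integral_diff(1) wq set_integrable_mult_right li) simp
  have gv: "(LBINT r:{0<..}. levy_gen r) = (LBINT r:{0<..}. w r * second_quot (exp (-r))) - \<beta> * (levy_sign \<beta> * c0)"
    unfolding levy_gen_second_quot[abs_def] w_def[symmetric]
    using lv[of 1] by (subst set_integral_diff(2)) (auto intro!: wq set_integrable_mult_right li)
  define D where "D = density lborel (\<lambda>r. ennreal (indicator {0<..} r * (w r / c0)))"
  define N where "N = distr D borel (\<lambda>r. exp (-r))"
  have D [measurable_cong]: "sets D = sets borel" by (simp add: D_def)
  have Nf: "(\<integral>u. f u \<partial>N) = (LBINT r:{0<..}. w r * f (exp (-r))) / c0" if [measurable]: "f \<in> borel_measurable borel" for f :: "real \<Rightarrow> real"
  proof -
    have "(\<integral>u. f u \<partial>N) = (\<integral>r. f (exp (-r)) \<partial>D)"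
      unfolding N_def by (rule integral_distr) measurable
    also have "\<dots> = (\<integral>r. (indicator {0<..} r * (w r / c0)) *\<^sub>R f (exp (-r)) \<partial>lborel)"
      unfolding D_def by (rule integral_density) (use w0 c0 in auto)
    also have "\<dots> = (\<integral>r. (indicator {0<..} r *\<^sub>R (w r * f (exp (-r)))) / c0 \<partial>lborel)"
      by (rule Bochner_Integration.integral_cong) auto
    finally show ?thesis by (simp add: set_lebesgue_integral_def)
  qed
  have "((\<lambda>e. (\<integral>y. kap (1 + y) - 1 \<partial>\<mu> e) / e) \<longlongrightarrow> (\<integral>u. second_quot u \<partial>N) - \<beta> * levy_sign \<beta>) (at_right 0)"
  proof (rule generator_limit[OF pr sets lap])
    show "0 < \<beta> - 1" using \<beta> by simp
    show "finite_measure N" unfolding N_def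
    proof (rule finite_measure.finite_measure_distr)
      have "integrable lborel (\<lambda>r. indicator {0<..} r * (w r / c0))"
        using wki[of 0] unfolding set_integrable_def by (simp add: integrable_divide)
      then have "(\<integral>\<^sup>+r. ennreal (indicator {0<..} r * (w r / c0)) \<partial>lborel) < \<infinity>"
        using c0 w0 by (subst nn_integral_eq_integral) auto
      then show "finite_measure D"
        by (intro finite_measureI) (simp add: D_def emeasure_density)
    qed measurable
    show "AE u in N. 0 \<le> u \<and> u \<le> 1"
    proof -
      have "AE r in D. 0 \<le> exp (-r) \<and> exp (-r) \<le> 1"
        unfolding D_def by (subst AE_density) (auto simp: indicator_def intro!: AE_I2)
      then show ?thesis unfolding N_def by (subst AE_distr_iff) auto
    qed
    show "(\<integral>u. u ^ k \<partial>N) = levy_sign \<beta> * (real (k + 2) powr (\<beta> - 1) - 2 * real (k + 1) powr (\<beta> - 1) + real k powr (\<beta> - 1))" for k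
      using c0 by (subst Nf) (simp_all only: wkv, auto)
  qed (auto simp: N_def)
  moreover have "(\<integral>u. second_quot u \<partial>N) - \<beta> * levy_sign \<beta> = (1 / c0) * (LBINT r:{0<..}. levy_gen r)"
    using c0 by (subst Nf) (auto simp: gv field_simps)
  ultimately show "\<exists>C>0. ((\<lambda>e. (\<integral>y. kap (1 + y) - 1 \<partial>\<mu> e) / e) \<longlongrightarrow> C * (LBINT r:{0<..}. levy_gen r)) (at_right 0)"
    using c0 by (intro exI[of _ "1 / c0"]) auto
qed

text \<open>The ramp and the indicator disagree only for \<open>r\<close> within \<open>z\<close> of
  1/2; there the cutoff difference and \<open>r powr (-\<beta>)\<close> are each at most
  \<open>4 powr \<beta>\<close>.\<close>

lemma levy_gen_approx:
  assumes z: "0 < z" "z \<le> 1/4" "1/2 - z \<le> a" "c \<le> 1/2 + z"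
    and i: "set_integrable lborel {0<..} levy_gen" "set_integrable lborel {0<..} (jump_kernel \<beta>)"
  shows "\<bar>(LBINT r:{0<..}. levy_gen r) - (LBINT r:{0<..}. jump_kernel \<beta> r)\<bar> \<le> 16 powr \<beta> * (2 * z)"
proof -
  have pt: "\<bar>indicator {0<..} r *\<^sub>R (levy_gen r - jump_kernel \<beta> r)\<bar> \<le> 16 powr \<beta> * indicator {1/2-z..1/2+z} r" for r
  proof (cases "r \<in> {1/2-z..1/2+z}")
    case True
    have d: "levy_gen r - jump_kernel \<beta> r = (kap (1-r) - (if r < 1/2 then (1-r) powr (-\<beta>) else 0)) * r powr (-\<beta>)"
      by (simp add: levy_gen_def jump_kernel_def algebra_simps)
    have p: "v powr (-\<beta>) \<le> 4 powr \<beta>" if "1/4 \<le> v" for v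
    proof -
      have "v powr (-\<beta>) \<le> (1/4) powr (-\<beta>)" using \<beta> that by (intro powr_mono2') auto
      then show ?thesis by (simp add: powr_divide powr_minus field_simps)
    qed
    have "\<bar>kap (1-r) - (if r < 1/2 then (1-r) powr (-\<beta>) else 0)\<bar> \<le> 4 powr \<beta>"
    proof (cases "r < 1/2")
      case T: True
      have "(1-r) powr (-\<beta>) \<le> 4 powr \<beta>" using T by (intro p) simp
      moreover have "0 \<le> (1-r) powr (-\<beta>)" by simp
      ultimately have "\<bar>kap (1-r) - (1-r) powr (-\<beta>)\<bar> \<le> 4 powr \<beta>"
        using kap_nonneg[of "1-r"] kap_le[of "1-r"] by linarith
      then show ?thesis using T by simp
    next
      case F: False
      then show ?thesis using kap_nonneg[of "1-r"] kap_le[of "1-r"] by simp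
    qed
    then have "\<bar>levy_gen r - jump_kernel \<beta> r\<bar> \<le> 4 powr \<beta> * 4 powr \<beta>"
      unfolding d abs_mult using p[of r] True z by (intro mult_mono) auto
    also have "\<dots> = 16 powr \<beta>" by (simp flip: powr_mult)
    finally show ?thesis using True z by simp
  next
    case False
    have "levy_gen r - jump_kernel \<beta> r = 0" if "0 < r"
    proof (cases "r < 1/2")
      case True
      then have "c \<le> 1 - r" using False z by auto
      then show ?thesis using True by (simp add: levy_gen_def jump_kernel_def kap_eq)
    next
      case F: False
      then have "1 - r \<le> a" using False z by auto
      then show ?thesis using F by (simp add: levy_gen_def jump_kernel_def kap_eq_0)
    qed
    then show ?thesis using False by (auto simp: indicator_def)
  qed
  have ii: "integrable lborel (\<lambda>r. 16 powr \<beta> * indicator {1/2-z..1/2+z} r)"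
    by (intro integrable_mult_right integrable_real_indicator) (auto simp: emeasure_lborel_Icc_eq)
  have di: "integrable lborel (\<lambda>r. indicator {0<..} r *\<^sub>R (levy_gen r - jump_kernel \<beta> r))"
    using set_integral_diff(1)[OF i] by (simp add: set_integrable_def)
  have "(LBINT r:{0<..}. levy_gen r) - (LBINT r:{0<..}. jump_kernel \<beta> r) = (\<integral>r. indicator {0<..} r *\<^sub>R (levy_gen r - jump_kernel \<beta> r) \<partial>lborel)"
    using set_integral_diff(2)[OF i] by (simp add: set_lebesgue_integral_def)
  also have "\<bar>\<dots>\<bar> \<le> (\<integral>r. \<bar>indicator {0<..} r *\<^sub>R (levy_gen r - jump_kernel \<beta> r)\<bar> \<partial>lborel)"
    by (rule integral_abs_bound)
  also have "\<dots> \<le> (\<integral>r. 16 powr \<beta> * indicator {1/2-z..1/2+z} r \<partial>lborel)"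
    by (rule integral_mono[OF integrable_abs[OF di] ii pt])
  also have "\<dots> = 16 powr \<beta> * (2 * z)" using z by simp
  finally show ?thesis .
qed

end

section \<open>Sign of F and choice of the cutoff\<close>

lemma jump_kernel_integral_nonzero:
  fixes b :: real
  assumes "1 < b" "b < 3" "b \<noteq> 2" "b \<noteq> 3/2" "b \<noteq> 5/2"
  shows "set_integrable lborel {0<..} (jump_kernel b)" "(LBINT r:{0<..}. jump_kernel b r) \<noteq> 0"
proof -
  have "set_integrable lborel {0<..} (jump_kernel b) \<and> (LBINT r:{0<..}. jump_kernel b r) \<noteq> 0"
  proof (cases "b < 2")
    case True
    then obtain J where J: "J > 0" "set_integrable lborel {0<..} (jump_kernel b)" "(LBINT r:{0<..}. jump_kernel b r) = (4*b-6)/(b-1) * J"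
      using jump_kernel_integral_1[of b] assms by blast
    have "(4*b-6)/(b-1) * J \<noteq> 0"
      unfolding mult_eq_0_iff divide_eq_0_iff using assms J(1) by linarith
    then show ?thesis unfolding J(3) using J(2) by blast
  next
    case False
    then obtain J where J: "J > 0" "set_integrable lborel {0<..} (jump_kernel b)" "(LBINT r:{0<..}. jump_kernel b r) = (4*b-6)*(4*b-10)/((b-1)*(b-2)) * J"
      using jump_kernel_integral_2[of b] assms(1-3) by (metis linorder_neqE_linordered_idom)
    have "(4*b-6)*(4*b-10)/((b-1)*(b-2)) * J \<noteq> 0"
      unfolding mult_eq_0_iff divide_eq_0_iff using assms J(1) by linarith
    then show ?thesis unfolding J(3) using J(2) by blast
  qed
  then show "set_integrable lborel {0<..} (jump_kernel b)" "(LBINT r:{0<..}. jump_kernel b r) \<noteq> 0" by auto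
qed

text \<open>For F > 0 the ramp lies strictly above 1/2, for F < 0 it ends at 1/2. The cutoff is then
  below, respectively above, the indicator, as the pathwise comparison will require.\<close>

lemma generator_sign:
  fixes \<mu> :: "real \<Rightarrow> real measure" and \<beta> \<gamma> :: real
  assumes \<beta>: "\<beta> \<in> {1<..} - real ` {2..}" and \<gamma>: "\<gamma> = min (\<beta> - 1) 2" and ne: "\<beta> \<noteq> 3/2" "\<beta> \<noteq> 5/2"
    and pr: "\<And>e. 0 < e \<Longrightarrow> prob_space (\<mu> e)" and sets: "\<And>e. sets (\<mu> e) = sets borel"
    and lap: "\<And>e l. 0 < e \<Longrightarrow> 0 \<le> l \<Longrightarrow> (\<integral>y. exp (l * y) \<partial>\<mu> e) =
       (if 1 < \<gamma> then exp (e * l powr \<gamma>) else exp (- e * l powr \<gamma>))"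
  obtains a c \<sigma> c0 where "cutoff a c \<beta>" "\<sigma> = 1 \<and> 1/2 < a \<or> \<sigma> = -1 \<and> c \<le> 1/2" "0 < c0"
    "eventually (\<lambda>e. c0 * e \<le> \<sigma> * (\<integral>y. cutoff.kap a c \<beta> (1 + y) - 1 \<partial>\<mu> e)) (at_right 0)"
proof -
  have "real 2 \<in> real ` {2..}" "real 3 \<in> real ` {2..}" by (rule imageI; simp)+
  then have n2: "\<beta> \<noteq> 2" "\<beta> \<noteq> 3" "1 < \<beta>" using \<beta> by auto
  have fin: "eventually (\<lambda>e. l * \<sigma> / 2 * e \<le> \<sigma> * f e) (at_right 0)"
    if "((\<lambda>e. f e / e) \<longlongrightarrow> l) (at_right 0)" "0 < l * \<sigma>" for f l and \<sigma> :: real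
  proof -
    have "((\<lambda>e. \<sigma> * (f e / e)) \<longlongrightarrow> \<sigma> * l) (at_right 0)" by (intro tendsto_intros that)
    then have "eventually (\<lambda>e. l * \<sigma> / 2 < \<sigma> * (f e / e)) (at_right 0)"
      by (rule order_tendstoD) (use that in \<open>simp add: mult.commute\<close>)
    then show ?thesis using eventually_at_right_less[of 0]
    proof eventually_elim
      case (elim e)
      have "l * \<sigma> / 2 * e \<le> \<sigma> * (f e / e) * e"
        using elim by (intro mult_right_mono) auto
      then show ?case using elim by simp
    qed
  qed
  show ?thesis
  proof (cases "\<beta> < 3")
    case False
    then have g2: "\<gamma> = 2" using \<gamma> by simp
    \<comment> \<open>The Gaussian limit depends only on the behaviour of \<open>kap\<close> at 1
      and is positive, so any ramp between 1/2 and 3/4 serves, with \<sigma> = 1.\<close>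
    interpret cutoff "9/16" "5/8" \<beta> using n2 by unfold_locales auto
    have "((\<lambda>e. (\<integral>y. kap (1 + y) - 1 \<partial>\<mu> e) / e) \<longlongrightarrow> \<beta> * (\<beta> + 1)) (at_right 0)"
    proof (rule generator_limit_gaussian[OF pr sets])
      show "(\<integral>y. exp (l * y) \<partial>\<mu> e) = exp (1 * l powr 2 * e)" if "0 < e" "0 \<le> l" for e l
        using lap[OF that] by (simp add: g2 mult.commute)
    qed
    from fin[OF this, of 1] n2 have "eventually (\<lambda>e. \<beta> * (\<beta> + 1) * 1 / 2 * e \<le> 1 * (\<integral>y. kap (1 + y) - 1 \<partial>\<mu> e)) (at_right 0)"
      by simp
    then show ?thesis using n2 cutoff_axioms by (intro that[of "9/16" "5/8" 1 "\<beta> * (\<beta> + 1) * 1 / 2"]) auto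
  next
    case True
    then have g: "\<gamma> = \<beta> - 1" using \<gamma> by simp
    define F where "F = (LBINT r:{0<..}. jump_kernel \<beta> r)"
    have F: "set_integrable lborel {0<..} (jump_kernel \<beta>)" "F \<noteq> 0"
      using jump_kernel_integral_nonzero[of \<beta>] n2 True ne by (auto simp: F_def)
    define \<sigma> where "\<sigma> = sgn F"
    \<comment> \<open>Makes the bound of \<open>levy_gen_approx\<close> at most half of |F|, so that
      the sign is preserved.\<close>
    define z where "z = min (1/4) (\<bar>F\<bar> / (4 * 16 powr \<beta>))"
    have z: "0 < z" "z \<le> 1/4" using F by (auto simp: z_def)
    have zF: "16 powr \<beta> * (2 * z) < \<bar>F\<bar>"
    proof -
      have "z \<le> \<bar>F\<bar> / (4 * 16 powr \<beta>)" by (simp add: z_def)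
      then have "16 powr \<beta> * (2 * z) \<le> \<bar>F\<bar> / 2" by (simp add: field_simps)
      then show ?thesis using F by simp
    qed
    define a where "a = (if 0 < F then 1/2 + z/2 else 1/2 - z)"
    define c where "c = (if 0 < F then 1/2 + z else 1/2)"
    interpret cutoff a c \<beta> using n2 z by unfold_locales (auto simp: a_def c_def)
    have lap': "(\<integral>y. exp (l * y) \<partial>\<mu> e) = exp (levy_sign \<beta> * l powr (\<beta> - 1) * e)" if "0 < e" "0 \<le> l" for e l
      using lap[OF that] by (simp add: g levy_sign_def mult.commute)
    note G = generator_limit_levy[OF True n2(1) pr sets lap']
    from G(2) obtain C where C: "0 < C" "((\<lambda>e. (\<integral>y. kap (1 + y) - 1 \<partial>\<mu> e) / e) \<longlongrightarrow> C * (LBINT r:{0<..}. levy_gen r)) (at_right 0)"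
      by blast
    have "\<bar>(LBINT r:{0<..}. levy_gen r) - F\<bar> < \<bar>F\<bar>"
      using levy_gen_approx[OF z _ _ G(1) F(1)] zF z unfolding F_def[symmetric] by (auto simp: a_def c_def)
    then have "0 < (LBINT r:{0<..}. levy_gen r) * \<sigma>"
      using F by (auto simp: \<sigma>_def sgn_if)
    then have p: "0 < C * (LBINT r:{0<..}. levy_gen r) * \<sigma>" using C(1) by (simp add: mult.assoc)
    show ?thesis
    proof (rule that[OF cutoff_axioms _ _ fin[OF C(2) p]])
      show "\<sigma> = 1 \<and> 1/2 < a \<or> \<sigma> = -1 \<and> c \<le> 1/2" using F z by (auto simp: \<sigma>_def a_def c_def sgn_if)
      show "0 < C * (LBINT r:{0<..}. levy_gen r) * \<sigma> / 2" using p by simp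
    qed
  qed
qed

subsection \<open>Sampling a path on dyadic grids\<close>

context cutoff begin

text \<open>Sampled version of h along the killed path: from 1, through positive values and with
  ratios at least \<open>c\<close>, the product telescopes to \<open>S k powr (-\<beta>)\<close>. A
  zero denominator gives ratio 0, where \<open>kap\<close> vanishes.\<close>

definition weight :: "(nat \<Rightarrow> real) \<Rightarrow> nat \<Rightarrow> real" where
  "weight S k = (\<Prod>j<k. kap (S (Suc j) / S j))"

definition stay :: "(nat \<Rightarrow> real) \<Rightarrow> nat \<Rightarrow> bool" where
  "stay S k \<longleftrightarrow> (\<forall>j\<le>k. 1/2 \<le> S j)"

text \<open>
  If \<open>T\<close> is the first index with \<open>S T < 1/2\<close>, the sum telescopes to \<open>weight S (min T K)\<close>.
\<close>

definition stopped :: "(nat \<Rightarrow> real) \<Rightarrow> nat \<Rightarrow> real" where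
  "stopped S K = 1 + (\<Sum>k<K. of_bool (stay S k) * weight S k * (kap (S (Suc k) / S k) - 1))"

lemma weight_Suc: "weight S (Suc k) = weight S k * kap (S (Suc k) / S k)"
  by (simp add: weight_def)

lemma weight_0 [simp]: "weight S 0 = 1"
  by (simp add: weight_def)

lemma weight_nonneg: "0 \<le> weight S k"
  by (simp add: weight_def prod_nonneg kap_nonneg)

lemma stopped_eq_weight:
  assumes "m \<le> K" "\<And>j. j < m \<Longrightarrow> 1/2 \<le> S j" "m = K \<or> S m < 1/2"
  shows "stopped S K = weight S m"
proof -
  have "(\<Sum>k<K. of_bool (stay S k) * weight S k * (kap (S (Suc k) / S k) - 1))
     = (\<Sum>k<m. of_bool (stay S k) * weight S k * (kap (S (Suc k) / S k) - 1))"
    by (rule sum.mono_neutral_right) (use assms in \<open>auto simp: stay_def\<close>)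
  also have "\<dots> = (\<Sum>k<m. weight S (Suc k) - weight S k)"
    by (rule sum.cong) (use assms in \<open>auto simp: stay_def weight_Suc algebra_simps\<close>)
  also have "\<dots> = weight S m - 1" by (simp add: sum_lessThan_telescope)
  finally show ?thesis by (simp add: stopped_def)
qed

text \<open>A nonzero factor forces its ratio above \<open>a > 0\<close>, so positivity passes from
  each value to the next, and each factor is at most the pure power.\<close>

lemma weight_pos_imp:
  assumes "S 0 = 1" "weight S k \<noteq> 0"
  shows "0 < S k" "weight S k \<le> S k powr (-\<beta>)"
proof -
  have "0 < S k \<and> weight S k \<le> S k powr (-\<beta>)"
    using assms(2)
  proof (induction k)
    case 0 then show ?case using assms by simp
  next
    case (Suc k)
    then have IH: "0 < S k" "weight S k \<le> S k powr (-\<beta>)" and nz: "kap (S (Suc k) / S k) \<noteq> 0"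
      by (auto simp: weight_Suc)
    have "a < S (Suc k) / S k" using nz by (meson kap_eq_0 not_le)
    then have p: "0 < S (Suc k) / S k" using a by linarith
    then have p': "0 < S (Suc k)" using IH by (simp add: zero_less_divide_iff)
    have "weight S (Suc k) \<le> S k powr (-\<beta>) * (S (Suc k) / S k) powr (-\<beta>)"
      unfolding weight_Suc using IH kap_le_powr kap_nonneg by (intro mult_mono) auto
    also have "\<dots> = S (Suc k) powr (-\<beta>)"
      using IH p p' by (simp flip: powr_mult)
    finally show ?case using p' by simp
  qed
  then show "0 < S k" "weight S k \<le> S k powr (-\<beta>)" by auto
qed

lemma weight_le:
  assumes "S 0 = 1" "0 < S k"
  shows "weight S k \<le> S k powr (-\<beta>)"
  using weight_pos_imp[of S k, OF assms(1)] by (cases "weight S k = 0") auto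

lemma weight_eq:
  assumes "S 0 = 1" "\<And>j. j < k \<Longrightarrow> 0 < S j" "\<And>j. j < k \<Longrightarrow> c \<le> S (Suc j) / S j"
  shows "weight S k = S k powr (-\<beta>) \<and> 0 < S k"
  using assms(2,3)
proof (induction k)
  case 0 then show ?case using assms(1) by simp
next
  case (Suc k)
  then have IH: "weight S k = S k powr (-\<beta>)" "0 < S k" and r: "c \<le> S (Suc k) / S k"
    by auto
  have "0 < S (Suc k) / S k" using r a ac by linarith
  then have p: "0 < S (Suc k)" using IH by (simp add: zero_less_divide_iff)
  have "weight S (Suc k) = S k powr (-\<beta>) * (S (Suc k) / S k) powr (-\<beta>)"
    unfolding weight_Suc IH kap_eq[OF r] ..
  also have "\<dots> = S (Suc k) powr (-\<beta>)"
    using IH p by (simp flip: powr_mult)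
  finally show ?case using p by simp
qed

text \<open>A nonzero last factor has ratio above 1/4 and starts from a value of at least 1/2, so
  the final value exceeds 1/8. Uniformity in \<open>K\<close> allows dominated convergence.\<close>

lemma stopped_bounds:
  assumes "S 0 = 1"
  shows "0 \<le> stopped S K" "stopped S K \<le> 8 powr \<beta>"
proof -
  define m where "m = (if \<exists>k<K. S k < 1/2 then LEAST k. S k < 1/2 else K)"
  have m: "m \<le> K" "\<And>j. j < m \<Longrightarrow> 1/2 \<le> S j" "m = K \<or> S m < 1/2"
  proof -
    have "m \<le> K \<and> (\<forall>j<m. 1/2 \<le> S j) \<and> (m = K \<or> S m < 1/2)"
    proof (cases "\<exists>k<K. S k < 1/2")
      case True
      then obtain k where k: "k < K" "S k < 1/2" by blast
      have m: "m = (LEAST k. S k < 1/2)" using True by (simp add: m_def)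
      have "S m < 1/2" unfolding m by (rule LeastI[of _ k]) (rule k)
      moreover have "m \<le> k" unfolding m by (rule Least_le) (rule k)
      moreover have "\<forall>j<m. 1/2 \<le> S j" unfolding m using not_less_Least by force
      ultimately show ?thesis using k by auto
    next
      case False
      have "m = K" unfolding m_def using False by (rule if_not_P)
      moreover have "\<forall>j<K. 1/2 \<le> S j" using False by (meson not_le)
      ultimately show ?thesis by simp
    qed
    then show "m \<le> K" "\<And>j. j < m \<Longrightarrow> 1/2 \<le> S j" "m = K \<or> S m < 1/2" by auto
  qed
  have eq: "stopped S K = weight S m" using m by (rule stopped_eq_weight)
  then show "0 \<le> stopped S K" by (simp add: weight_nonneg)
  show "stopped S K \<le> 8 powr \<beta>"
  proof (cases "m = 0 \<or> weight S m = 0")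
    case True
    moreover have "1 \<le> 8 powr \<beta>" using \<beta> by (intro ge_one_powr_ge_zero) auto
    ultimately show ?thesis using eq by auto
  next
    case False
    then obtain k where k: "m = Suc k" by (cases m) auto
    have nz: "weight S k \<noteq> 0" "kap (S m / S k) \<noteq> 0" using False k by (auto simp: weight_Suc)
    have Sk: "1/2 \<le> S k" using m(2)[of k] k by simp
    have "a < S m / S k" using nz by (meson kap_eq_0 not_le)
    then have "a * S k < S m" using Sk by (simp add: pos_less_divide_eq)
    moreover have "1/4 * S k \<le> a * S k" using a Sk by (intro mult_right_mono) auto
    ultimately have "1/4 * S k < S m" by linarith
    then have Sm: "1/8 \<le> S m" using Sk by simp
    have "weight S m \<le> S m powr (-\<beta>)" using weight_pos_imp(2)[of S m, OF assms] False by simp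
    also have "\<dots> \<le> (1/8) powr (-\<beta>)" using Sm \<beta> by (intro powr_mono2') auto
    also have "\<dots> = 8 powr \<beta>" by (simp add: powr_divide powr_minus field_simps)
    finally show ?thesis using eq by simp
  qed
qed

end

text \<open>If the level is never passed, \<open>real_of_ereal\<close> sends the infinite time to 0:
  the power is taken of \<open>x 0\<close> and the indicator runs over all times.\<close>

definition functional :: "real \<Rightarrow> (real \<Rightarrow> real) \<Rightarrow> real \<Rightarrow> real" where
  "functional \<beta> x \<delta> = (let \<tau> = passage_time x \<delta> in
     x (real_of_ereal \<tau>) powr (-\<beta>) *
     of_bool (\<forall>s\<ge>0. ereal s \<le> \<tau> \<longrightarrow> \<bar>jump x s\<bar> < left_limit x s / 2))"

section \<open>Passage times and grids for a fixed path\<close>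

locale hitting_path =
  fixes x :: "real \<Rightarrow> real"
  assumes cadlag: "cadlag x" and x0: "x 0 = 1" and no_pos: "\<And>t. 0 < t \<Longrightarrow> jump x t \<le> 0"
    and hits: "\<exists>s\<ge>0. x s < 1/2"
begin

lemma right_cont: "0 \<le> t \<Longrightarrow> (x \<longlongrightarrow> x t) (at_right t)"
  using cadlag by (auto simp: cadlag_def)

lemma left_lim:
  assumes "0 < t" shows "(x \<longlongrightarrow> left_limit x t) (at_left t)"
proof -
  obtain l where l: "(x \<longlongrightarrow> l) (at_left t)" using cadlag assms by (auto simp: cadlag_def)
  have "Lim (at_left t) x = l" by (rule tendsto_Lim[OF _ l]) simp
  then show ?thesis using l assms by (simp add: left_limit_def)
qed

lemma right_nbhd:
  assumes "0 \<le> t" "0 < e"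
  obtains h where "0 < h" "\<And>s. t \<le> s \<Longrightarrow> s < t + h \<Longrightarrow> \<bar>x s - x t\<bar> < e"
proof -
  have "eventually (\<lambda>s. \<bar>x s - x t\<bar> < e) (at_right t)"
    using tendstoD[OF right_cont[OF assms(1)] assms(2)] by (simp add: dist_real_def)
  then obtain b where b: "t < b" "\<And>s. t < s \<Longrightarrow> s < b \<Longrightarrow> \<bar>x s - x t\<bar> < e"
    unfolding eventually_at_right_field by blast
  show ?thesis
    by (rule that[of "b - t"]) (use b assms in \<open>auto simp: le_less\<close>)
qed

lemma left_nbhd:
  assumes "0 < t" "0 < e"
  obtains h where "0 < h" "\<And>s. t - h < s \<Longrightarrow> s < t \<Longrightarrow> \<bar>x s - left_limit x t\<bar> < e"
proof -
  have "eventually (\<lambda>s. \<bar>x s - left_limit x t\<bar> < e) (at_left t)"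
    using tendstoD[OF left_lim[OF assms(1)] assms(2)] by (simp add: dist_real_def)
  then obtain b where b: "b < t" "\<And>s. b < s \<Longrightarrow> s < t \<Longrightarrow> \<bar>x s - left_limit x t\<bar> < e"
    unfolding eventually_at_left_field by blast
  show ?thesis
    by (rule that[of "t - b"]) (use b in auto)
qed

lemma tendsto_right_seq:
  assumes "0 \<le> t" "eventually (\<lambda>n. t \<le> u n) sequentially" "u \<longlonglongrightarrow> t"
  shows "(\<lambda>n. x (u n)) \<longlonglongrightarrow> x t"
proof (rule tendstoI)
  fix e :: real assume "0 < e"
  then obtain h where h: "0 < h" "\<And>s. t \<le> s \<Longrightarrow> s < t + h \<Longrightarrow> \<bar>x s - x t\<bar> < e"
    using right_nbhd assms(1) by metis
  have "eventually (\<lambda>n. u n < t + h) sequentially"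
    by (rule order_tendstoD[OF assms(3)]) (use h in simp)
  with assms(2) show "eventually (\<lambda>n. dist (x (u n)) (x t) < e) sequentially"
    by eventually_elim (use h in \<open>simp add: dist_real_def\<close>)
qed

lemma left_limit_ge:
  assumes "0 < t" "\<And>s. 0 \<le> s \<Longrightarrow> s < t \<Longrightarrow> b \<le> x s"
  shows "b \<le> left_limit x t"
proof (rule tendsto_lowerbound[OF left_lim[OF assms(1)]])
  show "eventually (\<lambda>s. b \<le> x s) (at_left t)"
    unfolding eventually_at_left_field using assms by (intro exI[of _ 0]) auto
qed simp

definition hit :: real where "hit = Inf {s. 0 \<le> s \<and> x s < 1/2}"

lemma before_hit: "0 \<le> s \<Longrightarrow> s < hit \<Longrightarrow> 1/2 \<le> x s"
proof (rule ccontr)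
  assume s: "0 \<le> s" "s < hit" "\<not> 1/2 \<le> x s"
  have "hit \<le> s" unfolding hit_def
  proof (rule cInf_lower)
    show "bdd_below {s. 0 \<le> s \<and> x s < 1/2}" by (rule bdd_belowI[of _ 0]) simp
  qed (use s in simp)
  with s show False by simp
qed

lemma hit_le: "0 \<le> s \<Longrightarrow> x s < 1/2 \<Longrightarrow> hit \<le> s"
  using before_hit by force

lemma hit_nonneg: "0 \<le> hit"
  unfolding hit_def by (rule cInf_greatest) (use hits in auto)

lemma hit_pos: "0 < hit"
proof -
  obtain h where h: "0 < h" "\<And>s. 0 \<le> s \<Longrightarrow> s < 0 + h \<Longrightarrow> \<bar>x s - x 0\<bar> < 1/2"
    using right_nbhd[of 0 "1/2"] by auto
  have "h \<le> hit" unfolding hit_def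
  proof (rule cInf_greatest)
    show "{s. 0 \<le> s \<and> x s < 1/2} \<noteq> {}" using hits by auto
    fix s assume s: "s \<in> {s. 0 \<le> s \<and> x s < 1/2}"
    show "h \<le> s"
    proof (rule ccontr)
      assume "\<not> h \<le> s"
      then have "\<bar>x s - x 0\<bar> < 1/2" using h(2)[of s] s by auto
      then show False using s x0 by (auto simp: abs_less_iff)
    qed
  qed
  then show ?thesis using h by simp
qed

lemma hit_approx:
  assumes "0 < e" obtains s where "hit \<le> s" "s < hit + e" "x s < 1/2"
proof -
  have lt: "Inf {s. 0 \<le> s \<and> x s < 1/2} < hit + e" using assms by (simp add: hit_def)
  have ne: "{s. 0 \<le> s \<and> x s < 1/2} \<noteq> {}" using hits by auto
  from cInf_lessD[OF ne lt] obtain s where "s \<in> {s. 0 \<le> s \<and> x s < 1/2}" "s < hit + e"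
    by blast
  then show ?thesis using hit_le[of s] by (intro that[of s]) auto
qed

lemma left_limit_hit: "0 < s \<Longrightarrow> s \<le> hit \<Longrightarrow> 1/2 \<le> left_limit x s"
  by (rule left_limit_ge) (use before_hit in auto)

definition grid :: "nat \<Rightarrow> nat \<Rightarrow> real" where "grid n k = x (real k / 2^n)"

definition steps :: "nat \<Rightarrow> nat" where "steps n = (LEAST k. grid n k < 1/2)"

text \<open>By right continuity a value strictly below 1/2 persists on an interval to the right, and
  a fine grid meets that interval.\<close>

lemma grid_hit:
  assumes "0 < e"
  shows "eventually (\<lambda>n. \<exists>k. grid n k < 1/2 \<and> real k / 2^n < hit + e) sequentially"
proof -
  obtain s where s: "hit \<le> s" "s < hit + e" "x s < 1/2" using hit_approx[OF assms] by blast
  have s0: "0 \<le> s" using s hit_nonneg by simp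
  obtain h where h: "0 < h" "\<And>r. s \<le> r \<Longrightarrow> r < s + h \<Longrightarrow> \<bar>x r - x s\<bar> < 1/2 - x s"
    using right_nbhd[OF s0, of "1/2 - x s"] s by auto
  define d where "d = min h (hit + e - s)"
  have d: "0 < d" using h s by (simp add: d_def)
  have "(\<lambda>n. (1/2)^n :: real) \<longlonglongrightarrow> 0" by (rule LIMSEQ_realpow_zero) auto
  from order_tendstoD(2)[OF this d] show ?thesis
  proof eventually_elim
    case (elim n)
    define k where "k = nat \<lceil>s * 2^n\<rceil>"
    have k: "s * 2^n \<le> real k" "real k < s * 2^n + 1"
    proof -
      have "0 \<le> s * 2^n" using s0 by simp
      then have e: "real k = of_int \<lceil>s * 2^n\<rceil>" by (simp add: k_def)
      show "s * 2^n \<le> real k" "real k < s * 2^n + 1" unfolding e by linarith+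
    qed
    have "s \<le> real k / 2^n" "real k / 2^n < s + (1/2)^n"
      using k by (simp_all add: field_simps power_one_over)
    then have "s \<le> real k / 2^n" "real k / 2^n < s + h" "real k / 2^n < hit + e"
      using elim by (auto simp: d_def)
    then show ?case using h(2)[of "real k / 2^n"] by (intro exI[of _ k]) (auto simp: grid_def)
  qed
qed

lemma steps_props:
  assumes "grid n k < 1/2"
  shows "grid n (steps n) < 1/2" "steps n \<le> k" "\<And>j. j < steps n \<Longrightarrow> 1/2 \<le> grid n j"
    "hit \<le> real (steps n) / 2^n"
proof -
  show 1: "grid n (steps n) < 1/2" unfolding steps_def by (rule LeastI[of _ k]) (rule assms)
  show "steps n \<le> k" unfolding steps_def by (rule Least_le) (rule assms)
  show "1/2 \<le> grid n j" if "j < steps n" for j using that not_less_Least[of j "\<lambda>k. grid n k < 1/2"] by (auto simp: steps_def)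
  show "hit \<le> real (steps n) / 2^n" using 1 by (intro hit_le) (auto simp: grid_def)
qed

lemma ev_grid: "eventually (\<lambda>n. \<exists>k. grid n k < 1/2) sequentially"
  using grid_hit[OF zero_less_one] by eventually_elim auto

lemma steps_tendsto: "(\<lambda>n. real (steps n) / 2^n) \<longlonglongrightarrow> hit"
proof (rule order_tendstoI)
  fix b assume b: "b < hit"
  from ev_grid show "eventually (\<lambda>n. b < real (steps n) / 2^n) sequentially"
    by eventually_elim (use steps_props(4) b in force)
next
  fix b assume b: "hit < b"
  from grid_hit[of "b - hit"] b have "eventually (\<lambda>n. \<exists>k. grid n k < 1/2 \<and> real k / 2^n < hit + (b - hit)) sequentially" by simp
  then show "eventually (\<lambda>n. real (steps n) / 2^n < b) sequentially"
  proof eventually_elim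
    case (elim n)
    then obtain k where k: "grid n k < 1/2" "real k / 2^n < b" by auto
    have "real (steps n) / 2^n \<le> real k / 2^n" using steps_props(2)[OF k(1)] by (intro divide_right_mono) auto
    then show ?case using k by simp
  qed
qed

lemma steps_value: "(\<lambda>n. grid n (steps n)) \<longlonglongrightarrow> x hit"
  unfolding grid_def
proof (rule tendsto_right_seq[OF hit_nonneg _ steps_tendsto])
  from ev_grid show "eventually (\<lambda>n. hit \<le> real (steps n) / 2^n) sequentially"
    by eventually_elim (use steps_props(4) in blast)
qed

lemma steps_horizon: "eventually (\<lambda>n. steps n \<le> n * 2^n) sequentially"
proof -
  have 1: "eventually (\<lambda>n. real (steps n) / 2^n < hit + 1) sequentially"
    by (rule order_tendstoD[OF steps_tendsto]) simp
  have 2: "eventually (\<lambda>n. hit + 1 \<le> real n) sequentially"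
    using eventually_ge_at_top[of "nat \<lceil>hit + 1\<rceil>"] by eventually_elim linarith
  from 1 2 show ?thesis
  proof eventually_elim
    case (elim n)
    then have "real (steps n) / 2^n \<le> real n" by simp
    then have "real (steps n) \<le> real (n * 2^n)" by (simp add: field_simps)
    then show ?case by (simp only: of_nat_le_iff)
  qed
qed

text \<open>
  Levels increase strictly to \<open>1/2\<close>, so that their passage times decrease to the passage time \<open>hit\<close>
  below \<open>1/2\<close>; a passage at the level \<open>1/2\<close> itself could happen by touching, unseen by the grids.
\<close>

definition level :: "nat \<Rightarrow> real" where "level n = 1/2 - 1 / (real n + 4)"

lemma level_bounds: "1/4 \<le> level n" "level n < 1/2"
  by (simp_all add: level_def field_simps)

definition time :: "nat \<Rightarrow> ereal" where "time n = passage_time x (level n)"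

lemma time_ge: "ereal hit \<le> time n"
  unfolding time_def passage_time_def
proof (rule INF_greatest)
  fix s assume "s \<in> {s. 0 \<le> s \<and> x s \<le> level n}"
  then have "0 \<le> s" "x s < 1/2" using level_bounds(2)[of n] by auto
  then show "ereal hit \<le> ereal s" using hit_le by simp
qed

lemma time_le:
  assumes "0 < e" shows "eventually (\<lambda>n. time n \<le> ereal (hit + e)) sequentially"
proof -
  obtain s where s: "hit \<le> s" "s < hit + e" "x s < 1/2" using hit_approx[OF assms] by blast
  have "(\<lambda>n. level n) \<longlonglongrightarrow> 1/2" unfolding level_def by real_asymp
  from order_tendstoD(1)[OF this s(3)] show ?thesis
  proof eventually_elim
    case (elim n)
    have "time n \<le> ereal s"
      unfolding time_def passage_time_def using s hit_nonneg elim by (intro INF_lower) auto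
    then show ?case using s by (meson ereal_less_eq(3) less_imp_le order_trans)
  qed
qed

lemma time_real: "eventually (\<lambda>n. time n = ereal (real_of_ereal (time n)) \<and> hit \<le> real_of_ereal (time n)) sequentially"
  using time_le[OF zero_less_one]
proof eventually_elim
  case (elim n)
  then show ?case using time_ge[of n] by (cases "time n") auto
qed

lemma time_tendsto: "(\<lambda>n. real_of_ereal (time n)) \<longlonglongrightarrow> hit"
proof (rule order_tendstoI)
  fix b assume "b < hit"
  with time_real show "eventually (\<lambda>n. b < real_of_ereal (time n)) sequentially"
    by (auto elim!: eventually_mono)
next
  fix b assume b: "hit < b"
  have "eventually (\<lambda>n. time n \<le> ereal (hit + (b - hit)/2)) sequentially" by (rule time_le) (use b in simp)
  with time_real show "eventually (\<lambda>n. real_of_ereal (time n) < b) sequentially"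
  proof eventually_elim
    case (elim n)
    then have "ereal (real_of_ereal (time n)) \<le> ereal (hit + (b - hit)/2)" by simp
    then have "real_of_ereal (time n) \<le> hit + (b - hit)/2" by (simp only: ereal_less_eq)
    then show ?case using b by (simp add: field_simps)
  qed
qed

lemma time_value: "(\<lambda>n. x (real_of_ereal (time n))) \<longlonglongrightarrow> x hit"
  by (rule tendsto_right_seq[OF hit_nonneg _ time_tendsto]) (use time_real in \<open>auto elim!: eventually_mono\<close>)

definition alive :: "ereal \<Rightarrow> bool" where
  "alive \<tau> \<longleftrightarrow> (\<forall>s\<ge>0. ereal s \<le> \<tau> \<longrightarrow> \<bar>jump x s\<bar> < left_limit x s / 2)"

lemma functional_eq: "functional \<beta> x (level n) = x (real_of_ereal (time n)) powr (-\<beta>) * of_bool (alive (time n))"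
  by (simp add: functional_def Let_def alive_def time_def)

lemma alive_antimono: "alive t \<Longrightarrow> s \<le> t \<Longrightarrow> alive s"
  unfolding alive_def by (meson order_trans)

lemma value_left_jump: "x s = left_limit x s + jump x s"
  by (simp add: jump_def)

lemma alive_value_pos:
  assumes "alive (ereal hit)" shows "0 < x hit"
proof -
  have "\<bar>jump x hit\<bar> < left_limit x hit / 2" using assms hit_nonneg by (simp add: alive_def)
  then show ?thesis using value_left_jump[of hit] left_limit_hit[OF hit_pos] by (simp add: abs_less_iff)
qed

text \<open>\<open>time n\<close> may exceed \<open>hit\<close>. Shortly after \<open>hit\<close>
  the path stays within an eighth of the positive value \<open>x hit\<close>, where no jump reaches
  half of the left limit.\<close>

lemma alive_eventually:
  assumes "alive (ereal hit)" shows "eventually (\<lambda>n. alive (time n)) sequentially"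
proof -
  have p: "0 < x hit" using assms by (rule alive_value_pos)
  obtain h where h: "0 < h" "\<And>s. hit \<le> s \<Longrightarrow> s < hit + h \<Longrightarrow> \<bar>x s - x hit\<bar> < x hit / 8"
    using right_nbhd[OF hit_nonneg, of "x hit / 8"] p by auto
  have "eventually (\<lambda>n. time n \<le> ereal (hit + h/2)) sequentially" by (rule time_le) (use h in simp)
  then show ?thesis
  proof eventually_elim
    case (elim n)
    show ?case unfolding alive_def
    proof (intro allI impI)
      fix s :: real assume s: "0 \<le> s" "ereal s \<le> time n"
      show "\<bar>jump x s\<bar> < left_limit x s / 2"
      proof (cases "s \<le> hit")
        case True then show ?thesis using assms s by (simp add: alive_def)
      next
        case False
        have "ereal s \<le> ereal (hit + h/2)" using order_trans[OF s(2) elim] .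
        then have sh: "s < hit + h" using h by simp
        have s0: "0 < s" using False hit_nonneg by simp
        have xs: "\<bar>x s - x hit\<bar> < x hit / 8" using h(2)[of s] False sh by simp
        have ev: "eventually (\<lambda>r. \<bar>x r - x hit\<bar> < x hit / 8) (at_left s)"
          unfolding eventually_at_left_field using False h(2) sh by (intro exI[of _ hit]) auto
        have 1: "left_limit x s \<le> x hit + x hit / 8"

        proof (rule tendsto_upperbound[OF left_lim[OF s0]])
          show "eventually (\<lambda>r. x r \<le> x hit + x hit / 8) (at_left s)"
            using ev by eventually_elim linarith
        qed simp
        have 2: "x hit - x hit / 8 \<le> left_limit x s"

        proof (rule tendsto_lowerbound[OF left_lim[OF s0]])
          show "eventually (\<lambda>r. x hit - x hit / 8 \<le> x r) (at_left s)"
            using ev by eventually_elim linarith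
        qed simp
        show ?thesis using 1 2 xs p unfolding jump_def by (simp add: abs_less_iff abs_if split: if_splits)
      qed
    qed
  qed
qed

end

section \<open>Ratios of nearby path values\<close>

context hitting_path begin

text \<open>Survival gives \<open>x s > l / 2\<close> for the left limit \<open>l\<close>. Values
  before \<open>s\<close> are close to \<open>l\<close> and later ones close to \<open>x s\<close>,
  which settles each position of \<open>u\<close> and \<open>v\<close> relative to
  \<open>s\<close>.\<close>

lemma ratio_nbhd:
  assumes al: "alive (ereal hit)" and s: "0 \<le> s" "s \<le> hit"
  obtains h where "0 < h" "\<And>u v. 0 \<le> u \<Longrightarrow> s - h < u \<Longrightarrow> u < v \<Longrightarrow> v < s + h \<Longrightarrow> x u / 2 < x v"
proof -
  define l where "l = left_limit x s"
  have l: "1/2 \<le> l"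
    using left_limit_hit[of s] s x0 by (cases "s = 0") (auto simp: l_def left_limit_def)
  have xs: "l / 2 < x s"
  proof -
    have "\<bar>jump x s\<bar> < left_limit x s / 2" using al s by (simp add: alive_def)
    then show ?thesis unfolding l_def using value_left_jump[of s] by (simp add: abs_less_iff)
  qed
  \<comment> \<open>The slack \<open>x s - l/2\<close> is shared by a pair straddling
    \<open>s\<close>; the eighths serve pairs on one side.\<close>
  define e where "e = min (l / 8) (min (x s / 8) ((x s - l/2) / 2))"
  have e: "0 < e" "e \<le> l / 8" "e \<le> x s / 8" "e \<le> (x s - l/2) / 2"
  proof -
    show "0 < e" using l xs by (simp add: e_def)
    show "e \<le> l / 8" unfolding e_def by linarith
    show "e \<le> x s / 8" unfolding e_def by linarith
    show "e \<le> (x s - l/2) / 2" unfolding e_def by linarith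
  qed
  obtain h1 where h1: "0 < h1" "\<And>r. s \<le> r \<Longrightarrow> r < s + h1 \<Longrightarrow> \<bar>x r - x s\<bar> < e"
    using right_nbhd[OF s(1) e(1)] by blast
  obtain h2 where h2: "0 < h2" "\<And>r. 0 \<le> r \<Longrightarrow> s - h2 < r \<Longrightarrow> r < s \<Longrightarrow> \<bar>x r - l\<bar> < e"
  proof (cases "s = 0")
    case True then show ?thesis by (intro that[of 1]) auto
  next
    case False
    then show ?thesis using left_nbhd[of s e] s e(1) that unfolding l_def by (metis less_le)
  qed
  show ?thesis
  proof (rule that[of "min h1 h2"])
    show "0 < min h1 h2" using h1 h2 by simp
    fix u v assume uv: "0 \<le> u" "s - min h1 h2 < u" "u < v" "v < s + min h1 h2"
    consider "v < s" | "u < s" "s \<le> v" | "s \<le> u" by linarith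
    then show "x u / 2 < x v"
    proof cases
      case 1
      have "\<bar>x u - l\<bar> < e" "\<bar>x v - l\<bar> < e" using uv 1 by (auto intro!: h2(2))
      then show ?thesis using e by linarith
    next
      case 2
      have "\<bar>x u - l\<bar> < e" using uv 2 by (intro h2(2)) auto
      then have u: "x u < l + e" by linarith
      have "\<bar>x v - x s\<bar> < e" using uv 2 by (intro h1(2)) auto
      then have v: "x s - e < x v" by linarith
      have "e * 2 \<le> x s - l/2" using e(4) by simp
      then show ?thesis using u v e(1) xs by (simp add: field_simps)
    next
      case 3
      have "\<bar>x u - x s\<bar> < e" "\<bar>x v - x s\<bar> < e" using uv 3 by (auto intro!: h1(2))
      then show ?thesis using e by linarith
    qed
  qed
qed

lemma ratio_uniform:
  assumes al: "alive (ereal hit)"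
  obtains h where "0 < h" "\<And>u v. 0 \<le> u \<Longrightarrow> u < v \<Longrightarrow> v < u + h \<Longrightarrow> v < hit + h \<Longrightarrow> x u / 2 < x v"
proof -
  define \<G> where "\<G> = {G. open G \<and> (\<forall>u v. u \<in> G \<longrightarrow> v \<in> G \<longrightarrow> 0 \<le> u \<longrightarrow> u < v \<longrightarrow> x u / 2 < x v)}"
  obtain e where e: "0 < e" "\<And>s. s \<in> {0..hit} \<Longrightarrow> \<exists>G\<in>\<G>. ball s e \<subseteq> G"
  proof (rule Heine_Borel_lemma[of "{0..hit}" \<G>])
    show "{0..hit} \<subseteq> \<Union>\<G>"
    proof
      fix s assume s: "s \<in> {0..hit}"
      then obtain h where h: "0 < h" "\<And>u v. 0 \<le> u \<Longrightarrow> s - h < u \<Longrightarrow> u < v \<Longrightarrow> v < s + h \<Longrightarrow> x u / 2 < x v"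
        using ratio_nbhd[OF al, of s] by auto
      then have "{s-h<..<s+h} \<in> \<G>" by (auto simp: \<G>_def)
      moreover have "s \<in> {s-h<..<s+h}" using h by simp
      ultimately show "s \<in> \<Union>\<G>" by blast
    qed
    show "open G" if "G \<in> \<G>" for G using that by (simp add: \<G>_def)
  qed (use that in auto)
  show ?thesis
  proof (rule that[OF e(1)])
    fix u v assume uv: "0 \<le> u" "u < v" "v < u + e" "v < hit + e"
    \<comment> \<open>\<open>u\<close> itself may lie beyond \<open>hit\<close>, so the ball is
      centered at its projection to the interval.\<close>
    have "min u hit \<in> {0..hit}" using uv hit_nonneg by auto
    then obtain G where G: "G \<in> \<G>" "ball (min u hit) e \<subseteq> G" using e(2) by blast
    have "u \<in> ball (min u hit) e" "v \<in> ball (min u hit) e"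
      using uv e(1) by (auto simp: dist_real_def min_def)
    then have "u \<in> G" "v \<in> G" using G(2) by auto
    then show "x u / 2 < x v" using G(1) uv by (simp add: \<G>_def)
  qed
qed

lemma ratio_grid:
  assumes al: "alive (ereal hit)"
  shows "eventually (\<lambda>n. \<forall>j<steps n. 1/2 \<le> grid n (Suc j) / grid n j) sequentially"
proof -
  obtain h where h: "0 < h" "\<And>u v. 0 \<le> u \<Longrightarrow> u < v \<Longrightarrow> v < u + h \<Longrightarrow> v < hit + h \<Longrightarrow> x u / 2 < x v"
    using ratio_uniform[OF al] by blast
  have "(\<lambda>n. (1/2)^n :: real) \<longlonglongrightarrow> 0" by (rule LIMSEQ_realpow_zero) auto
  from order_tendstoD(2)[OF this h(1)] have 1: "eventually (\<lambda>n. (1/2)^n < h) sequentially" .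
  have 2: "eventually (\<lambda>n. real (steps n) / 2^n < hit + h) sequentially"
    by (rule order_tendstoD[OF steps_tendsto]) (use h in simp)
  from 1 2 ev_grid show ?thesis
  proof eventually_elim
    case (elim n)
    show ?case
    proof (intro allI impI)
      fix j assume j: "j < steps n"
      have p: "1/2 \<le> grid n j" using elim(3) steps_props(3) j by blast
      have "real (Suc j) / 2^n \<le> real (steps n) / 2^n" using j by (intro divide_right_mono) auto
      moreover have "real (Suc j) / 2^n = real j / 2^n + (1/2)^n" by (simp add: add_divide_distrib power_one_over)
      ultimately have "x (real j / 2^n) / 2 < x (real (Suc j) / 2^n)"
        using elim by (intro h(2)) (auto simp: power_one_over)
      then show "1/2 \<le> grid n (Suc j) / grid n j" using p by (simp add: grid_def field_simps)
    qed
  qed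
qed

text \<open>Positive jumps being absent, a killing jump goes down and leaves at most half of the
  left limit. It cannot occur at time 0, where the jump is 0 and the left limit 1.\<close>

lemma big_jump:
  assumes "\<not> alive (ereal hit)"
  obtains s where "0 < s" "s \<le> hit" "x s \<le> left_limit x s / 2" "1/2 \<le> left_limit x s"
proof -
  obtain s where s: "0 \<le> s" "s \<le> hit" "\<not> \<bar>jump x s\<bar> < left_limit x s / 2"
    using assms by (auto simp: alive_def)
  have "s \<noteq> 0" using s x0 by (auto simp: jump_def left_limit_def)
  then have s0: "0 < s" using s by simp
  have "x s \<le> left_limit x s / 2" using s(3) no_pos[OF s0] value_left_jump[of s] by auto
  then show ?thesis using that s0 s left_limit_hit by blast
qed

end

section \<open>One-sided comparison along a path\<close>

locale cutoff_path = cutoff a c \<beta> + hitting_path x for a c \<beta> x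
begin

lemma grid_0: "grid n 0 = 1"
  by (simp add: grid_def x0)

lemma stopped_grid: "eventually (\<lambda>n. stopped (grid n) (n * 2^n) = weight (grid n) (steps n)) sequentially"
  using steps_horizon ev_grid
proof eventually_elim
  case (elim n)
  then obtain k where "grid n k < 1/2" by blast
  from steps_props[OF this] elim show ?case by (intro stopped_eq_weight) auto
qed

text \<open>The grid cell around the killing jump has ratio tending to
  \<open>x s / l \<le> 1/2 < a\<close>, so its factor is eventually 0. The strict gap covers a loss
  of exactly one half.\<close>

lemma dead_weight:
  assumes "\<not> alive (ereal hit)" and a2: "1/2 < a"
  shows "eventually (\<lambda>n. weight (grid n) (steps n) = 0) sequentially"
proof -
  obtain s where s: "0 < s" "s \<le> hit" "x s \<le> left_limit x s / 2" "1/2 \<le> left_limit x s"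
    using big_jump[OF assms(1)] by blast
  define l where "l = left_limit x s"
  \<comment> \<open>Last index strictly before \<open>s\<close>: the grid times \<open>k n\<close>
    approach from the left and give the left limit, their successors are at or after
    \<open>s\<close> and give \<open>x s\<close>.\<close>
  define k where "k n = nat \<lceil>s * 2^n\<rceil> - 1" for n :: nat
  have k: "real (k n) / 2^n < s" "s \<le> real (Suc (k n)) / 2^n" for n
  proof -
    have "0 < s * 2^n" using s by simp
    then have "1 \<le> \<lceil>s * 2^n\<rceil>" by linarith
    moreover have "real (nat z - 1) = of_int z - 1" if "1 \<le> z" for z :: int
      using that by (cases z) (auto simp: of_nat_diff)
    ultimately have e: "real (k n) = of_int \<lceil>s * 2^n\<rceil> - 1" unfolding k_def by blast
    have "real (k n) < s * 2^n" "s * 2^n \<le> real (Suc (k n))" using e by (simp_all only: of_nat_Suc, linarith+)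
    then show "real (k n) / 2^n < s" "s \<le> real (Suc (k n)) / 2^n" by (simp_all add: field_simps)
  qed
  have k': "real (Suc (k n)) / 2^n = real (k n) / 2^n + (1/2)^n" for n
    by (simp add: add_divide_distrib power_one_over)
  have z: "(\<lambda>n. (1/2)^n :: real) \<longlonglongrightarrow> 0" by (rule LIMSEQ_realpow_zero) auto
  \<comment> \<open>This fact and \<open>antiderivative_at_0_high\<close> below are local: they
    state that the two grid times bracketing \<open>s\<close> converge to it, and shadow the
    unrelated lemmas of the same names.\<close>
  have antiderivative_at_0_low: "(\<lambda>n. real (k n) / 2^n) \<longlonglongrightarrow> s"
  proof (rule tendsto_sandwich)
    show "(\<lambda>n. s - (1/2)^n) \<longlonglongrightarrow> s" using tendsto_diff[OF tendsto_const z, of s] by simp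
    show "eventually (\<lambda>n. s - (1/2)^n \<le> real (k n) / 2^n) sequentially"
      using k(2) k' by (intro always_eventually allI) (simp add: algebra_simps)
    show "eventually (\<lambda>n. real (k n) / 2^n \<le> s) sequentially"
      using k(1) by (intro always_eventually allI less_imp_le)
  qed (rule tendsto_const)
  have antiderivative_at_0_high: "(\<lambda>n. real (Suc (k n)) / 2^n) \<longlonglongrightarrow> s"
    unfolding k' using tendsto_add[OF antiderivative_at_0_low z] by simp
  have A: "(\<lambda>n. grid n (k n)) \<longlonglongrightarrow> l"
    unfolding grid_def l_def
  proof (rule filterlim_compose[OF left_lim[OF s(1)]])
    show "filterlim (\<lambda>n. real (k n) / 2^n) (at_left s) sequentially"
      unfolding filterlim_at using antiderivative_at_0_low k(1) by (auto simp: less_imp_neq)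
  qed
  have B: "(\<lambda>n. grid n (Suc (k n))) \<longlonglongrightarrow> x s"
    unfolding grid_def by (rule tendsto_right_seq[OF _ _ antiderivative_at_0_high]) (use s k(2) in auto)
  have "(\<lambda>n. grid n (Suc (k n)) / grid n (k n)) \<longlonglongrightarrow> x s / l"
    using s by (intro tendsto_divide A B) (auto simp: l_def)
  moreover have "x s / l \<le> 1/2" using s by (simp add: l_def field_simps)
  then have "x s / l < a" using a2 by linarith
  ultimately have "eventually (\<lambda>n. grid n (Suc (k n)) / grid n (k n) < a) sequentially"
    by (rule order_tendstoD)
  then show ?thesis using ev_grid
  proof eventually_elim
    case (elim n)
    then have "hit \<le> real (steps n) / 2^n" using steps_props(4) by blast
    then have "real (k n) / 2^n < real (steps n) / 2^n" using k(1)[of n] s by linarith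
    then have "k n < steps n" by (simp add: divide_less_cancel)
    moreover have "kap (grid n (Suc (k n)) / grid n (k n)) = 0" using elim by (intro kap_eq_0) simp
    ultimately show ?case unfolding weight_def by (intro prod_zero) auto
  qed
qed

lemma functional_dead: "\<not> alive (ereal hit) \<Longrightarrow> functional \<beta> x (level n) = 0"
  unfolding functional_eq using alive_antimono[OF _ time_ge] by auto

lemma functional_nonneg: "0 \<le> functional \<beta> x d"
  by (simp add: functional_def Let_def)

lemma powr_limit:
  assumes "0 < x hit" "u \<longlonglongrightarrow> x hit" shows "(\<lambda>n. u n powr (-\<beta>)) \<longlonglongrightarrow> x hit powr (-\<beta>)"
  using assms by (intro tendsto_powr tendsto_const) auto

text \<open>On killed paths the sampled value is eventually 0. On surviving ones the weight is at
  most the pure power, whose limit is that of the functional by right continuity at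
  \<open>hit\<close>.\<close>

lemma path_upper:
  assumes a2: "1/2 < a"
  shows "(\<lambda>n. max 0 (stopped (grid n) (n * 2^n) - functional \<beta> x (level n))) \<longlonglongrightarrow> 0"
proof (cases "alive (ereal hit)")
  case False
  have "eventually (\<lambda>n. max 0 (stopped (grid n) (n * 2^n) - functional \<beta> x (level n)) = 0) sequentially"
    using stopped_grid dead_weight[OF False a2] by eventually_elim (simp add: functional_dead[OF False])
  then show ?thesis by (rule tendsto_eventually)
next
  case True
  have p: "0 < x hit" using True by (rule alive_value_pos)
  let ?g = "\<lambda>n. max 0 (grid n (steps n) powr (-\<beta>) - x (real_of_ereal (time n)) powr (-\<beta>))"
  have lim: "?g \<longlonglongrightarrow> max 0 (x hit powr (-\<beta>) - x hit powr (-\<beta>))"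
    by (intro tendsto_intros powr_limit p steps_value time_value)
  have pos: "eventually (\<lambda>n. 0 < grid n (steps n)) sequentially"
    by (rule order_tendstoD(1)[OF steps_value p])
  show ?thesis
  proof (rule tendsto_sandwich[OF _ _ tendsto_const])
    show "?g \<longlonglongrightarrow> 0" using lim by simp
    show "eventually (\<lambda>n. max 0 (stopped (grid n) (n * 2^n) - functional \<beta> x (level n)) \<le> ?g n) sequentially"
      using stopped_grid alive_eventually[OF True] pos
    proof eventually_elim
      case (elim n)
      have "weight (grid n) (steps n) \<le> grid n (steps n) powr (-\<beta>)"
        by (rule weight_le) (use elim grid_0 in auto)
      then show ?case using elim by (auto simp: functional_eq)
    qed
  qed auto
qed

text \<open>On killed paths the functional is 0. On surviving ones all ratios are eventually at
  least \<open>1/2 \<ge> c\<close>, so the weight equals the pure power.\<close>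

lemma path_lower:
  assumes c2: "c \<le> 1/2"
  shows "(\<lambda>n. max 0 (functional \<beta> x (level n) - stopped (grid n) (n * 2^n))) \<longlonglongrightarrow> 0"
proof (cases "alive (ereal hit)")
  case False
  have "max 0 (functional \<beta> x (level n) - stopped (grid n) (n * 2^n)) = 0" for n
    using stopped_bounds(1)[of "grid n", OF grid_0] by (simp add: functional_dead[OF False])
  then show ?thesis by simp
next
  case True
  have p: "0 < x hit" using True by (rule alive_value_pos)
  let ?g = "\<lambda>n. max 0 (x (real_of_ereal (time n)) powr (-\<beta>) - grid n (steps n) powr (-\<beta>))"
  have lim: "?g \<longlonglongrightarrow> max 0 (x hit powr (-\<beta>) - x hit powr (-\<beta>))"
    by (intro tendsto_intros powr_limit p steps_value time_value)
  show ?thesis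
  proof (rule tendsto_sandwich[OF _ _ tendsto_const])
    show "?g \<longlonglongrightarrow> 0" using lim by simp
    show "eventually (\<lambda>n. max 0 (functional \<beta> x (level n) - stopped (grid n) (n * 2^n)) \<le> ?g n) sequentially"
      using stopped_grid ratio_grid[OF True] ev_grid
    proof eventually_elim
      case (elim n)
      then obtain k where k: "grid n k < 1/2" by blast
      have "weight (grid n) (steps n) = grid n (steps n) powr (-\<beta>)"
      proof -
        have "0 < grid n j" if "j < steps n" for j using steps_props(3)[OF k that] by simp
        moreover have "c \<le> grid n (Suc j) / grid n j" if "j < steps n" for j
          using elim(2) that c2 by (meson order_trans)
        ultimately show ?thesis using weight_eq[of "grid n" "steps n", OF grid_0] by blast
      qed
      then show ?case using elim powr_ge_zero[of "grid n (steps n)" "-\<beta>"]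
        by (auto simp: functional_eq le_max_iff_disj)
    qed
  qed auto
qed

text \<open>Until passage the path exceeds \<open>level n \<ge> 1/4\<close>, so a last jump of less
  than half the left limit leaves at least 1/8. An infinite passage time yields at most the power of
  \<open>x 0 = 1\<close>.\<close>

lemma functional_le: "functional \<beta> x (level n) \<le> 8 powr \<beta>"
proof -
  have one: "1 \<le> 8 powr \<beta>" using \<beta> by (intro ge_one_powr_ge_zero) auto
  show ?thesis
  proof (cases "alive (time n) \<and> time n \<noteq> \<infinity>")
    case False
    then show ?thesis using one x0 by (auto simp: functional_eq)
  next
    case True
    define t where "t = real_of_ereal (time n)"
    have t: "time n = ereal t" "hit \<le> t" using True time_ge[of n] by (auto simp: t_def) (cases "time n"; auto)+
    have t0: "0 < t" using t hit_pos by simp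
    have "1/4 \<le> left_limit x t"
    proof (rule left_limit_ge[OF t0])
      fix s assume s: "0 \<le> s" "s < t"
      have "\<not> x s \<le> level n"
      proof
        assume "x s \<le> level n"
        then have "time n \<le> ereal s" unfolding time_def passage_time_def using s by (intro INF_lower) auto
        then show False using t s by simp
      qed
      moreover have "1/4 \<le> level n" by (rule level_bounds)
      ultimately show "1/4 \<le> x s" by simp
    qed
    moreover have "\<bar>jump x t\<bar> < left_limit x t / 2" using True t t0 by (auto simp: alive_def)
    ultimately have "1/8 \<le> x t" using value_left_jump[of t] by (simp add: abs_less_iff)
    then have "x t powr (-\<beta>) \<le> (1/8) powr (-\<beta>)" using \<beta> by (intro powr_mono2') auto
    also have "\<dots> = 8 powr \<beta>" by (simp add: powr_divide powr_minus field_simps)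
    finally show ?thesis using True by (simp add: functional_eq t_def)
  qed
qed

end

subsection \<open>The stable process\<close>

locale stable_from_one = spectrally_negative_stable_process M X 1 \<gamma>
  for M :: "'a measure" and X :: "real \<Rightarrow> 'a \<Rightarrow> real" and \<gamma> :: real
begin

lemma gamma_pos: "0 < \<gamma>"
  using index by auto

lemma X_measurable [measurable]: "0 \<le> t \<Longrightarrow> X t \<in> borel_measurable M"
  by (rule measurable_process)

definition law :: "real \<Rightarrow> real measure" where
  "law t = distr M borel (\<lambda>\<omega>. X t \<omega> - X 0 \<omega>)"

lemma sets_law [measurable_cong]: "sets (law t) = sets borel"
  by (simp add: law_def)

lemma space_law: "space (law t) = UNIV"
  by (simp add: law_def)

lemma prob_space_law: "0 \<le> t \<Longrightarrow> prob_space (law t)"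
  unfolding law_def by (rule prob_space_distr) measurable

lemma law_increment: "0 \<le> s \<Longrightarrow> 0 \<le> t \<Longrightarrow> distr M borel (\<lambda>\<omega>. X (s + t) \<omega> - X s \<omega>) = law t"
  unfolding law_def by (rule stationary_increments)

lemma law_scale: "0 < r \<Longrightarrow> 0 \<le> t \<Longrightarrow> law (r * t) = distr (law t) borel (\<lambda>y. r powr (1/\<gamma>) * y)"
  using stable[of r t] unfolding law_def by (subst distr_distr) (auto simp: comp_def)

lemma law_laplace:
  assumes "0 \<le> t" "0 \<le> l"
  shows "(\<integral>y. exp (l * y) \<partial>law t) = (if 1 < \<gamma> then exp (t * l powr \<gamma>) else exp (- t * l powr \<gamma>))"
proof -
  have "(\<integral>y. exp (l * y) \<partial>law t) = expectation (\<lambda>\<omega>. exp (l * (X t \<omega> - X 0 \<omega>)))"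
    unfolding law_def using assms by (intro integral_distr) auto
  also have "\<dots> = expectation (\<lambda>\<omega>. exp (l * (X t \<omega> - 1)))"
    by (rule integral_cong_AE) (use assms start in auto)
  finally show ?thesis using laplace[OF assms] by simp
qed

lemma law_exp_integrable: "0 \<le> t \<Longrightarrow> 0 \<le> l \<Longrightarrow> integrable (law t) (\<lambda>y. exp (l * y))"
  using law_laplace[of t l] not_integrable_integral_eq[of "law t" "\<lambda>y. exp (l * y)"] by (auto split: if_splits)

section \<open>Almost sure passage below 1/2\<close>

lemma law_negative: obtains a where "0 < a" "0 < measure (law 1) {..-a}"
proof -
  interpret L: prob_space "law 1" by (rule prob_space_law) simp
  have "\<exists>n::nat. 0 < measure (law 1) {..- (1 / real (Suc n))}"
  proof (rule ccontr)
    assume "\<not> ?thesis"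
    then have z: "measure (law 1) {..- (1 / real (Suc n))} = 0" for n
      by (metis measure_nonneg less_le)
    have "AE y in law 1. \<forall>n::nat. y \<notin> {..- (1 / real (Suc n))}"
    proof (subst AE_all_countable, rule allI)
      fix n :: nat
      have "emeasure (law 1) {..- (1 / real (Suc n))} = 0" using z[of n] by (simp add: L.emeasure_eq_measure)
      then have "{..- (1 / real (Suc n))} \<in> null_sets (law 1)" by (intro null_setsI) auto
      then show "AE y in law 1. y \<notin> {..- (1 / real (Suc n))}" by (rule AE_not_in)
    qed
    then have nn: "AE y in law 1. 0 \<le> y"
    proof eventually_elim
      case (elim y)
      show ?case
      proof (rule ccontr)
        assume "\<not> 0 \<le> y"
        then obtain n where "inverse (real (Suc n)) < - y" using reals_Archimedean[of "-y"] by auto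
        then show False using elim by (auto simp: inverse_eq_divide dest!: spec[of _ n])
      qed
    qed
    \<comment> \<open>A law on the nonnegative half-line has Laplace integral at least 1 here,
      against \<open>exp (-1)\<close> for \<gamma> < 1. For \<gamma> > 1 the slope 0 of exp
      (l^\<gamma>) at 0 forces mean 0, hence a point mass at 0, against
      \<open>exp 1\<close>.\<close>
    show False
    proof (cases "1 < \<gamma>")
      case False
      have "(\<integral>y. 1 \<partial>law 1) \<le> (\<integral>y. exp (1 * y) \<partial>law 1)"
        by (rule integral_mono_AE[OF _ law_exp_integrable]) (use nn in auto)
      then show False using law_laplace[of 1 1] False by (simp add: L.prob_space)
    next
      case True
      have yi: "integrable (law 1) (\<lambda>y. y)"
      proof (rule Bochner_Integration.integrable_bound[OF law_exp_integrable[of 1 1]])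
        show "AE y in law 1. norm y \<le> norm (exp (1 * y))"
          using nn by eventually_elim (simp add: exp_gt_self less_imp_le)
      qed auto
      have le: "(\<integral>y. y \<partial>law 1) \<le> (exp (1 * (e powr \<gamma>)) - 1) / e" if e: "0 < e" for e
      proof -
        have "(\<integral>y. y \<partial>law 1) \<le> (\<integral>y. (exp (e * y) - 1) / e \<partial>law 1)"
        proof (rule integral_mono[OF yi])
          show "integrable (law 1) (\<lambda>y. (exp (e * y) - 1) / e)"
            using law_exp_integrable[of 1 e] e by auto
          show "y \<le> (exp (e * y) - 1) / e" for y
            using exp_ge_add_one_self[of "e * y"] e by (simp add: field_simps)
        qed
        also have "\<dots> = ((\<integral>y. exp (e * y) \<partial>law 1) - 1) / e"
          using law_exp_integrable[of 1 e] e by (simp add: L.prob_space)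
        finally show ?thesis using law_laplace[of 1 e] True e by simp
      qed
      have "((\<lambda>e. (exp (1 * (e powr \<gamma>)) - 1) / e) \<longlongrightarrow> 0) (at_right 0)"
        using True by real_asymp
      then have "(\<integral>y. y \<partial>law 1) \<le> 0"
        by (rule tendsto_lowerbound)
           (use eventually_at_right_less[of 0] in \<open>auto elim!: eventually_mono dest!: le\<close>)
      moreover have "0 \<le> (\<integral>y. y \<partial>law 1)" by (rule integral_nonneg_AE[OF nn])
      ultimately have "AE y in law 1. y = 0"
        using integral_nonneg_eq_0_iff_AE[OF yi nn] by simp
      then have "(\<integral>y. exp (1 * y) \<partial>law 1) = (\<integral>y. 1 \<partial>law 1)"
        by (intro integral_cong_AE) auto
      then show False using law_laplace[of 1 1] True by (simp add: L.prob_space)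
    qed
  qed
  then obtain n :: nat where "0 < measure (law 1) {..- (1 / real (Suc n))}" by blast
  then show ?thesis by (intro that[of "1 / real (Suc n)"]) auto
qed

text \<open>\<open>X 0 = 1\<close> only holds almost surely; this version starts from \<open>1\<close> everywhere.\<close>

definition Y :: "real \<Rightarrow> 'a \<Rightarrow> real" where
  "Y t \<omega> = 1 + (X t \<omega> - X 0 \<omega>)"

lemma Y_measurable [measurable]: "0 \<le> t \<Longrightarrow> Y t \<in> borel_measurable M"
  unfolding Y_def[abs_def] by measurable

lemma AE_Y_eq: "AE \<omega> in M. \<forall>t. Y t \<omega> = X t \<omega>"
  using start by eventually_elim (simp add: Y_def)

lemma prob_increment:
  assumes "0 \<le> s" "0 < t" and [measurable]: "A \<in> sets borel"
  shows "prob ((\<lambda>\<omega>. X (s + t) \<omega> - X s \<omega>) -` A \<inter> space M) = measure (law 1) ((\<lambda>y. t powr (1/\<gamma>) * y) -` A)"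
proof -
  have "prob ((\<lambda>\<omega>. X (s + t) \<omega> - X s \<omega>) -` A \<inter> space M) = measure (distr M borel (\<lambda>\<omega>. X (s + t) \<omega> - X s \<omega>)) A"
    using assms by (subst measure_distr) auto
  also have "\<dots> = measure (law (t * 1)) A" using assms by (simp add: law_increment)
  also have "\<dots> = measure (law 1) ((\<lambda>y. t powr (1/\<gamma>) * y) -` A)"
    using assms by (subst law_scale) (auto simp: measure_distr space_law)
  finally show ?thesis .
qed

text \<open>
  Over each interval \<open>[R^i, R^(i+1)]\<close> the increment is very negative with a fixed positive probability,
  independently of the others, and for large \<open>R\<close> it dominates the position at time \<open>R^i\<close>.
\<close>

lemma prob_no_hit_le:
  fixes N :: nat and R a :: real
  assumes R: "R = real r" "2 \<le> R" and a: "0 < a"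
  shows "prob {\<omega> \<in> space M. \<forall>j::nat. 1/2 \<le> Y (real j) \<omega>}
    \<le> (1 - measure (law 1) {..-a}) ^ N + real N * measure (law 1) {a * (R - 1) powr (1/\<gamma>) - 1<..}"
proof -
  interpret L: prob_space "law 1" by (rule prob_space_law) simp
  let ?H = "{\<omega> \<in> space M. \<forall>j::nat. 1/2 \<le> Y (real j) \<omega>}"
  \<comment> \<open>\<open>R\<close> is an integer, so the times \<open>R ^ i\<close> are among the
    integer times tested by \<open>?H\<close>.\<close>
  define d where "d i = R ^ Suc i - R ^ i" for i :: nat
  have d: "0 < d i" "d i = R ^ i * (R - 1)" for i
    using R by (auto simp: d_def algebra_simps)
  define \<Delta> where "\<Delta> i \<omega> = X (R ^ Suc i) \<omega> - X (R ^ i) \<omega>" for i :: nat and \<omega>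
  have \<Delta>: "\<Delta> i = (\<lambda>\<omega>. X (R ^ i + d i) \<omega> - X (R ^ i) \<omega>)" for i by (simp add: \<Delta>_def d_def fun_eq_iff)
  have ind: "indep_vars (\<lambda>_. borel) \<Delta> {..<N}"
    unfolding \<Delta>_def
  proof (rule independent_increments)
    show "R ^ i \<le> R ^ Suc i" for i using R(2) by (intro power_increasing) auto
  qed (use R(2) in simp)
  \<comment> \<open>\<open>A\<close> says that the increment is not very negative, \<open>B\<close>
    that the position is too large to be compensated by it; on \<open>?H\<close> one of the two
    holds at each step.\<close>
  define A where "A i = {- a * d i powr (1/\<gamma>)<..}" for i :: nat
  define B where "B i = {\<omega> \<in> space M. a * d i powr (1/\<gamma>) < Y (R ^ i) \<omega>}" for i :: nat
  have Ri0: "0 \<le> R ^ i" for i using R(2) by simp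
  have [measurable]: "Y (R ^ i) \<in> borel_measurable M" "X (R ^ i) \<in> borel_measurable M" for i
    by (rule Y_measurable X_measurable, rule Ri0)+
  have [measurable]: "\<Delta> i \<in> borel_measurable M" for i
    unfolding \<Delta>_def[abs_def] by measurable
  have Bm: "B i \<in> events" for i unfolding B_def by measurable
  have Am: "\<Delta> i -` A i \<inter> space M \<in> events" for i
    by (rule measurable_sets[of _ _ borel]) (simp_all add: A_def)
  have sub: "?H \<subseteq> (space M \<inter> (\<Inter>i\<in>{..<N}. \<Delta> i -` A i \<inter> space M)) \<union> (\<Union>i\<in>{..<N}. B i)"
  proof
    fix \<omega> assume w: "\<omega> \<in> ?H"
    show "\<omega> \<in> (space M \<inter> (\<Inter>i\<in>{..<N}. \<Delta> i -` A i \<inter> space M)) \<union> (\<Union>i\<in>{..<N}. B i)"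
    proof (rule ccontr)
      assume n: "\<not> ?thesis"
      then obtain i where i: "i < N" "\<omega> \<notin> \<Delta> i -` A i" using w by blast
      have "\<omega> \<notin> B i" using n i by blast
      then have "Y (R ^ i) \<omega> \<le> a * d i powr (1/\<gamma>)" using w by (auto simp: B_def)
      moreover have "\<Delta> i \<omega> \<le> - a * d i powr (1/\<gamma>)" using i by (auto simp: A_def)
      ultimately have "Y (R ^ Suc i) \<omega> \<le> 0" by (simp add: Y_def \<Delta>_def)
      moreover have "1/2 \<le> Y (real (r ^ Suc i)) \<omega>" using w by blast
      ultimately show False by (simp add: R)
    qed
  qed
  have PA: "prob (\<Delta> i -` A i \<inter> space M) = 1 - measure (law 1) {..-a}" for i
  proof -
    have p: "0 < d i powr (1/\<gamma>)" using d(1)[of i] by simp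
    have "(- a * d i powr (1/\<gamma>) < d i powr (1/\<gamma>) * y) = (- a < y)" for y
      using mult_less_cancel_left_pos[OF p, of "-a" y] mult.commute[of "-a" "d i powr (1/\<gamma>)"] by metis
    then have "(\<lambda>y. d i powr (1/\<gamma>) * y) -` A i = {-a<..}"
      unfolding A_def greaterThan_def vimage_def mem_Collect_eq by simp
    moreover have "{-a<..} = space (law 1) - {..-a}" unfolding space_law by auto
    ultimately have v: "(\<lambda>y. d i powr (1/\<gamma>) * y) -` A i = space (law 1) - {..-a}" by (rule trans)
    have "prob (\<Delta> i -` A i \<inter> space M) = measure (law 1) ((\<lambda>y. d i powr (1/\<gamma>) * y) -` A i)"
      unfolding \<Delta> by (rule prob_increment[OF Ri0 d(1)]) (simp add: A_def)
    also have "\<dots> = 1 - measure (law 1) {..-a}"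
      unfolding v by (rule L.prob_compl) (simp add: sets_law)
    finally show ?thesis .
  qed
  have PB: "prob (B i) \<le> measure (law 1) {a * (R - 1) powr (1/\<gamma>) - 1<..}" for i
  proof -
    have Ri: "1 \<le> R ^ i" using R by simp
    have "B i = (\<lambda>\<omega>. X (0 + R ^ i) \<omega> - X 0 \<omega>) -` {a * d i powr (1/\<gamma>) - 1<..} \<inter> space M"
      by (auto simp: B_def Y_def)
    also have "prob \<dots> = measure (law 1) ((\<lambda>y. (R ^ i) powr (1/\<gamma>) * y) -` {a * d i powr (1/\<gamma>) - 1<..})"
      by (rule prob_increment) (use Ri in auto)
    also have "\<dots> \<le> measure (law 1) {a * (R - 1) powr (1/\<gamma>) - 1<..}"
    proof (rule L.finite_measure_mono)
      show "(\<lambda>y. (R ^ i) powr (1/\<gamma>) * y) -` {a * d i powr (1/\<gamma>) - 1<..} \<subseteq> {a * (R - 1) powr (1/\<gamma>) - 1<..}"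
      proof
        fix y assume "y \<in> (\<lambda>y. (R ^ i) powr (1/\<gamma>) * y) -` {a * d i powr (1/\<gamma>) - 1<..}"
        then have y: "a * d i powr (1/\<gamma>) - 1 < (R ^ i) powr (1/\<gamma>) * y" by simp
        define p where "p = (R ^ i) powr (1/\<gamma>)"
        \<comment> \<open>As \<open>p \<ge> 1\<close>, the constant 1 may be scaled up to
          \<open>p\<close>, which gives a bound independent of \<open>i\<close>.\<close>
        have p: "1 \<le> p" unfolding p_def using Ri gamma_pos by (intro ge_one_powr_ge_zero) auto
        have "d i powr (1/\<gamma>) = p * (R - 1) powr (1/\<gamma>)" unfolding d(2) p_def by (rule powr_mult)
        then have "p * (a * (R - 1) powr (1/\<gamma>)) - p * 1 < p * y" using y p by (simp add: p_def algebra_simps)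
        then have "p * (a * (R - 1) powr (1/\<gamma>) - 1) < p * y" by (simp only: right_diff_distrib)
        then show "y \<in> {a * (R - 1) powr (1/\<gamma>) - 1<..}" using p by simp
      qed
    qed simp
    finally show ?thesis .
  qed
  \<comment> \<open>Intersecting with \<open>space M\<close> covers \<open>N = 0\<close>, where the
    indexed intersection is the whole type.\<close>
  define E where "E = space M \<inter> (\<Inter>i\<in>{..<N}. \<Delta> i -` A i \<inter> space M)"
  have E: "E \<in> events \<and> prob E = (1 - measure (law 1) {..-a}) ^ N"
  proof (cases "N = 0")
    case True then show ?thesis by (simp add: E_def prob_space)
  next
    case False
    have "(\<Inter>i\<in>{..<N}. \<Delta> i -` A i \<inter> space M) \<subseteq> space M" using False by blast
    then have eq: "E = (\<Inter>i\<in>{..<N}. \<Delta> i -` A i \<inter> space M)" unfolding E_def by (rule Int_absorb1)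
    have "E \<in> events" unfolding eq by (rule sets.finite_INT) (use False Am in auto)
    moreover have "prob E = (\<Prod>i\<in>{..<N}. prob (\<Delta> i -` A i \<inter> space M))"
      unfolding eq by (rule indep_varsD[OF ind]) (use False in \<open>auto simp: A_def\<close>)
    ultimately show ?thesis by (simp add: PA)
  qed
  have UB: "(\<Union>i\<in>{..<N}. B i) \<in> events" by (rule sets.finite_UN) (use Bm in auto)
  have "prob ?H \<le> prob (E \<union> (\<Union>i\<in>{..<N}. B i))"
    by (rule finite_measure_mono[OF sub[folded E_def]]) (use E UB in auto)
  also have "\<dots> \<le> prob E + prob (\<Union>i\<in>{..<N}. B i)"
    by (rule measure_Un_le) (use E UB in auto)
  also have "prob E = (1 - measure (law 1) {..-a}) ^ N" using E by blast
  also have "prob (\<Union>i\<in>{..<N}. B i) \<le> (\<Sum>i<N. prob (B i))"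
    by (rule finite_measure_subadditive_finite) (use Bm in auto)
  also have "\<dots> \<le> (\<Sum>i<N. measure (law 1) {a * (R - 1) powr (1/\<gamma>) - 1<..})"
    by (rule sum_mono) (rule PB)
  finally show ?thesis by simp
qed

text \<open>In \<open>prob_no_hit_le\<close> first \<open>R\<close> tends to infinity with
  \<open>N\<close> fixed, which removes the tail term; then \<open>N\<close> tends to
  infinity.\<close>

lemma AE_hits: "AE \<omega> in M. \<exists>s\<ge>0. X s \<omega> < 1/2"
proof -
  interpret L: prob_space "law 1" by (rule prob_space_law) simp
  interpret L: real_distribution "law 1" by unfold_locales (auto simp: space_law sets_law)
  let ?H = "{\<omega> \<in> space M. \<forall>j::nat. 1/2 \<le> Y (real j) \<omega>}"
  obtain a where a: "0 < a" "0 < measure (law 1) {..-a}" using law_negative .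
  define q where "q = 1 - measure (law 1) {..-a}"
  have q: "0 \<le> q" "q < 1" using a by (auto simp: q_def)
  have "prob ?H \<le> q ^ N" for N
  proof (rule tendsto_lowerbound)
    have "filterlim (\<lambda>r::nat. a * (real r - 1) powr (1/\<gamma>) - 1) at_top sequentially"
      using a(1) gamma_pos by real_asymp
    from filterlim_compose[OF L.cdf_lim_at_top_prob this]
    have "(\<lambda>r::nat. q ^ N + real N * (1 - cdf (law 1) (a * (real r - 1) powr (1/\<gamma>) - 1))) \<longlonglongrightarrow> q ^ N + real N * (1 - 1)"
      by (intro tendsto_intros)
    then show "(\<lambda>r::nat. q ^ N + real N * (1 - cdf (law 1) (a * (real r - 1) powr (1/\<gamma>) - 1))) \<longlonglongrightarrow> q ^ N"
      by simp
    show "eventually (\<lambda>r::nat. prob ?H \<le> q ^ N + real N * (1 - cdf (law 1) (a * (real r - 1) powr (1/\<gamma>) - 1))) sequentially"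
      using eventually_ge_at_top[of 2]
    proof eventually_elim
      case (elim r)
      have "measure (law 1) {b<..} = 1 - cdf (law 1) b" for b
      proof -
        have "{b<..} = space (law 1) - {..b}" by (auto simp: space_law)
        then show ?thesis using L.prob_compl[of "{..b}"] by (simp add: cdf_def)
      qed
      then show ?case using prob_no_hit_le[OF refl _ a(1), of r N] elim by (simp add: q_def)
    qed
  qed simp
  moreover have "(\<lambda>N. q ^ N) \<longlonglongrightarrow> 0" using q by (intro LIMSEQ_realpow_zero)
  ultimately have "prob ?H \<le> 0" by (intro tendsto_lowerbound[of "\<lambda>N. q ^ N"]) auto
  then have "prob ?H = 0" by (simp add: measure_le_0_iff)
  moreover have "?H \<in> events"
  proof -
    have [measurable]: "Y (real j) \<in> borel_measurable M" for j :: nat by (rule Y_measurable) simp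
    show ?thesis by measurable
  qed

  ultimately have "AE \<omega> in M. \<omega> \<notin> ?H" by (intro AE_not_in) (simp add: emeasure_eq_measure null_setsI)
  then show ?thesis using AE_Y_eq AE_space
  proof eventually_elim
    case (elim \<omega>)
    then obtain j :: nat where "\<not> 1/2 \<le> Y (real j) \<omega>" by blast
    then show ?case using elim(2) by (intro exI[of _ "real j"]) simp
  qed
qed

end

section \<open>The sampled process and its expected growth\<close>

locale stable_cutoff = stable_from_one M X \<gamma> + cutoff a c \<beta>
  for M :: "'a measure" and X :: "real \<Rightarrow> 'a \<Rightarrow> real" and \<gamma> a c \<beta> :: real +
  fixes \<sigma> c0 e0 :: real
  assumes \<sigma>: "\<sigma> = 1 \<or> \<sigma> = -1" and c0: "0 < c0" and e0: "0 < e0"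
    and gen: "\<And>e. 0 < e \<Longrightarrow> e < e0 \<Longrightarrow> c0 * e \<le> \<sigma> * (\<integral>y. kap (1 + y) - 1 \<partial>law e)"
begin

definition S :: "nat \<Rightarrow> 'a \<Rightarrow> nat \<Rightarrow> real" where
  "S n \<omega> k = Y (real k / 2^n) \<omega>"

definition drift :: "nat \<Rightarrow> real \<Rightarrow> real" where
  "drift n x = (\<integral>d. kap ((x + d) / x) - 1 \<partial>law (1 / 2^n))"

lemma S_measurable [measurable]: "(\<lambda>\<omega>. S n \<omega> k) \<in> borel_measurable M"
  unfolding S_def by (rule Y_measurable) simp

lemma weight_measurable [measurable]: "(\<lambda>\<omega>. weight (S n \<omega>) k) \<in> borel_measurable M"
  unfolding weight_def by measurable

lemma stay_measurable [measurable]: "Measurable.pred M (\<lambda>\<omega>. stay (S n \<omega>) k)"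
  unfolding stay_def by measurable

lemma weight_bound: "weight S' k \<le> (4 powr \<beta>) ^ k"
proof -
  have "weight S' k \<le> (\<Prod>j<k. 4 powr \<beta>)"
    unfolding weight_def by (intro prod_mono conjI kap_nonneg kap_le)
  then show ?thesis by simp
qed

text \<open>Self-similarity: a step of length \<open>1 / 2^n\<close> from \<open>x\<close> has the
  relative law of a step of length \<open>x powr (-\<gamma>) / 2^n\<close> from 1. The small-time
  estimate at 1 thus serves all values from 1/2 on.\<close>

lemma drift_eq:
  assumes x: "0 < x"
  shows "drift n x = (\<integral>y. kap (1 + y) - 1 \<partial>law (x powr (-\<gamma>) * (1 / 2^n)))"
proof -
  have "(x powr (-\<gamma>)) powr (1/\<gamma>) = 1 / x"
  proof -
    have "(x powr (-\<gamma>)) powr (1/\<gamma>) = x powr ((-\<gamma>) * (1/\<gamma>))" by (rule powr_powr)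
    also have "(-\<gamma>) * (1/\<gamma>) = -1" using gamma_pos by simp
    finally show ?thesis using x by (simp add: powr_minus divide_inverse)
  qed
  then have "law (x powr (-\<gamma>) * (1 / 2^n)) = distr (law (1 / 2^n)) borel (\<lambda>y. 1 / x * y)"
    using law_scale[of "x powr (-\<gamma>)" "1 / 2^n"] x by simp
  then have "(\<integral>y. kap (1 + y) - 1 \<partial>law (x powr (-\<gamma>) * (1 / 2^n))) = (\<integral>y. kap (1 + 1 / x * y) - 1 \<partial>law (1 / 2^n))"
    by (simp only:) (rule integral_distr; measurable)
  moreover have "(x + d) / x = 1 + 1 / x * d" for d using x by (simp add: add_divide_distrib)
  ultimately show ?thesis by (simp add: drift_def)
qed

lemma drift_lower:
  assumes "1/2 \<le> x" "2 powr \<gamma> / 2^n < e0"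
  shows "c0 * (x powr (-\<gamma>) / 2^n) \<le> \<sigma> * drift n x"
proof -
  have "x powr (-\<gamma>) \<le> (1/2) powr (-\<gamma>)" using assms gamma_pos by (intro powr_mono2') auto
  also have "\<dots> = 2 powr \<gamma>" by (simp add: powr_divide powr_minus field_simps)
  finally have "x powr (-\<gamma>) / 2^n \<le> 2 powr \<gamma> / 2^n" by (intro divide_right_mono) auto
  then have "x powr (-\<gamma>) / 2^n < e0" using assms by linarith
  then have "c0 * (x powr (-\<gamma>) / 2^n) \<le> \<sigma> * (\<integral>y. kap (1 + y) - 1 \<partial>law (x powr (-\<gamma>) / 2^n))"
    using assms by (intro gen) auto
  then show ?thesis using drift_eq[of x n] assms by simp
qed

definition U :: "nat \<Rightarrow> nat \<Rightarrow> 'a \<Rightarrow> real" where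
  "U n k \<omega> = of_bool (stay (S n \<omega>) k) * weight (S n \<omega>) k"

lemma U_measurable [measurable]: "U n k \<in> borel_measurable M"
proof -
  have "U n k = (\<lambda>\<omega>. if stay (S n \<omega>) k then weight (S n \<omega>) k else 0)" by (auto simp: U_def fun_eq_iff)
  then show ?thesis by simp
qed

lemma U_bounds: "0 \<le> U n k \<omega>" "U n k \<omega> \<le> (4 powr \<beta>) ^ k"
  using weight_nonneg[of "S n \<omega>" k] weight_bound[of "S n \<omega>" k] by (auto simp: U_def)

lemma U_step_bound: "\<bar>U n k \<omega> * (kap v - 1)\<bar> \<le> (4 powr \<beta>) ^ k * (4 powr \<beta> + 1)"
  unfolding abs_mult using U_bounds[of n k \<omega>] kap_nonneg[of v] kap_le[of v]
  by (intro mult_mono) auto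

lemma U_integrable: "integrable M (\<lambda>\<omega>. U n k \<omega> * (kap (S n \<omega> (Suc k) / S n \<omega> k) - 1))"
  by (rule integrable_const_bound[where B="(4 powr \<beta>) ^ k * (4 powr \<beta> + 1)"])
     (use U_step_bound in auto)

lemma drift_measurable [measurable]: "drift n \<in> borel_measurable borel"
proof -
  interpret L: prob_space "law (1 / 2^n)" by (rule prob_space_law) simp
  show ?thesis unfolding drift_def[abs_def] by measurable
qed

text \<open>Markov property at a grid time: weight and position are a function \<open>\<Phi>\<close>
  of the first \<open>k\<close> increments, which are independent of the next one; Fubini integrates
  the latter out.\<close>

lemma one_step:
  "expectation (\<lambda>\<omega>. U n k \<omega> * (kap (S n \<omega> (Suc k) / S n \<omega> k) - 1)) = expectation (\<lambda>\<omega>. U n k \<omega> * drift n (S n \<omega> k))"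
proof -
  define D where "D i \<omega> = X (real (Suc i) / 2^n) \<omega> - X (real i / 2^n) \<omega>" for i \<omega>
  define sumS where "sumS d j = 1 + (\<Sum>i<j. d i)" for d :: "nat \<Rightarrow> real" and j
  define \<Phi> where "\<Phi> d = (of_bool (stay (sumS d) k) * weight (sumS d) k, sumS d k)" for d
  have Dm [measurable]: "D i \<in> borel_measurable M" for i
  proof -
    have [measurable]: "X (real j / 2^n) \<in> borel_measurable M" for j by (rule X_measurable) simp
    show ?thesis unfolding D_def[abs_def] by measurable
  qed
  have ind: "indep_vars (\<lambda>_. borel) D {..<Suc k}"
    unfolding D_def[abs_def] by (rule independent_increments) (auto intro!: divide_right_mono)
  have Dk: "distr M borel (D k) = law (1 / 2^n)"
  proof -
    have "D k = (\<lambda>\<omega>. X (real k / 2^n + 1 / 2^n) \<omega> - X (real k / 2^n) \<omega>)"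
      by (simp add: D_def[abs_def] add_divide_distrib add.commute)
    then show ?thesis by (simp add: law_increment)
  qed
  have SD: "S n \<omega> j = sumS (\<lambda>i. D i \<omega>) j" for j \<omega>
    using sum_lessThan_telescope[of "\<lambda>i. X (real i / 2^n) \<omega>" j] by (simp add: S_def sumS_def D_def Y_def)
  have sumS_restrict: "sumS (restrict d {..<k}) j = sumS d j" if "j \<le> k" for d j
    unfolding sumS_def using that by (intro arg_cong2[where f="(+)"] sum.cong) auto
  have \<Phi>_restrict: "\<Phi> (restrict d {..<k}) = \<Phi> d" for d
    unfolding \<Phi>_def stay_def weight_def by (simp add: sumS_restrict)
  have sumSm: "(\<lambda>d. sumS d j) \<in> borel_measurable (PiM {..<k} (\<lambda>_. borel))" if "j \<le> k" for j
    unfolding sumS_def using that by (intro borel_measurable_add borel_measurable_const borel_measurable_sum measurable_component_singleton) auto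
  have \<Phi>m: "\<Phi> \<in> measurable (PiM {..<k} (\<lambda>_. borel)) (borel \<Otimes>\<^sub>M borel)"
  proof -
    have w: "(\<lambda>d. weight (sumS d) k) \<in> borel_measurable (PiM {..<k} (\<lambda>_. borel))"
      unfolding weight_def
      by (intro borel_measurable_prod measurable_compose[OF _ kap_measurable] borel_measurable_divide sumSm) auto
    have st: "Measurable.pred (PiM {..<k} (\<lambda>_. borel)) (\<lambda>d. stay (sumS d) k)"
    proof -
      have "(\<lambda>d. stay (sumS d) k) = (\<lambda>d. \<forall>j\<in>{..k}. 1/2 \<le> sumS d j)" by (auto simp: stay_def fun_eq_iff)
      then show ?thesis
      proof (simp only:, intro pred_intros_finite)
        fix j assume "j \<in> {..k}"
        then have [measurable]: "(\<lambda>d. sumS d j) \<in> borel_measurable (PiM {..<k} (\<lambda>_. borel))" by (intro sumSm) simp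
        show "Measurable.pred (PiM {..<k} (\<lambda>_. borel)) (\<lambda>d. 1/2 \<le> sumS d j)" by measurable
      qed simp
    qed
    have "(\<lambda>d. if stay (sumS d) k then weight (sumS d) k else 0) \<in> borel_measurable (PiM {..<k} (\<lambda>_. borel))"
      using w st by measurable
    moreover have "(\<lambda>d. if stay (sumS d) k then weight (sumS d) k else 0) = (\<lambda>d. of_bool (stay (sumS d) k) * weight (sumS d) k)"
      by auto
    ultimately show ?thesis unfolding \<Phi>_def using sumSm[of k] by (intro measurable_Pair) auto
  qed
  define R1 where "R1 \<omega> = restrict (\<lambda>i. D i \<omega>) {..<k}" for \<omega>
  define R2 where "R2 \<omega> = restrict (\<lambda>i. D i \<omega>) {k}" for \<omega>
  have Z: "\<Phi> (R1 \<omega>) = (U n k \<omega>, S n \<omega> k)" for \<omega>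
    unfolding R1_def \<Phi>_restrict by (simp add: \<Phi>_def U_def SD[abs_def])
  have iv: "indep_var (PiM {..<k} (\<lambda>_. borel)) R1 (PiM {k} (\<lambda>_. borel)) R2"
    unfolding R1_def[abs_def] R2_def[abs_def] by (rule indep_var_restrict[OF ind]) auto
  have [measurable]: "R1 \<in> measurable M (PiM {..<k} (\<lambda>_. borel))" "R2 \<in> measurable M (PiM {k} (\<lambda>_. borel))"
    using iv indep_var_rv1 indep_var_rv2 by blast+
  define P where "P = distr M (PiM {..<k} (\<lambda>_. borel)) R1"
  define Q where "Q = distr M (PiM {k} (\<lambda>_. borel)) R2"
  interpret P: prob_space P unfolding P_def by (rule prob_space_distr) measurable
  interpret Q: prob_space Q unfolding Q_def by (rule prob_space_distr) measurable
  interpret PQ: pair_sigma_finite P Q ..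
  have [measurable_cong]: "sets P = sets (PiM {..<k} (\<lambda>_. borel))" "sets Q = sets (PiM {k} (\<lambda>_. borel))"
    by (simp_all add: P_def Q_def)
  have joint: "P \<Otimes>\<^sub>M Q = distr M (PiM {..<k} (\<lambda>_. borel) \<Otimes>\<^sub>M PiM {k} (\<lambda>_. borel)) (\<lambda>\<omega>. (R1 \<omega>, R2 \<omega>))"
    using iv unfolding indep_var_distribution_eq P_def Q_def by blast
  define G where "G = (\<lambda>(z :: real \<times> real, d :: real). fst z * (kap ((snd z + d) / snd z) - 1))"
  have Gm [measurable]: "G \<in> borel_measurable ((borel \<Otimes>\<^sub>M borel) \<Otimes>\<^sub>M borel)"
    unfolding G_def by measurable
  note [measurable] = \<Phi>m
  define F where "F = (\<lambda>(d1, d2). G (\<Phi> d1, d2 k))"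
  have Fm [measurable]: "F \<in> borel_measurable (PiM {..<k} (\<lambda>_. borel) \<Otimes>\<^sub>M PiM {k} (\<lambda>_. borel))"
    unfolding F_def by measurable
  have S_Suc: "S n \<omega> (Suc k) = S n \<omega> k + D k \<omega>" for \<omega> by (simp add: SD sumS_def)
  have R2k: "R2 \<omega> k = D k \<omega>" for \<omega> by (simp add: R2_def)
  have FZ: "F (R1 \<omega>, R2 \<omega>) = U n k \<omega> * (kap (S n \<omega> (Suc k) / S n \<omega> k) - 1)" for \<omega>
    by (simp add: F_def G_def Z S_Suc R2k)
  have Fi: "integrable (P \<Otimes>\<^sub>M Q) F"
    unfolding joint by (subst integrable_distr_eq) (simp_all add: FZ U_integrable)
  have inner: "(\<integral>d2. F (d1, d2) \<partial>Q) = fst (\<Phi> d1) * drift n (snd (\<Phi> d1))" for d1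
  proof -
    obtain u v where uv: "\<Phi> d1 = (u, v)" by fastforce
    have "(\<lambda>d. u * (kap ((v + d) / v) - 1)) \<in> borel_measurable borel" by measurable
    then have Gs: "(\<lambda>d. G (\<Phi> d1, d)) \<in> borel_measurable borel" by (simp add: uv G_def)
    have [measurable]: "(\<lambda>d2. G (\<Phi> d1, d2 k)) \<in> borel_measurable (PiM {k} (\<lambda>_. borel))"
      using measurable_compose[OF _ Gs, of "\<lambda>d2. d2 k" "PiM {k} (\<lambda>_. borel)"] by simp
    have "(\<integral>d2. F (d1, d2) \<partial>Q) = expectation (\<lambda>\<omega>. G (\<Phi> d1, D k \<omega>))"
      unfolding Q_def by (subst integral_distr) (simp_all add: F_def R2k)
    also have "\<dots> = (\<integral>d. G (\<Phi> d1, d) \<partial>law (1 / 2^n))"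
      unfolding Dk[symmetric] by (rule integral_distr[symmetric, OF Dm Gs])
    finally show ?thesis by (simp add: G_def drift_def)
  qed
  have "expectation (\<lambda>\<omega>. U n k \<omega> * (kap (S n \<omega> (Suc k) / S n \<omega> k) - 1)) = integral\<^sup>L (P \<Otimes>\<^sub>M Q) F"
    unfolding joint by (subst integral_distr) (simp_all add: FZ)
  also have "\<dots> = (\<integral>d1. (\<integral>d2. F (d1, d2) \<partial>Q) \<partial>P)"
    by (rule PQ.integral_fst'[OF Fi, symmetric])
  also have "\<dots> = expectation (\<lambda>\<omega>. fst (\<Phi> (R1 \<omega>)) * drift n (snd (\<Phi> (R1 \<omega>))))"
    unfolding inner P_def by (rule integral_distr) measurable
  finally show ?thesis by (simp add: Z)
qed

text \<open>Quantifies over all grids at once, so that one event, still a countable intersection,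
  serves every \<open>n\<close>.\<close>

definition calm :: "nat \<Rightarrow> 'a set" where
  "calm m = {\<omega> \<in> space M. \<forall>n k. real k / 2^n \<le> 1 / 2^m \<longrightarrow> \<bar>S n \<omega> k - 1\<bar> \<le> 1/8}"

lemma calm_events: "calm m \<in> events"
  unfolding calm_def by measurable

lemma calm_large: obtains m where "1/2 < prob (calm m)"
proof -
  have inc: "incseq calm"
  proof (rule incseq_SucI)
    fix m
    have "(1 :: real) / 2 ^ Suc m \<le> 1 / 2 ^ m" by (simp add: field_simps)
    then show "calm m \<subseteq> calm (Suc m)" unfolding calm_def by (auto intro: order_trans)
  qed
  have "AE \<omega> in M. \<omega> \<in> (\<Union>m. calm m)"
    using cadlag_paths AE_Y_eq start AE_space
  proof eventually_elim
    case (elim \<omega>)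
    have "((\<lambda>t. X t \<omega>) \<longlongrightarrow> X 0 \<omega>) (at_right 0)" using elim by (auto simp: cadlag_def)
    then have "eventually (\<lambda>t. \<bar>X t \<omega> - 1\<bar> < 1/8) (at_right 0)"
      using tendstoD[of "\<lambda>t. X t \<omega>" "X 0 \<omega>" "at_right 0" "1/8"] elim by (simp add: dist_real_def)
    then obtain b where b: "0 < b" "\<And>t. 0 < t \<Longrightarrow> t < b \<Longrightarrow> \<bar>X t \<omega> - 1\<bar> < 1/8"
      unfolding eventually_at_right_field by blast
    obtain m where m: "(1/2 :: real) ^ m < b" using real_arch_pow_inv[OF b(1), of "1/2"] by auto
    have "\<omega> \<in> calm m" unfolding calm_def
    proof (intro CollectI conjI allI impI)
      fix n k assume "real k / 2^n \<le> 1 / 2^m"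
      then have l: "real k / 2^n < b" using m by (simp add: power_one_over)
      show "\<bar>S n \<omega> k - 1\<bar> \<le> 1/8"
      proof (cases "k = 0")
        case False
        then show ?thesis using b(2)[of "real k / 2^n"] l elim by (simp add: S_def less_imp_le)
      qed (simp add: S_def Y_def)
    qed (use elim in simp)
    then show ?case by blast
  qed
  then have "prob (\<Union>m. calm m) = 1"
    using calm_events by (subst prob_eq_1) auto
  moreover have "(\<lambda>m. prob (calm m)) \<longlonglongrightarrow> prob (\<Union>m. calm m)"
    by (rule finite_Lim_measure_incseq[OF _ inc]) (use calm_events in auto)
  ultimately have "eventually (\<lambda>m. 1/2 < prob (calm m)) sequentially"
    by (intro order_tendstoD(1)[where y="prob (\<Union>m. calm m)"]) auto
  then show ?thesis using that by (auto simp: eventually_sequentially)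
qed

text \<open>Values between 7/8 and 9/8 have ratios of at least 7/9, above
  \<open>3/4 \<ge> c\<close>, so no factor is damped.\<close>

lemma calm_U:
  assumes w: "\<omega> \<in> calm m" and k: "real k / 2^n \<le> 1 / 2^m"
  shows "(9/8) powr (-\<beta>) \<le> U n k \<omega>" "(9/8) powr (-\<gamma>) \<le> S n \<omega> k powr (-\<gamma>)" "1/2 \<le> S n \<omega> k"
proof -
  have b: "7/8 \<le> S n \<omega> j" "S n \<omega> j \<le> 9/8" if "j \<le> k" for j
  proof -
    have "real j / 2^n \<le> real k / 2^n" using that by (intro divide_right_mono) auto
    then have "\<bar>S n \<omega> j - 1\<bar> \<le> 1/8" using w k unfolding calm_def by (blast intro: order_trans)
    then have "7/8 \<le> S n \<omega> j \<and> S n \<omega> j \<le> 9/8" by linarith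
    then show "7/8 \<le> S n \<omega> j" "S n \<omega> j \<le> 9/8" by blast+
  qed
  have "weight (S n \<omega>) k = S n \<omega> k powr (-\<beta>) \<and> 0 < S n \<omega> k"
  proof (rule weight_eq)
    show "S n \<omega> 0 = 1" by (simp add: S_def Y_def)
    show "0 < S n \<omega> j" if "j < k" for j using b(1)[of j] that by simp
    show "c \<le> S n \<omega> (Suc j) / S n \<omega> j" if "j < k" for j
    proof -
      have "3/4 * S n \<omega> j \<le> S n \<omega> (Suc j)" using b[of j] b[of "Suc j"] that by simp
      then have "3/4 \<le> S n \<omega> (Suc j) / S n \<omega> j" using b(1)[of j] that by (simp add: le_divide_eq)
      then show ?thesis using c by linarith
    qed
  qed
  moreover have "stay (S n \<omega>) k" unfolding stay_def
  proof (intro allI impI)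
    show "1/2 \<le> S n \<omega> j" if "j \<le> k" for j using b(1)[OF that] by simp
  qed
  moreover have "(9/8) powr (-\<beta>) \<le> S n \<omega> k powr (-\<beta>)" using b[of k] \<beta> by (intro powr_mono2') auto
  ultimately show "(9/8) powr (-\<beta>) \<le> U n k \<omega>" by (simp add: U_def)
  show "(9/8) powr (-\<gamma>) \<le> S n \<omega> k powr (-\<gamma>)" using b[of k] gamma_pos by (intro powr_mono2') auto
  show "1/2 \<le> S n \<omega> k" using b(1)[of k] by simp
qed

text \<open>Multiplied by \<sigma>, every one-step mean is nonnegative. On \<open>calm m\<close>, of
  probability above 1/2, each of the first \<open>2^(n-m)\<close> steps yields at least
  \<open>\<kappa> / 2^n\<close>, which adds up to an amount independent of \<open>n\<close>.\<close>

lemma growth: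
  obtains \<eta> where "0 < \<eta>"
    "eventually (\<lambda>n. \<eta> \<le> \<sigma> * (expectation (\<lambda>\<omega>. stopped (S n \<omega>) (n * 2^n)) - 1)) sequentially"
proof -
  obtain m where m: "1/2 < prob (calm m)" using calm_large by blast
  define \<kappa> where "\<kappa> = (9/8) powr (-\<beta>) * (c0 * (9/8) powr (-\<gamma>))"
  have \<kappa>: "0 < \<kappa>" using c0 by (simp add: \<kappa>_def)
  have term_nonneg: "0 \<le> U n k \<omega> * (\<sigma> * drift n (S n \<omega> k))" and
    term_calm: "\<omega> \<in> calm m \<Longrightarrow> real k / 2^n \<le> 1 / 2^m \<Longrightarrow> \<kappa> / 2^n \<le> U n k \<omega> * (\<sigma> * drift n (S n \<omega> k))"
    if n: "2 powr \<gamma> / 2^n < e0" for n k \<omega>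
  proof -
    show "0 \<le> U n k \<omega> * (\<sigma> * drift n (S n \<omega> k))"
    proof (cases "stay (S n \<omega>) k")
      case True
      then have "1/2 \<le> S n \<omega> k" by (simp add: stay_def)
      from drift_lower[OF this n] have "0 \<le> \<sigma> * drift n (S n \<omega> k)"
        by (rule order_trans[rotated]) (use c0 in simp)
      then show ?thesis by (rule mult_nonneg_nonneg[OF U_bounds(1)])
    qed (simp add: U_def)
    assume w: "\<omega> \<in> calm m" "real k / 2^n \<le> 1 / 2^m"
    note C = calm_U[OF w]
    have "c0 * (9/8) powr (-\<gamma>) / 2^n \<le> c0 * (S n \<omega> k powr (-\<gamma>) / 2^n)"
      using C(2) c0 by (simp add: divide_right_mono)
    also have "\<dots> \<le> \<sigma> * drift n (S n \<omega> k)" by (rule drift_lower[OF C(3) n])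
    finally have "(9/8) powr (-\<beta>) * (c0 * (9/8) powr (-\<gamma>) / 2^n) \<le> U n k \<omega> * (\<sigma> * drift n (S n \<omega> k))"
      using C(1) c0 by (intro mult_mono) (auto intro: order_trans[OF powr_ge_zero])
    then show "\<kappa> / 2^n \<le> U n k \<omega> * (\<sigma> * drift n (S n \<omega> k))" by (simp add: \<kappa>_def)
  qed
  have Ed: "integrable M (\<lambda>\<omega>. U n k \<omega> * drift n (S n \<omega> k))" for n k
  proof (rule integrable_const_bound[where B="(4 powr \<beta>) ^ k * (4 powr \<beta> + 1)"])
    interpret L: prob_space "law (1 / 2^n)" by (rule prob_space_law) simp
    have "\<bar>drift n x\<bar> \<le> 4 powr \<beta> + 1" for x
    proof -
      have ki: "integrable (law (1 / 2^n)) (\<lambda>d. \<bar>kap ((x + d) / x) - 1\<bar>)"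
      proof (rule L.integrable_const_bound[where B="4 powr \<beta> + 1"])
        have "norm \<bar>kap ((x + d) / x) - 1\<bar> \<le> 4 powr \<beta> + 1" for d
          using kap_nonneg[of "(x + d) / x"] kap_le[of "(x + d) / x"] by simp
        then show "AE d in law (1 / 2^n). norm \<bar>kap ((x + d) / x) - 1\<bar> \<le> 4 powr \<beta> + 1" by simp
      qed measurable
      have "\<bar>drift n x\<bar> \<le> (\<integral>d. \<bar>kap ((x + d) / x) - 1\<bar> \<partial>law (1 / 2^n))"
        unfolding drift_def by (rule integral_abs_bound)
      also have "\<dots> \<le> (\<integral>d. 4 powr \<beta> + 1 \<partial>law (1 / 2^n))"
      proof (rule integral_mono[OF ki])
        show "\<bar>kap ((x + d) / x) - 1\<bar> \<le> 4 powr \<beta> + 1" for d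
          using kap_nonneg[of "(x + d) / x"] kap_le[of "(x + d) / x"] by linarith
      qed simp
      finally show ?thesis by (simp add: L.prob_space)
    qed
    then have "\<bar>U n k \<omega> * drift n (S n \<omega> k)\<bar> \<le> (4 powr \<beta>) ^ k * (4 powr \<beta> + 1)" for \<omega>
      unfolding abs_mult using U_bounds[of n k \<omega>] by (intro mult_mono) auto
    then show "AE \<omega> in M. norm (U n k \<omega> * drift n (S n \<omega> k)) \<le> (4 powr \<beta>) ^ k * (4 powr \<beta> + 1)" by simp
  qed measurable
  have main: "\<kappa> / 2 / 2^m \<le> \<sigma> * (expectation (\<lambda>\<omega>. stopped (S n \<omega>) (n * 2^n)) - 1)"
    if n: "2 powr \<gamma> / 2^n < e0" "m \<le> n" "1 \<le> n" for n
  proof -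
    let ?T = "\<lambda>k. expectation (\<lambda>\<omega>. U n k \<omega> * (\<sigma> * drift n (S n \<omega> k)))"
    have Ti: "integrable M (\<lambda>\<omega>. U n k \<omega> * (\<sigma> * drift n (S n \<omega> k)))" for k
      using integrable_mult_right[OF Ed, of \<sigma> n k] by (simp add: mult.left_commute)
    have "stopped (S n \<omega>) (n * 2^n) = 1 + (\<Sum>k<n * 2^n. U n k \<omega> * (kap (S n \<omega> (Suc k) / S n \<omega> k) - 1))" for \<omega>
      by (simp add: stopped_def U_def)
    then have "expectation (\<lambda>\<omega>. stopped (S n \<omega>) (n * 2^n)) = 1 + (\<Sum>k<n * 2^n. expectation (\<lambda>\<omega>. U n k \<omega> * (kap (S n \<omega> (Suc k) / S n \<omega> k) - 1)))"
      using U_integrable by (simp add: prob_space)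
    then have "\<sigma> * (expectation (\<lambda>\<omega>. stopped (S n \<omega>) (n * 2^n)) - 1) = (\<Sum>k<n * 2^n. \<sigma> * expectation (\<lambda>\<omega>. U n k \<omega> * drift n (S n \<omega> k)))"
      by (simp add: one_step sum_distrib_left)
    also have "\<dots> = (\<Sum>k<n * 2^n. ?T k)"
      by (simp add: mult.left_commute)
    also have "\<dots> \<ge> (\<Sum>k<2^(n-m). ?T k)"
    proof (rule sum_mono2)
      have "(2::nat) ^ (n - m) \<le> 1 * 2 ^ n" by (simp add: power_increasing)
      also have "\<dots> \<le> n * 2^n" using n(3) by (intro mult_right_mono) auto
      finally show "{..<2^(n-m)} \<subseteq> {..<n * 2^n}" by auto
      show "0 \<le> ?T k" for k by (rule integral_nonneg_AE) (simp add: term_nonneg[OF n(1)])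
    qed simp
    moreover have "(\<Sum>k<(2::nat)^(n-m). \<kappa> / 2^n / 2) \<le> (\<Sum>k<2^(n-m). ?T k)"
    proof (rule sum_mono)
      fix k assume "k \<in> {..<(2::nat)^(n-m)}"
      then have "k \<le> 2^(n-m)" by simp
      then have "real k \<le> real (2^(n-m))" by (simp only: of_nat_le_iff)
      then have "real k / 2^n \<le> 2^(n-m) / 2^n" by (intro divide_right_mono) auto
      also have "(2::real)^(n-m) / 2^n = 1 / 2^m" using n(2) by (simp add: power_diff)
      finally have k: "real k / 2^n \<le> 1 / 2^m" .
      have "\<kappa> / 2^n / 2 \<le> \<kappa> / 2^n * prob (calm m)" using m \<kappa> by (simp add: field_simps)
      also have "\<dots> = expectation (\<lambda>\<omega>. \<kappa> / 2^n * indicator (calm m) \<omega>)"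
        using calm_events[of m] by simp
      also have "\<dots> \<le> ?T k"
      proof (rule integral_mono)
        show "integrable M (\<lambda>\<omega>. \<kappa> / 2^n * indicator (calm m) \<omega>)"
          using calm_events[of m]
          by (intro integrable_mult_right integrable_real_indicator) (auto simp: emeasure_eq_measure)
        show "\<kappa> / 2^n * indicator (calm m) \<omega> \<le> U n k \<omega> * (\<sigma> * drift n (S n \<omega> k))" for \<omega>
          using term_calm[OF n(1) _ k, of \<omega>] term_nonneg[OF n(1), of k \<omega>] by (cases "\<omega> \<in> calm m") auto
      qed (rule Ti)
      finally show "\<kappa> / 2^n / 2 \<le> ?T k" .
    qed
    moreover have "(\<Sum>k<(2::nat)^(n-m). \<kappa> / 2^n / 2) = \<kappa> / 2 / 2^m"
    proof -
      have "(2::real)^n = 2^(n-m) * 2^m" using n(2) by (simp flip: power_add)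
      then show ?thesis by simp
    qed
    ultimately show ?thesis by linarith
  qed
  have "(\<lambda>n::nat. 2 powr \<gamma> / 2^n) \<longlonglongrightarrow> 0" by real_asymp
  from order_tendstoD(2)[OF this e0]
  have "eventually (\<lambda>n. \<kappa> / 2 / 2^m \<le> \<sigma> * (expectation (\<lambda>\<omega>. stopped (S n \<omega>) (n * 2^n)) - 1)) sequentially"
    using eventually_ge_at_top[of m] eventually_ge_at_top[of 1] by eventually_elim (rule main)
  then show ?thesis using \<kappa> by (intro that[of "\<kappa> / 2 / 2^m"]) auto
qed

end

text \<open>The mean of \<open>\<sigma> * (V n - f n)\<close> is eventually at least
  \<open>\<eta>\<close>, yet it is at most that of the positive part \<open>W n\<close>, which tends
  to 0 by dominated convergence.\<close>

lemma (in stable_cutoff) no_invariant: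
  assumes side: "\<sigma> = 1 \<and> 1/2 < a \<or> \<sigma> = -1 \<and> c \<le> 1/2"
    and inv: "\<And>d. 0 < d \<Longrightarrow> d < 1 \<Longrightarrow> expectation (\<lambda>\<omega>. functional \<beta> (\<lambda>t. X t \<omega>) d) = 1"
  shows False
proof -
  define lev where "lev n = 1/2 - 1 / (real n + 4)" for n :: nat
  define f where "f n \<omega> = functional \<beta> (\<lambda>t. X t \<omega>) (lev n)" for n \<omega>
  define V where "V n \<omega> = stopped (S n \<omega>) (n * 2^n)" for n \<omega>
  define W where "W n \<omega> = max 0 (\<sigma> * (V n \<omega> - f n \<omega>))" for n \<omega>
  have lev: "0 < lev n" "lev n < 1" for n by (auto simp: lev_def field_simps)
  have fe: "expectation (f n) = 1" for n unfolding f_def[abs_def] by (rule inv[OF lev])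
  \<comment> \<open>A non-integrable function has integral 0, so the value 1 yields integrability
    and with it measurability of the functional.\<close>
  have fi: "integrable M (f n)" for n using fe[of n] not_integrable_integral_eq[of M "f n"] by auto
  then have [measurable]: "f n \<in> borel_measurable M" for n by auto
  have [measurable]: "V n \<in> borel_measurable M" for n
  proof -
    have "V n = (\<lambda>\<omega>. 1 + (\<Sum>k<n * 2^n. U n k \<omega> * (kap (S n \<omega> (Suc k) / S n \<omega> k) - 1)))"
      by (simp add: V_def[abs_def] stopped_def U_def)
    then show ?thesis by simp
  qed
  have S0: "S n \<omega> 0 = 1" for n \<omega> by (simp add: S_def Y_def)
  have Vb: "0 \<le> V n \<omega>" "V n \<omega> \<le> 8 powr \<beta>" for n \<omega>
    unfolding V_def using stopped_bounds[of "S n \<omega>"] S0 by auto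
  have Vi: "integrable M (V n)" for n
    by (rule integrable_const_bound[where B="8 powr \<beta>"]) (use Vb in auto)
  have path: "AE \<omega> in M. (\<lambda>n. W n \<omega>) \<longlonglongrightarrow> 0 \<and> (\<forall>n. norm (W n \<omega>) \<le> 8 powr \<beta>)"
    using cadlag_paths no_positive_jumps start AE_hits AE_Y_eq
  proof eventually_elim
    case (elim \<omega>)
    interpret cutoff_path a c \<beta> "\<lambda>t. X t \<omega>"
      by unfold_locales (use elim in auto)
    have Sg: "S n \<omega> = grid n" for n
      using elim(5) by (simp add: S_def[abs_def] grid_def[abs_def])
    have lv: "lev n = level n" for n by (simp add: lev_def level_def)
    have fb: "0 \<le> f n \<omega>" "f n \<omega> \<le> 8 powr \<beta>" for n
      using functional_nonneg functional_le by (auto simp: f_def lv)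
    show ?case
    proof
      show "(\<lambda>n. W n \<omega>) \<longlonglongrightarrow> 0"
        using side
      proof
        assume "\<sigma> = 1 \<and> 1/2 < a"
        then show ?thesis using path_upper by (simp add: W_def V_def f_def Sg lv)
      next
        assume "\<sigma> = -1 \<and> c \<le> 1/2"
        then show ?thesis using path_lower by (simp add: W_def V_def f_def Sg lv)
      qed
      show "\<forall>n. norm (W n \<omega>) \<le> 8 powr \<beta>"
      proof
        fix n
        have "\<sigma> * (V n \<omega> - f n \<omega>) \<le> 8 powr \<beta>"
          using Vb(1)[of n \<omega>] Vb(2)[of n \<omega>] fb[of n] \<sigma> by auto
        then show "norm (W n \<omega>) \<le> 8 powr \<beta>" by (simp add: W_def)
      qed
    qed
  qed
  have Wm [measurable]: "W n \<in> borel_measurable M" for n unfolding W_def[abs_def] by measurable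
  have "(\<lambda>n. expectation (W n)) \<longlonglongrightarrow> expectation (\<lambda>_. 0)"
  proof (rule integral_dominated_convergence[where w="\<lambda>_. 8 powr \<beta>"])
    show "AE \<omega> in M. (\<lambda>n. W n \<omega>) \<longlonglongrightarrow> 0" using path by eventually_elim simp
    show "AE \<omega> in M. norm (W n \<omega>) \<le> 8 powr \<beta>" for n using path by eventually_elim blast
  qed auto
  then have Wlim: "(\<lambda>n. expectation (W n)) \<longlonglongrightarrow> 0" by simp
  obtain \<eta> where \<eta>: "0 < \<eta>"
    "eventually (\<lambda>n. \<eta> \<le> \<sigma> * (expectation (\<lambda>\<omega>. stopped (S n \<omega>) (n * 2^n)) - 1)) sequentially"
    using growth by blast
  from \<eta>(2) order_tendstoD(2)[OF Wlim \<eta>(1)] have "eventually (\<lambda>n::nat. False) sequentially"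
  proof eventually_elim
    case (elim n)
    have Wi: "integrable M (W n)"
    proof (rule integrable_const_bound[where B="8 powr \<beta>"])
      show "AE \<omega> in M. norm (W n \<omega>) \<le> 8 powr \<beta>" using path by eventually_elim blast
    qed measurable
    have "\<sigma> * (expectation (V n) - 1) = expectation (\<lambda>\<omega>. \<sigma> * (V n \<omega> - f n \<omega>))"
      using Vi fi fe by simp
    also have "\<dots> \<le> expectation (W n)"
      by (rule integral_mono[OF _ Wi]) (use Vi fi in \<open>auto simp: W_def\<close>)
    finally show ?case using elim by (simp add: V_def[abs_def])
  qed
  then show False by simp
qed

theorem theorem15:
  fixes \<beta> \<gamma> :: real and M :: "'a measure" and \<xi> :: "real \<Rightarrow> 'a \<Rightarrow> real"
  assumes "\<beta> \<in> {1<..} - real ` {2..}"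
    and "\<gamma> = min (\<beta> - 1) 2"
    and "spectrally_negative_stable_process M \<xi> 1 \<gamma>"
    and "\<forall>\<delta>\<in>{0<..<1}.
      1 = prob_space.expectation M (\<lambda>\<omega>.
        (let \<tau> = passage_time (\<lambda>t. \<xi> t \<omega>) \<delta> in
          \<xi> (real_of_ereal \<tau>) \<omega> powr (- \<beta>) *
          of_bool (\<forall>s\<ge>0. ereal s \<le> \<tau> \<longrightarrow>
            \<bar>jump (\<lambda>t. \<xi> t \<omega>) s\<bar> < left_limit (\<lambda>t. \<xi> t \<omega>) s / 2)))"
  shows "\<beta> = 3 / 2 \<or> \<beta> = 5 / 2"
proof (rule ccontr)
  assume "\<not> ?thesis"
  then have ne: "\<beta> \<noteq> 3/2" "\<beta> \<noteq> 5/2" by auto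
  interpret spectrally_negative_stable_process M \<xi> 1 \<gamma> by fact
  interpret stable_from_one M \<xi> \<gamma> ..
  obtain a c \<sigma> c0 where cut: "cutoff a c \<beta>" and side: "\<sigma> = 1 \<and> 1/2 < a \<or> \<sigma> = -1 \<and> c \<le> 1/2" and c0: "0 < c0"
    and ev: "eventually (\<lambda>e. c0 * e \<le> \<sigma> * (\<integral>y. cutoff.kap a c \<beta> (1 + y) - 1 \<partial>law e)) (at_right 0)"
    by (rule generator_sign[OF assms(1,2) ne, of law]) (auto simp: prob_space_law sets_law law_laplace)
  from ev obtain e0 where e0: "0 < e0" "\<And>e. 0 < e \<Longrightarrow> e < e0 \<Longrightarrow> c0 * e \<le> \<sigma> * (\<integral>y. cutoff.kap a c \<beta> (1 + y) - 1 \<partial>law e)"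
    unfolding eventually_at_right_field by auto
  interpret cutoff a c \<beta> by fact
  interpret stable_cutoff M \<xi> \<gamma> a c \<beta> \<sigma> c0 e0
    by unfold_locales (use side c0 e0 in auto)
  show False
  proof (rule no_invariant[OF side])
    fix d :: real assume "0 < d" "d < 1"
    then show "expectation (\<lambda>\<omega>. functional \<beta> (\<lambda>t. \<xi> t \<omega>) d) = 1"
      using assms(4) by (simp add: functional_def)
  qed
qed

end
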